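(* The discrete constrained energy functionals $E_{\delta,\varepsilon,h}$ approximate the continuous constrained energy functional $E$ in the sense of the following assertions. (i) Let $(y,b)\in V$ be admissible, i.e. $(y,b)\in\mathcal{A}_{\rm frame}$ and $y'\cdot b'=0$ a.e. in $(0,L)$. If $(\sigma,\varepsilon_1,\varepsilon_2,\delta)\to 0$ as $h\to 0$, with $\sigma>0$ being the parameter of the smooth approximating frames $(y_\sigma,b_\sigma)$ described in the context, such that $$h^2\varepsilon_1^{-1}+\sigma^2\varepsilon_2^{-1}+h^2[y,b]_\sigma^2\,\varepsilon_2^{-1}\to 0,$$ then there exists a sequence of discrete admissible pairs $(y_h,b_h)\in V_h$ with $y_h\to y$ in $H^2$ and $b_h\to b$ in $H^1$ as $h\to 0$ and such that $$E_{\delta,\varepsilon,h}[y_h,b_h]\to E[y,b].$$ (ii) For every bounded sequence $(y_h,b_h)\in V_h$ of discrete admissible pairs with weak limit $(y,b)\in V$, the limiting pair is admissible, i.e. $(y,b)\in\mathcal{A}_{\rm frame}$ and $y'\cdot b'=0$ a.e., and $$E[y,b]\le\liminf_{(\varepsilon,\delta,h)\to 0}E_{\delta,\varepsilon,h}[y_h,b_h].$$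
   Context: Let $L>0$, $V=H^2(0,L;\mathbb{R}^3)\times H^1(0,L;\mathbb{R}^3)$, and let $L_{\rm bc}$ be a bounded linear operator on $V$ that depends only on the boundary values (at $0$ and $L$) of $y$, $y'$ and $b$; $\ell_{\rm bc}$ is given data. Set $$\mathcal{A}_{\rm frame}=\{(y,b)\in V:\ [y',b,y'\times b]\in SO(3)\text{ a.e. in }(0,L),\ L_{\rm bc}[y,b]=\ell_{\rm bc}\}.$$ A pair $(y,b)$ is called admissible if $(y,b)\in\mathcal{A}_{\rm frame}$ and $y'\cdot b'=0$ a.e. The function $\overline{Q}$ is $\overline{Q}(\alpha,\beta)=(\alpha^2+\beta^2)^2/\alpha^2$ if $|\alpha|\ge|\beta|$ and $\overline{Q}(\alpha,\beta)=4\beta^2$ if $|\alpha|\le|\beta|$ (value $0$ at $(0,0)$). The continuous constrained functional is $E[y,b]=\int_0^L\overline{Q}(|y''|,|b'|)\,dx$ for admissible pairs $(y,b)$. Smooth approximating frames: for admissible $(y,b)$ and $\sigma>0$, $(y_\sigma,b_\sigma)\in[C^\infty(0,L;\mathbb{R}^3)]^2\cap\mathcal{A}_{\rm frame}$ denotes a pair with $$\|y-y_\sigma\|_{H^2(0,L)}+\|b-b_\sigma\|_{H^1(0,L)}+\|y_\sigma'\cdot b_\sigma'\|_{L^2(0,L)}\le\sigma,$$ and $[y,b]_\sigma=\|y_\sigma\|_{H^3(0,L)}+\|b_\sigma\|_{H^2(0,L)}$. Regularized modulus: for every $\delta>0$ a function $|\cdot|_\delta\in C^2(\mathbb{R};\mathbb{R}_{\ge0})$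 is given such that, with constants $c_0,c_1,c_2,c_{\rm uni}$ independent of $\delta$, $|x|_\delta\ge c_0\delta$, $\big|(|\cdot|_\delta)'\big|\le c_1$, $\big|(|\cdot|_\delta)''\big|\le c_2\delta^{-1}$, and $\big||x|_\delta-|x|\big|\le c_{\rm uni}\delta$ for all $x\in\mathbb{R}$. Set $$\psi_\delta(\alpha^2,\beta^2)=|\alpha^2-\beta^2|_\delta+\frac{4\beta^4}{\alpha^2+\beta^2+|\alpha^2-\beta^2|_\delta}.$$ Discretization: $\mathcal{T}_h$ is a quasiuniform family (minimal element length $\ge c\,h$) of partitions $0=x_0<x_1<\dots<x_N=L$ of $(0,L)$ with maximal element length $h$. $\mathcal{S}^{p,k}(\mathcal{T}_h)$ is the space of $C^k$ functions on $[0,L]$ that are polynomials of degree at most $p$ on each element. $V_h=\mathcal{S}^{3,1}(\mathcal{T}_h)^3\times\mathcal{S}^{1,0}(\mathcal{T}_h)^3\subset V$. A pair $(y_h,b_h)\in V_h$ is called discrete admissible if $|y_h'(x_j)|=|b_h(x_j)|=1$ for $j=0,\dots,N$ and $L_{\rm bc}[y_h,b_h]=\ell_{\rm bc}$. For $\delta>0$, $\varepsilon=(\varepsilon_1,\varepsilon_2)$ with $\varepsilon_1,\varepsilon_2>0$, and discrete admissible pairs, $$E_{\delta,\varepsilon,h}[y_h,b_h]=\frac12\int_0^L|y_h''|^2+5|b_h'|^2+\psi_\delta(|y_h''|^2,|b_h'|^2)\,dx+\frac1{2\varepsilon_1}\int_0^L(y_h'\cdot b_h)^2dx+\frac1{2\varepsilon_2}\int_0^L(y_h'\cdot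 b_h')^2dx.$$
   Formalization: In (ii), admissibility of the limit is asserted only if the liminf of the discrete energies is finite; for sequences merely bounded in V it fails, e.g. y_h=(x,0,0), b_h=(1,0,0) with L_bc=0, ℓ_bc=0, where y'·b=1. The liminf inequality is proved without this condition. *)

theory Defs
  imports "HOL-Analysis.Analysis" "HOL-Computational_Algebra.Polynomial"
begin

section \<open>Classical and weak differentiability on an interval\<close>

text \<open>The derivative is taken within \<open>S\<close>, hence one-sided at the end points of a compact interval.\<close>

primrec Ck_on :: "nat \<Rightarrow> real set \<Rightarrow> (real \<Rightarrow> 'a::real_normed_vector) \<Rightarrow> bool" where
  "Ck_on 0 S f \<longleftrightarrow> continuous_on S f"
| "Ck_on (Suc k) S f \<longleftrightarrow> (\<forall>x\<in>S. f differentiable (at x within S)) \<and>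
     Ck_on k S (\<lambda>x. vector_derivative f (at x within S))"

definition smooth_on :: "real set \<Rightarrow> (real \<Rightarrow> 'a::real_normed_vector) \<Rightarrow> bool" where
  "smooth_on S f \<longleftrightarrow> (\<forall>k. Ck_on k S f)"

definition test_functions :: "real \<Rightarrow> (real \<Rightarrow> real) set" where
  "test_functions L = {\<phi>. smooth_on UNIV \<phi> \<and>
     (\<exists>a b. 0 < a \<and> b < L \<and> (\<forall>x. x \<notin> {a..b} \<longrightarrow> \<phi> x = 0))}"

text \<open>Elements of Lebesgue and Sobolev spaces on the interval \<open>(0, L)\<close> are represented by functions
  on \<open>real\<close>; their values outside of \<open>(0, L)\<close> and on null sets are irrelevant.\<close>

definition has_weak_deriv ::
    "real \<Rightarrow> (real \<Rightarrow> 'a::euclidean_space) \<Rightarrow> (real \<Rightarrow> 'a) \<Rightarrow> bool" where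
  "has_weak_deriv L f g \<longleftrightarrow>
     integrable (lebesgue_on {0<..<L}) f \<and> integrable (lebesgue_on {0<..<L}) g \<and>
     (\<forall>\<phi>\<in>test_functions L.
        (\<integral>x. deriv \<phi> x *\<^sub>R f x \<partial>lebesgue_on {0<..<L}) =
        - (\<integral>x. \<phi> x *\<^sub>R g x \<partial>lebesgue_on {0<..<L}))"

text \<open>The weak derivative is unique up to null sets; \<open>wderiv\<close> selects a representative.\<close>

definition wderiv :: "real \<Rightarrow> (real \<Rightarrow> 'a::euclidean_space) \<Rightarrow> real \<Rightarrow> 'a" where
  "wderiv L f = (SOME g. has_weak_deriv L f g)"

definition L2 :: "real \<Rightarrow> (real \<Rightarrow> 'a::euclidean_space) set" where
  "L2 L = {f. f \<in> borel_measurable (lebesgue_on {0<..<L}) \<and>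
              integrable (lebesgue_on {0<..<L}) (\<lambda>x. (norm (f x))\<^sup>2)}"

definition L2_norm :: "real \<Rightarrow> (real \<Rightarrow> 'a::euclidean_space) \<Rightarrow> real" where
  "L2_norm L f = sqrt (\<integral>x. (norm (f x))\<^sup>2 \<partial>lebesgue_on {0<..<L})"

primrec Hsob :: "nat \<Rightarrow> real \<Rightarrow> (real \<Rightarrow> 'a::euclidean_space) set" where
  "Hsob 0 L = L2 L"
| "Hsob (Suc k) L = {f \<in> L2 L. \<exists>g. has_weak_deriv L f g \<and> g \<in> Hsob k L}"

definition Hsob_norm :: "nat \<Rightarrow> real \<Rightarrow> (real \<Rightarrow> 'a::euclidean_space) \<Rightarrow> real" where
  "Hsob_norm k L f = sqrt (\<Sum>j\<le>k. (L2_norm L ((wderiv L ^^ j) f))\<^sup>2)"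

text \<open>Point values of an \<open>H\<^sup>1\<close> function on the closed interval are those of its continuous
  representative.\<close>

definition cont_rep :: "real \<Rightarrow> (real \<Rightarrow> 'a::euclidean_space) \<Rightarrow> real \<Rightarrow> 'a" where
  "cont_rep L f = (SOME g. continuous_on {0..L} g \<and>
     (AE x in lebesgue_on {0<..<L}. g x = f x))"


section \<open>Framed curves\<close>

type_synonym curve = "real \<Rightarrow> real ^ 3"

definition V :: "real \<Rightarrow> (curve \<times> curve) set" where
  "V L = Hsob 2 L \<times> Hsob 1 L"

definition V_norm :: "real \<Rightarrow> curve \<times> curve \<Rightarrow> real" where
  "V_norm L u = sqrt ((Hsob_norm 2 L (fst u))\<^sup>2 + (Hsob_norm 1 L (snd u))\<^sup>2)"

definition V_add :: "curve \<times> curve \<Rightarrow> curve \<times> curve \<Rightarrow> curve \<times> curve" where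
  "V_add u v = ((\<lambda>x. fst u x + fst v x), (\<lambda>x. snd u x + snd v x))"

definition V_scale :: "real \<Rightarrow> curve \<times> curve \<Rightarrow> curve \<times> curve" where
  "V_scale c u = ((\<lambda>x. c *\<^sub>R fst u x), (\<lambda>x. c *\<^sub>R snd u x))"

text \<open>Boundedness forces such a map to agree on almost everywhere equal representatives.\<close>

definition bounded_linear_V ::
    "real \<Rightarrow> (curve \<times> curve \<Rightarrow> 'z::real_normed_vector) \<Rightarrow> bool" where
  "bounded_linear_V L F \<longleftrightarrow>
     (\<forall>u\<in>V L. \<forall>v\<in>V L. F (V_add u v) = F u + F v) \<and>
     (\<forall>c. \<forall>u\<in>V L. F (V_scale c u) = c *\<^sub>R F u) \<and>
     (\<exists>C. \<forall>u\<in>V L. norm (F u) \<le> C * V_norm L u)"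

definition weakly_converges_V ::
    "real \<Rightarrow> (nat \<Rightarrow> curve \<times> curve) \<Rightarrow> curve \<times> curve \<Rightarrow> bool" where
  "weakly_converges_V L u v \<longleftrightarrow>
     (\<forall>F :: curve \<times> curve \<Rightarrow> real. bounded_linear_V L F \<longrightarrow> (\<lambda>n. F (u n)) \<longlonglongrightarrow> F v)"

definition depends_on_boundary_values ::
    "real \<Rightarrow> (curve \<times> curve \<Rightarrow> 'z) \<Rightarrow> bool" where
  "depends_on_boundary_values L F \<longleftrightarrow>
     (\<forall>y b z d. (y, b) \<in> V L \<and> (z, d) \<in> V L \<and>
        (\<forall>x\<in>{0, L}. cont_rep L y x = cont_rep L z x \<and>
                     cont_rep L (wderiv L y) x = cont_rep L (wderiv L z) x \<and>
                     cont_rep L b x = cont_rep L d x)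
      \<longrightarrow> F (y, b) = F (z, d))"

text \<open>\<open>vector\<close> lists the rows of a matrix, whence the transposition.\<close>

definition A_frame ::
    "real \<Rightarrow> (curve \<times> curve \<Rightarrow> 'z) \<Rightarrow> 'z \<Rightarrow> (curve \<times> curve) set" where
  "A_frame L Lbc lbc = {(y, b). (y, b) \<in> V L \<and>
     (AE x in lebesgue_on {0<..<L}. rotation_matrix
        (transpose (vector [wderiv L y x, b x, cross3 (wderiv L y x) (b x)] :: real ^ 3 ^ 3))) \<and>
     Lbc (y, b) = lbc}"

definition admissible ::
    "real \<Rightarrow> (curve \<times> curve \<Rightarrow> 'z) \<Rightarrow> 'z \<Rightarrow> (curve \<times> curve) set" where
  "admissible L Lbc lbc = {(y, b). (y, b) \<in> A_frame L Lbc lbc \<and>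
     (AE x in lebesgue_on {0<..<L}. wderiv L y x \<bullet> wderiv L b x = 0)}"

text \<open>At the origin the first branch yields \<open>0 / 0 = 0\<close>; for \<open>\<bar>\<alpha>\<bar> = \<bar>\<beta>\<bar>\<close> both formulas agree.\<close>

definition Qbar :: "real \<Rightarrow> real \<Rightarrow> real" where
  "Qbar \<alpha> \<beta> = (if \<bar>\<alpha>\<bar> \<ge> \<bar>\<beta>\<bar> then (\<alpha>\<^sup>2 + \<beta>\<^sup>2)\<^sup>2 / \<alpha>\<^sup>2 else 4 * \<beta>\<^sup>2)"

definition energy :: "real \<Rightarrow> curve \<times> curve \<Rightarrow> real" where
  "energy L = (\<lambda>(y, b).
     \<integral>x. Qbar (norm (wderiv L (wderiv L y) x)) (norm (wderiv L b x)) \<partial>lebesgue_on {0<..<L})"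

text \<open>\<open>C\<^sup>\<infinity>\<close> is understood on the open interval; membership in \<open>H\<^sup>3\<close> and \<open>H\<^sup>2\<close> expresses that
  the quantity \<open>frame_size\<close> below is finite.\<close>

definition smooth_frame_approx ::
    "real \<Rightarrow> (curve \<times> curve \<Rightarrow> 'z) \<Rightarrow> 'z \<Rightarrow> real \<Rightarrow> curve \<times> curve \<Rightarrow> curve \<times> curve \<Rightarrow> bool" where
  "smooth_frame_approx L Lbc lbc \<sigma> = (\<lambda>(y, b) (ys, bs).
     smooth_on {0<..<L} ys \<and> smooth_on {0<..<L} bs \<and>
     ys \<in> Hsob 3 L \<and> bs \<in> Hsob 2 L \<and> (ys, bs) \<in> A_frame L Lbc lbc \<and>
     Hsob_norm 2 L (\<lambda>x. y x - ys x) + Hsob_norm 1 L (\<lambda>x. b x - bs x) +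
       L2_norm L (\<lambda>x. wderiv L ys x \<bullet> wderiv L bs x) \<le> \<sigma>)"

definition frame_size :: "real \<Rightarrow> curve \<times> curve \<Rightarrow> real" where
  "frame_size L = (\<lambda>(ys, bs). Hsob_norm 3 L ys + Hsob_norm 2 L bs)"


section \<open>Regularization and discretization\<close>

definition regularized_modulus ::
    "(real \<Rightarrow> real \<Rightarrow> real) \<Rightarrow> real \<Rightarrow> real \<Rightarrow> real \<Rightarrow> real \<Rightarrow> bool" where
  "regularized_modulus m c0 c1 c2 cuni \<longleftrightarrow> (\<forall>\<delta>>0. Ck_on 2 UNIV (m \<delta>) \<and>
     (\<forall>x. m \<delta> x \<ge> c0 * \<delta> \<and> \<bar>deriv (m \<delta>) x\<bar> \<le> c1 \<and>
          \<bar>deriv (deriv (m \<delta>)) x\<bar> \<le> c2 / \<delta> \<and> \<bar>m \<delta> x - \<bar>x\<bar>\<bar> \<le> cuni * \<delta>))"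

text \<open>The arguments \<open>s\<close> and \<open>t\<close> are the squares \<open>\<alpha>\<^sup>2\<close> and \<open>\<beta>\<^sup>2\<close>, so that
  \<open>4 * t\<^sup>2\<close> is \<open>4 * \<beta>^4\<close>; \<open>m\<close> is the regularized modulus.\<close>

definition psi :: "(real \<Rightarrow> real) \<Rightarrow> real \<Rightarrow> real \<Rightarrow> real" where
  "psi m s t = m (s - t) + 4 * t\<^sup>2 / (s + t + m (s - t))"

definition mesh :: "real \<Rightarrow> nat \<Rightarrow> (nat \<Rightarrow> real) \<Rightarrow> bool" where
  "mesh L N x \<longleftrightarrow> N \<ge> 1 \<and> x 0 = 0 \<and> x N = L \<and> (\<forall>j<N. x j < x (Suc j))"

definition mesh_size :: "nat \<Rightarrow> (nat \<Rightarrow> real) \<Rightarrow> real" where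
  "mesh_size N x = Max ((\<lambda>j. x (Suc j) - x j) ` {..<N})"

definition quasiuniform_family :: "real \<Rightarrow> (nat \<Rightarrow> nat) \<Rightarrow> (nat \<Rightarrow> nat \<Rightarrow> real) \<Rightarrow> bool" where
  "quasiuniform_family L N x \<longleftrightarrow> (\<forall>n. mesh L (N n) (x n)) \<and>
     (\<exists>c>0. \<forall>n. \<forall>j<N n. c * mesh_size (N n) (x n) \<le> x n (Suc j) - x n j)"

definition spline :: "nat \<Rightarrow> nat \<Rightarrow> real \<Rightarrow> nat \<Rightarrow> (nat \<Rightarrow> real) \<Rightarrow> (real \<Rightarrow> real) set" where
  "spline p k L N x = {v. Ck_on k {0..L} v \<and>
     (\<forall>j<N. \<exists>q :: real poly. degree q \<le> p \<and> (\<forall>t\<in>{x j..x (Suc j)}. v t = poly q t))}"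

definition V_disc :: "real \<Rightarrow> nat \<Rightarrow> (nat \<Rightarrow> real) \<Rightarrow> (curve \<times> curve) set" where
  "V_disc L N x = {(y, b). (\<forall>i. (\<lambda>t. y t $ i) \<in> spline 3 1 L N x) \<and>
                           (\<forall>i. (\<lambda>t. b t $ i) \<in> spline 1 0 L N x)}"

definition disc_admissible ::
    "real \<Rightarrow> (curve \<times> curve \<Rightarrow> 'z) \<Rightarrow> 'z \<Rightarrow> nat \<Rightarrow> (nat \<Rightarrow> real) \<Rightarrow> (curve \<times> curve) set" where
  "disc_admissible L Lbc lbc N x = {(y, b). (y, b) \<in> V_disc L N x \<and>
     (\<forall>j\<le>N. norm (vector_derivative y (at (x j) within {0..L})) = 1 \<and> norm (b (x j)) = 1) \<and>
     Lbc (y, b) = lbc}"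

text \<open>The discretization parameter enters only through the argument, which is taken from the
  discrete space.\<close>

definition energy_disc ::
    "real \<Rightarrow> (real \<Rightarrow> real) \<Rightarrow> real \<Rightarrow> real \<Rightarrow> curve \<times> curve \<Rightarrow> real" where
  "energy_disc L m \<epsilon>1 \<epsilon>2 = (\<lambda>(y, b).
     1 / 2 * (\<integral>x. (norm (wderiv L (wderiv L y) x))\<^sup>2 + 5 * (norm (wderiv L b x))\<^sup>2
        + psi m ((norm (wderiv L (wderiv L y) x))\<^sup>2) ((norm (wderiv L b x))\<^sup>2)
        \<partial>lebesgue_on {0<..<L})
     + 1 / (2 * \<epsilon>1) * (\<integral>x. (wderiv L y x \<bullet> b x)\<^sup>2 \<partial>lebesgue_on {0<..<L})
     + 1 / (2 * \<epsilon>2) * (\<integral>x. (wderiv L y x \<bullet> wderiv L b x)\<^sup>2 \<partial>lebesgue_on {0<..<L}))"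

end

theory Submission
  imports Defs
begin

text \<open>The integrand has the representation
  \<open>Qbar \<alpha> \<beta> = max {(1 - l\<^sup>2) \<alpha>\<^sup>2 + 2 (1 + l) \<beta>\<^sup>2 | 0 \<le> l \<le> 1}\<close>, so that the limit energy is a supremum of
  nonnegative quadratic forms: it is weakly lower semicontinuous, and its integrand is Lipschitz
  continuous in \<open>\<alpha>\<^sup>2\<close> and \<open>\<beta>\<^sup>2\<close>. The regularized integrand differs from \<open>Qbar\<close> by at most a constant
  times \<open>\<delta>\<close>, uniformly.

  For the lower bound, point values of \<open>H\<^sup>1\<close> functions are weakly continuous, which together with the
  uniform Hoelder estimate passes the nodal constraints to the limit, while the penalty terms enforce
  the orthogonality relations. The boundary condition survives because a functional of boundary values
  factors through a finite-dimensional space.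

  For the upper bound, the smooth frames are interpolated. The element error of the highest derivative
  is that of an \<open>L\<^sup>2\<close> projection, hence of order \<open>h\<close> times the norm of the next derivative; the
  interpolant of the frame is orthogonal at the nodes, which makes the first penalty term of order
  \<open>h\<^sup>2 / \<epsilon>\<^sub>1\<close>.\<close>

section \<open>Smooth test functions\<close>

text \<open>Derivatives and point values are encoded by choice: \<open>wderiv\<close> and
  \<open>cont_rep\<close> select representatives, so even additivity of \<open>wderiv\<close> holds
  only almost everywhere. The bridge to pointwise arguments is that a function with weak derivative
  \<open>g\<close> is almost everywhere a constant plus the primitive of \<open>g\<close>; this is
  derived from the test function definition and carries all estimates. In the lower bound, nodal
  constraints alone do not force any orthogonality. The penalties do, but they need an energy bound,
  which a finite lower limit supplies along a subsequence only. In the upper bound, the discrete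
  pair has to match the frame exactly at the nodes (unit length, boundary data) and still be near
  optimal in y'' and b'. Projecting the highest derivatives elementwise and integrating up from 0
  achieves both. With \<kappa> = h [y,b]_\<sigma> the second penalty then costs at most a multiple
  of (\<sigma>^2 + \<kappa>^2) / \<epsilon>2. The first penalty is bounded by the norms of the
  discrete y'' and b', which stay bounded, so no frame size appears next to 1 / \<epsilon>1.\<close>

lemma Ck_on_UNIV_SucI:
  assumes "\<And>x. (f has_vector_derivative f' x) (at x)" "Ck_on k UNIV f'"
  shows "Ck_on (Suc k) UNIV f"
proof -
  have "(\<lambda>x. vector_derivative f (at x)) = f'"
    using assms(1) by (auto simp: vector_derivative_at)
  then show ?thesis
    using assms by (auto intro: differentiableI_vector)
qed

lemma Ck_on_UNIV_SucE:
  assumes "Ck_on (Suc k) UNIV f"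
  obtains f' where "\<And>x. (f has_vector_derivative f' x) (at x)" "Ck_on k UNIV f'"
  using assms that[of "\<lambda>x. vector_derivative f (at x)"] by (simp add: vector_derivative_works)

lemma Ck_on_UNIV_Suc_imp: "Ck_on (Suc k) UNIV f \<Longrightarrow> Ck_on k UNIV f"
proof (induction k arbitrary: f)
  case 0
  then show ?case
    by (auto intro!: differentiable_imp_continuous_on simp: differentiable_on_def)
next
  case (Suc k)
  then show ?case by (metis Ck_on.simps(2))
qed

lemma Ck_on_UNIV_const: "Ck_on k UNIV (\<lambda>x. c)"
proof (induction k arbitrary: c)
  case (Suc k)
  show ?case by (rule Ck_on_UNIV_SucI[OF _ Suc[of 0]]) (auto intro!: derivative_eq_intros)
qed auto

lemma Ck_on_UNIV_add: "Ck_on k UNIV f \<Longrightarrow> Ck_on k UNIV g \<Longrightarrow> Ck_on k UNIV (\<lambda>x. f x + g x)"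
proof (induction k arbitrary: f g)
  case (Suc k)
  obtain f' g' where "\<And>x. (f has_vector_derivative f' x) (at x)" "Ck_on k UNIV f'"
     "\<And>x. (g has_vector_derivative g' x) (at x)" "Ck_on k UNIV g'"
    by (meson Suc.prems Ck_on_UNIV_SucE)
  then show ?case
    by (intro Ck_on_UNIV_SucI[where f' = "\<lambda>x. f' x + g' x"] Suc.IH) (auto intro: has_vector_derivative_add)
qed (auto intro: continuous_intros)

lemma Ck_on_UNIV_mult:
  fixes f g :: "real \<Rightarrow> real"
  shows "Ck_on k UNIV f \<Longrightarrow> Ck_on k UNIV g \<Longrightarrow> Ck_on k UNIV (\<lambda>x. f x * g x)"
proof (induction k arbitrary: f g)
  case (Suc k)
  obtain f' g' where d: "\<And>x. (f has_vector_derivative f' x) (at x)" "Ck_on k UNIV f'"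
     "\<And>x. (g has_vector_derivative g' x) (at x)" "Ck_on k UNIV g'"
    by (meson Suc.prems Ck_on_UNIV_SucE)
  show ?case
  proof (rule Ck_on_UNIV_SucI)
    show "((\<lambda>x. f x * g x) has_vector_derivative f x * g' x + f' x * g x) (at x)" for x
      using d by (intro has_vector_derivative_mult)
    show "Ck_on k UNIV (\<lambda>x. f x * g' x + f' x * g x)"
      using d Suc.prems by (intro Ck_on_UNIV_add Suc.IH) (auto intro: Ck_on_UNIV_Suc_imp)
  qed
qed (auto intro: continuous_intros)

lemma Ck_on_UNIV_affine:
  fixes f :: "real \<Rightarrow> real"
  shows "Ck_on k UNIV f \<Longrightarrow> Ck_on k UNIV (\<lambda>x. f (c * x + d))"
proof (induction k arbitrary: f)
  case (Suc k)
  obtain f' where d: "\<And>x. (f has_vector_derivative f' x) (at x)" "Ck_on k UNIV f'"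
    by (meson Suc.prems Ck_on_UNIV_SucE)
  show ?case
  proof (rule Ck_on_UNIV_SucI)
    show "((\<lambda>x. f (c * x + d)) has_vector_derivative c * f' (c * x + d)) (at x)" for x
    proof -
      have "(f has_real_derivative f' (c * x + d)) (at (c * x + d))"
        using d(1) by (simp add: has_real_derivative_iff_has_vector_derivative)
      then have "((\<lambda>x. f (c * x + d)) has_real_derivative f' (c * x + d) * c) (at x)"
        by (rule DERIV_chain2) (auto intro!: derivative_eq_intros)
      then show ?thesis
        by (simp add: has_real_derivative_iff_has_vector_derivative mult.commute)
    qed
    show "Ck_on k UNIV (\<lambda>x. c * f' (c * x + d))"
      using Ck_on_UNIV_mult[OF Ck_on_UNIV_const Suc.IH[OF d(2)]] .
  qed
next
  case 0
  then show ?case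
    by (auto intro!: continuous_intros continuous_on_compose2[of UNIV f UNIV "\<lambda>x. c * x + d"])
qed

lemma smooth_on_UNIV_derivI:
  assumes "\<And>x. (f has_vector_derivative f' x) (at x)" "smooth_on UNIV f'"
  shows "smooth_on UNIV f"
  unfolding smooth_on_def
  by (metis Ck_on_UNIV_SucI Ck_on_UNIV_Suc_imp assms smooth_on_def)

lemma smooth_on_UNIV_deriv:
  fixes f :: "real \<Rightarrow> real"
  assumes "smooth_on UNIV f"
  shows "(f has_real_derivative deriv f x) (at x)" "smooth_on UNIV (deriv f)"
proof -
  have d: "\<exists>D. (f has_real_derivative D) (at x)" for x
    using assms unfolding smooth_on_def has_real_derivative_iff_has_vector_derivative
    by (metis Ck_on_UNIV_SucE)
  then show *: "(f has_real_derivative deriv f x) (at x)" for x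
    by (metis DERIV_imp_deriv)
  have "vector_derivative f (at x) = deriv f x" for x
    using *[of x] by (simp add: has_real_derivative_iff_has_vector_derivative vector_derivative_at)
  then show "smooth_on UNIV (deriv f)"
    using assms unfolding smooth_on_def
    by (metis (no_types, lifting) Ck_on.simps(2) ext)
qed

lemma smooth_on_UNIV_mult:
  fixes f g :: "real \<Rightarrow> real"
  shows "smooth_on UNIV f \<Longrightarrow> smooth_on UNIV g \<Longrightarrow> smooth_on UNIV (\<lambda>x. f x * g x)"
  by (simp add: smooth_on_def Ck_on_UNIV_mult)

lemma smooth_on_UNIV_affine:
  fixes f :: "real \<Rightarrow> real"
  shows "smooth_on UNIV f \<Longrightarrow> smooth_on UNIV (\<lambda>x. f (c * x + d))"
  by (simp add: smooth_on_def Ck_on_UNIV_affine)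

text \<open>The class of functions p(1/x) exp(-1/x), continued by 0, is closed under
  differentiation. One induction on the order of differentiability with arbitrary \<open>p\<close>
  therefore gives smoothness, the origin included. The member with \<open>p = 1\<close> is the usual
  building block of bump functions.\<close>

definition flat_exp :: "real poly \<Rightarrow> real \<Rightarrow> real" where
  "flat_exp p x = (if x \<le> 0 then 0 else poly p (1 / x) * exp (- (1 / x)))"

lemma poly_times_exp_minus_tendsto_0: "((\<lambda>t. poly p t * exp (- t)) \<longlongrightarrow> (0::real)) at_top"
proof -
  have "((\<lambda>t. \<Sum>i\<le>degree p. coeff p i * (t ^ i / exp t)) \<longlongrightarrow> (\<Sum>i\<le>degree p. coeff p i * 0)) at_top"
    by (intro tendsto_intros tendsto_power_div_exp_0)
  moreover have "(\<lambda>t. \<Sum>i\<le>degree p. coeff p i * (t ^ i / exp t)) = (\<lambda>t. poly p t * exp (- t))"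
    by (simp add: poly_altdef sum_distrib_right exp_minus divide_inverse mult.assoc)
  ultimately show ?thesis by simp
qed

text \<open>Differentiation in \<open>t = 1 / x\<close> contributes the factor \<open>- t\<^sup>2\<close>.\<close>

lemma flat_exp_deriv:
  "(flat_exp p has_real_derivative flat_exp ([:0, 0, 1:] * (p - pderiv p)) x) (at x)"
proof (cases x "0::real" rule: linorder_cases)
  case less
  have "(flat_exp p has_real_derivative 0) (at x)"
    by (rule DERIV_cong_ev[THEN iffD2, of x x _ "\<lambda>x. 0"])
       (auto simp: flat_exp_def intro!: eventually_mono[OF eventually_nhds_in_open[of "{..<0}" x]] less)
  then show ?thesis using less by (simp add: flat_exp_def)
next
  case greater
  have "((\<lambda>x. poly p (1 / x) * exp (- (1 / x))) has_real_derivative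
         flat_exp ([:0, 0, 1:] * (p - pderiv p)) x) (at x)"
    using greater
    by (auto intro!: derivative_eq_intros DERIV_chain2[where f="poly p"] simp: flat_exp_def)
       (simp add: field_simps)
  then show ?thesis
    by (rule DERIV_cong_ev[THEN iffD2, rotated -1, OF _ refl _ refl])
       (auto simp: flat_exp_def intro!: eventually_mono[OF eventually_nhds_in_open[of "{0<..}" x]] greater)
next
  case equal
  have r: "((\<lambda>y. flat_exp p y / y) \<longlongrightarrow> 0) (at_right 0)"
  proof -
    \<comment> \<open>The difference quotient at 0 is \<open>flat_exp p y / y\<close>. With t = 1 /
      y the division turns into multiplication by t, which is what \<open>pCons 0 p\<close>
      encodes.\<close>
    have "((\<lambda>y. poly (pCons 0 p) (inverse y) * exp (- (inverse y))) \<longlongrightarrow> (0::real)) (at_right 0)"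
      by (rule filterlim_compose[OF poly_times_exp_minus_tendsto_0 filterlim_inverse_at_top_right])
    then show ?thesis
      by (rule Lim_transform_eventually)
         (auto simp: flat_exp_def field_simps eventually_at_filter)
  qed
  have l: "((\<lambda>y. flat_exp p y / y) \<longlongrightarrow> 0) (at_left 0)"
    by (rule Lim_transform_eventually[OF tendsto_const])
       (auto simp: flat_exp_def eventually_at_filter)
  have "((\<lambda>y. flat_exp p y / y) \<longlongrightarrow> 0) (at 0)"
    using l r by (simp add: filterlim_split_at)
  then show ?thesis
    using equal by (simp add: DERIV_def flat_exp_def)
qed

lemma smooth_flat_exp: "smooth_on UNIV (flat_exp p)"
proof -
  have "Ck_on k UNIV (flat_exp p)" for k
  proof (induction k arbitrary: p)
    case 0
    show ?case using flat_exp_deriv by (auto intro!: DERIV_continuous_on)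
  next
    case (Suc k)
    show ?case
      by (rule Ck_on_UNIV_SucI[OF _ Suc])
         (use flat_exp_deriv in \<open>simp add: has_real_derivative_iff_has_vector_derivative\<close>)
  qed
  then show ?thesis by (simp add: smooth_on_def)
qed

text \<open>A product of a rising and a falling copy of \<open>flat_exp 1\<close>, compressed by the
  factor \<open>K n\<close>. The shift by 1 moves the edges of the support to
  \<open>a + 1 / K n\<close> and \<open>b - 1 / K n\<close>, so it is compact in (0, L) even if a =
  0 and b = L. The bounds 0 and 1 prepare dominated convergence.\<close>

lemma test_function_between:
  assumes "0 \<le> a" "a < b" "b \<le> L"
  obtains \<phi> where "\<And>n. \<phi> n \<in> test_functions L" "\<And>n x. 0 \<le> \<phi> n x \<and> \<phi> n x \<le> (1::real)"
    "\<And>x. (\<lambda>n. \<phi> n x) \<longlonglongrightarrow> indicator {a<..<b} x"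
proof -
  define \<rho> where "\<rho> = flat_exp 1"
  \<comment> \<open>Larger than 2 / (b - a), which keeps \<open>a + 1 / K n\<close> to the left of
    \<open>b - 1 / K n\<close>; the factor \<open>Suc n\<close> makes both transitions arbitrarily
    steep.\<close>
  define K where "K n = Suc n * (2 / (b - a) + 1)" for n
  define \<phi> where "\<phi> n x = \<rho> (K n * x + (- K n * a - 1)) * \<rho> ((- K n) * x + (K n * b - 1))" for n x
  have Kpos: "K n > 0" for n unfolding K_def using assms by (intro mult_pos_pos) (auto simp: field_simps)
  have \<rho>: "0 \<le> \<rho> x" "\<rho> x \<le> 1" for x by (auto simp: \<rho>_def flat_exp_def)
  have \<rho>0: "\<rho> x = 0" if "x \<le> 0" for x using that by (auto simp: \<rho>_def flat_exp_def)
  have Kt: "filterlim K at_top sequentially"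
  proof -
    have "0 < 2 / (b - a) + 1" using assms by (auto simp: field_simps)
    then show ?thesis unfolding K_def
      by (intro filterlim_at_top_mult_tendsto_pos[OF tendsto_const] filterlim_compose[OF filterlim_real_sequentially filterlim_Suc])
  qed
  have Kab: "0 < a + 1 / K n" "b - 1 / K n < L" for n
  proof -
    have "1 / K n > 0" using Kpos by simp
    then show "0 < a + 1 / K n" "b - 1 / K n < L" using assms by linarith+
  qed
  show ?thesis
  proof
    show "\<phi> n \<in> test_functions L" for n
    proof -
      have "smooth_on UNIV (\<phi> n)" unfolding \<phi>_def \<rho>_def
        by (intro smooth_on_UNIV_mult smooth_on_UNIV_affine smooth_flat_exp)
      moreover have "\<phi> n x = 0" if "x \<notin> {a + 1 / K n .. b - 1 / K n}" for x
      proof -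
        have "K n * x + (- K n * a - 1) \<le> 0 \<or> (- K n) * x + (K n * b - 1) \<le> 0"
          using that Kpos[of n] by (auto simp: field_simps)
        then show ?thesis using \<rho>0 by (auto simp: \<phi>_def)
      qed
      ultimately show ?thesis
        unfolding test_functions_def using Kab[of n] by blast
    qed
    show "0 \<le> \<phi> n x \<and> \<phi> n x \<le> 1" for n x
      unfolding \<phi>_def using \<rho> by (auto intro!: mult_nonneg_nonneg mult_le_one)
    show "(\<lambda>n. \<phi> n x) \<longlonglongrightarrow> indicator {a<..<b} x" for x
    proof (cases "x \<in> {a<..<b}")
      case False
      have "\<phi> n x = 0" for n
      proof -
        have "K n * x \<le> K n * a \<or> K n * b \<le> K n * x" using False Kpos[of n] by (auto)
        then have "K n * x + (- K n * a - 1) \<le> 0 \<or> (- K n) * x + (K n * b - 1) \<le> 0" by auto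
        then show ?thesis using \<rho>0 by (auto simp: \<phi>_def)
      qed
      then show ?thesis using False by simp
    next
      case True
      have \<rho>t: "(\<rho> \<longlongrightarrow> 1) at_top"
      proof -
        have "((\<lambda>x. exp (- inverse x)) \<longlongrightarrow> exp (- (0::real))) at_top"
          by (intro tendsto_intros tendsto_inverse_0_at_top filterlim_ident)
        then have "((\<lambda>x. exp (- inverse x)) \<longlongrightarrow> (1::real)) at_top" by simp
        then show ?thesis
          by (rule Lim_transform_eventually)
             (auto intro!: eventually_mono[OF eventually_gt_at_top[of 0]] simp: \<rho>_def flat_exp_def inverse_eq_divide)
      qed
      have A: "filterlim (\<lambda>n. (- 1) + K n * (x - a)) at_top sequentially"
        using True by (intro filterlim_tendsto_add_at_top[OF tendsto_const] filterlim_at_top_mult_tendsto_pos[OF tendsto_const _ Kt]) auto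
      have B: "filterlim (\<lambda>n. (- 1) + K n * (b - x)) at_top sequentially"
        using True by (intro filterlim_tendsto_add_at_top[OF tendsto_const] filterlim_at_top_mult_tendsto_pos[OF tendsto_const _ Kt]) auto
      have "(\<lambda>n. \<rho> ((- 1) + K n * (x - a)) * \<rho> ((- 1) + K n * (b - x))) \<longlonglongrightarrow> 1 * 1"
        by (intro tendsto_mult filterlim_compose[OF \<rho>t] A B)
      moreover have "\<phi> n x = \<rho> ((- 1) + K n * (x - a)) * \<rho> ((- 1) + K n * (b - x))" for n
        unfolding \<phi>_def by (simp add: algebra_simps)
      ultimately show ?thesis using True by simp
    qed
  qed
qed

section \<open>The fundamental lemma of the calculus of variations\<close>

abbreviation interval_measure :: "real \<Rightarrow> real measure" (\<open>\<mu>\<close>) where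
  "\<mu> L \<equiv> lebesgue_on {0<..<L}"

lemma finite_measure_interval: "finite_measure (\<mu> L)"
  by (rule finite_measure_lebesgue_on) simp

lemma sigma_finite_measure_interval: "sigma_finite_measure (\<mu> L)"
  using finite_measure_interval by (rule finite_measure.axioms(1))

lemma AE_interval_iff: "(AE x in \<mu> L. P x) \<longleftrightarrow> (AE x in lebesgue. x \<in> {0<..<L} \<longrightarrow> P x)"
  by (rule AE_restrict_space_iff) simp

lemma AE_intervalI: "(\<And>x. 0 < x \<Longrightarrow> x < L \<Longrightarrow> P x) \<Longrightarrow> AE x in \<mu> L. P x"
  by (auto simp: AE_interval_iff)

lemma sigma_finite_lebesgue: "sigma_finite_measure (lebesgue :: real measure)"
proof
  let ?A = "range (\<lambda>n. {- real n..real n})"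
  have "emeasure lebesgue a \<noteq> \<infinity>" if "a \<in> ?A" for a
    using that lmeasurable_interval(1) by (auto simp: fmeasurable_def)
  moreover have "\<exists>n. x \<in> {- real n..real n}" for x
    using real_arch_simple[of "\<bar>x\<bar>"] by (auto simp: abs_le_iff minus_le_iff)
  then have "\<Union>?A = space lebesgue" by auto
  moreover have "countable ?A" "?A \<subseteq> sets lebesgue" by auto
  ultimately show "\<exists>A. countable A \<and> A \<subseteq> sets (lebesgue :: real measure) \<and> \<Union>A = space lebesgue \<and>
      (\<forall>a\<in>A. emeasure lebesgue a \<noteq> \<infinity>)"
    by blast
qed

lemma borel_eq_greaterThanLessThan: "borel = sigma UNIV (range (\<lambda>(a, b). {a<..<b::real}))"
  using borel_eq_box[where 'a = real] by simp

text \<open>A Dynkin argument: open intervals are stable under intersection and generate the Borel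
  sets, and the sets over which \<open>G\<close> integrates to 0 are closed under disjoint unions
  and, by the hypothesis on the whole line, under complements. A Lebesgue set differs from an
  F-sigma set by a null set, so the integral of \<open>G\<close> vanishes over all measurable
  sets.\<close>

lemma AE_zero_if_open_interval_integrals_zero:
  fixes G :: "real \<Rightarrow> 'a::euclidean_space"
  assumes int: "integrable lebesgue G" and UNIV: "integral\<^sup>L lebesgue G = 0"
    and ivl: "\<And>a b. (\<integral>x. indicator {a<..<b} x *\<^sub>R G x \<partial>lebesgue) = 0"
  shows "AE x in lebesgue. G x = 0"
proof (rule sigma_finite_measure.density_zero[OF _ int])
  show "sigma_finite_measure (lebesgue :: real measure)" by (rule sigma_finite_lebesgue)
  have sint: "set_integrable lebesgue A G" if "A \<in> sets lebesgue" for A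
    unfolding set_integrable_def using integrable_mult_indicator[OF that int] .
  have borel: "set_lebesgue_integral lebesgue A G = 0" if "A \<in> sets borel" for A
  proof -
    let ?E = "range (\<lambda>(a, b). {a<..<b::real})"
    have "A \<in> sigma_sets UNIV ?E"
      using that unfolding borel_eq_greaterThanLessThan by simp
    have "Int_stable ?E"
    proof (rule Int_stableI)
      fix A B assume "A \<in> ?E" "B \<in> ?E"
      then obtain a b c d where "A = {a<..<b}" "B = {c<..<d}" by auto
      then have "A \<inter> B = (\<lambda>(a, b). {a<..<b}) (max a c, min b d)" by auto
      then show "A \<inter> B \<in> ?E" by blast
    qed
    moreover have "?E \<subseteq> Pow UNIV" by simp
    ultimately show ?thesis using \<open>A \<in> sigma_sets UNIV ?E\<close>
    proof (induction rule: sigma_sets_induct_disjoint)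
      case (basic A)
      then show ?case using ivl by (auto simp: set_lebesgue_integral_def)
    next
      case empty
      show ?case by (simp add: set_lebesgue_integral_def)
    next
      case (compl A)
      have "A \<in> sets borel" using compl(1) unfolding borel_eq_greaterThanLessThan by simp
      then have A: "A \<in> sets lebesgue" by simp
      have "(LINT x:A \<union> (UNIV - A)|lebesgue. G x) = (LINT x:A|lebesgue. G x) + (LINT x:UNIV - A|lebesgue. G x)"
        using A sets.compl_sets[OF A] by (intro set_integral_Un sint) auto
      then show ?case using compl(2) UNIV by (simp add: set_lebesgue_integral_def)
    next
      case (union A)
      have A: "A i \<in> sets lebesgue" for i
      proof -
        have "A i \<in> sets borel" using union(2) unfolding borel_eq_greaterThanLessThan by auto
        then show ?thesis by simp
      qed
      have "(LINT x:(\<Union>i. A i)|lebesgue. G x) = (\<Sum>i. (LINT x:(A i)|lebesgue. G x))"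
        using A union(1) by (intro lebesgue_integral_countable_add sint) (auto simp: disjoint_family_on_def)
      then show ?case using union(3) by simp
    qed
  qed
  show "set_lebesgue_integral lebesgue A G = 0" if A: "A \<in> sets lebesgue" for A
  proof -
    obtain C T where CT: "fsigma C" "T \<in> null_sets lebesgue" "C \<union> T = A" "disjnt C T"
      using lebesgue_set_almost_fsigma[OF A] .
    have C: "C \<in> sets borel" using CT(1) by (auto simp: fsigma.simps)
    then have C': "C \<in> sets lebesgue" by simp
    have "AE x in lebesgue. indicator C x *\<^sub>R G x = indicator A x *\<^sub>R G x"
      using AE_not_in[OF CT(2)] by eventually_elim (use CT(3) in \<open>auto simp: indicator_def\<close>)
    then have "set_lebesgue_integral lebesgue A G = set_lebesgue_integral lebesgue C G"
      unfolding set_lebesgue_integral_def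
      using int C' A by (intro integral_cong_AE) (auto intro!: borel_measurable_scaleR)
    then show ?thesis using borel[OF C] by simp
  qed
qed

lemma test_functionE:
  assumes "\<phi> \<in> test_functions L"
  obtains a b where "0 < a" "b < L" "\<And>x. x \<notin> {a..b} \<Longrightarrow> \<phi> x = 0"
  using assms by (auto simp: test_functions_def)

lemma test_function_has_deriv:
  assumes "\<phi> \<in> test_functions L"
  shows "(\<phi> has_real_derivative deriv \<phi> x) (at x)"
  using assms smooth_on_UNIV_deriv(1) by (auto simp: test_functions_def)

lemma test_function_continuous: "\<phi> \<in> test_functions L \<Longrightarrow> continuous_on S \<phi>"
  by (meson DERIV_continuous_on has_field_derivative_at_within test_function_has_deriv)

lemma test_function_deriv:
  assumes "\<phi> \<in> test_functions L"
  shows "deriv \<phi> \<in> test_functions L"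
proof -
  obtain a b where ab: "0 < a" "b < L" "\<And>x. x \<notin> {a..b} \<Longrightarrow> \<phi> x = 0"
    using test_functionE[OF assms] by blast
  have "deriv \<phi> x = 0" if "x \<notin> {a..b}" for x
  proof -
    have "(\<phi> has_real_derivative 0) (at x)"
      by (rule DERIV_cong_ev[THEN iffD2, of x x _ "\<lambda>x. 0"])
         (use that ab(3) in \<open>auto intro!: eventually_mono[OF eventually_nhds_in_open[of "- {a..b}" x]]\<close>)
    then show ?thesis by (rule DERIV_imp_deriv)
  qed
  then show ?thesis
    using assms ab smooth_on_UNIV_deriv(2) by (auto simp: test_functions_def)
qed

lemma test_function_lin:
  assumes "\<phi> \<in> test_functions L" "\<psi> \<in> test_functions L"
  shows "(\<lambda>x. \<phi> x + c * \<psi> x) \<in> test_functions L"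
proof -
  obtain a b where ab: "0 < a" "b < L" "\<And>x. x \<notin> {a..b} \<Longrightarrow> \<phi> x = 0"
    using test_functionE[OF assms(1)] by blast
  obtain a' b' where ab': "0 < a'" "b' < L" "\<And>x. x \<notin> {a'..b'} \<Longrightarrow> \<psi> x = 0"
    using test_functionE[OF assms(2)] by blast
  have "smooth_on UNIV (\<lambda>x. \<phi> x + c * \<psi> x)"
    using assms by (simp add: test_functions_def smooth_on_def Ck_on_UNIV_add Ck_on_UNIV_mult Ck_on_UNIV_const)
  moreover have "\<phi> x + c * \<psi> x = 0" if "x \<notin> {min a a'..max b b'}" for x
    using that ab(3)[of x] ab'(3)[of x] by (auto simp: min_le_iff_disj le_max_iff_disj)
  moreover have "0 < min a a'" "max b b' < L" using ab ab' by auto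
  ultimately show ?thesis unfolding test_functions_def by blast
qed

lemma test_function_bounded:
  assumes "\<phi> \<in> test_functions L"
  obtains B where "\<And>x. \<bar>\<phi> x\<bar> \<le> B"
proof -
  obtain a b where ab: "0 < a" "b < L" "\<And>x. x \<notin> {a..b} \<Longrightarrow> \<phi> x = 0"
    using test_functionE[OF assms] by blast
  have "compact (\<phi> ` {a..b})"
    by (intro compact_continuous_image test_function_continuous[OF assms]) simp
  then obtain B where "\<forall>x\<in>{a..b}. \<bar>\<phi> x\<bar> \<le> B"
    by (auto dest!: compact_imp_bounded simp: bounded_iff)
  then have "\<bar>\<phi> x\<bar> \<le> max 0 B" for x using ab(3)[of x] by (cases "x \<in> {a..b}") (auto simp: le_max_iff_disj)
  then show ?thesis by (rule that)
qed

lemma continuous_borel_measurable_interval: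
  "continuous_on {0<..<L} f \<Longrightarrow> f \<in> borel_measurable (\<mu> L)"
  by (simp add: continuous_imp_measurable_on_sets_lebesgue)

lemma test_function_measurable: "\<phi> \<in> test_functions L \<Longrightarrow> \<phi> \<in> borel_measurable (\<mu> L')"
  by (intro continuous_borel_measurable_interval test_function_continuous)

lemma integrable_bounded_scaleR:
  fixes g :: "real \<Rightarrow> 'a::euclidean_space"
  assumes "integrable M g" "f \<in> borel_measurable M" "\<And>x. \<bar>f x\<bar> \<le> B"
  shows "integrable M (\<lambda>x. f x *\<^sub>R g x)"
proof (rule Bochner_Integration.integrable_bound[where f = "\<lambda>x. B *\<^sub>R g x"])
  show "integrable M (\<lambda>x. B *\<^sub>R g x)" using assms(1) by simp
  show "(\<lambda>x. f x *\<^sub>R g x) \<in> borel_measurable M" using assms by (intro borel_measurable_scaleR) auto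
  have "\<bar>f x\<bar> \<le> \<bar>B\<bar>" for x using assms(3)[of x] by linarith
  then show "AE x in M. norm (f x *\<^sub>R g x) \<le> norm (B *\<^sub>R g x)"
    by (auto intro!: mult_right_mono)
qed

lemma integrable_test_scaleR:
  fixes g :: "real \<Rightarrow> 'a::euclidean_space"
  assumes "integrable (\<mu> L) g" "\<phi> \<in> test_functions L'"
  shows "integrable (\<mu> L) (\<lambda>x. \<phi> x *\<^sub>R g x)"
  using test_function_bounded[OF assms(2)] integrable_bounded_scaleR[OF assms(1)] test_function_measurable[OF assms(2)]
  by metis

text \<open>Dominated convergence with majorant \<open>norm (g x)\<close> replaces test functions by
  indicators of open subintervals of (0, L). Extension by zero to \<open>?G\<close> reduces an
  arbitrary interval to its intersection with (0, L).\<close>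

lemma fundamental_lemma_variations:
  fixes g :: "real \<Rightarrow> 'a::euclidean_space"
  assumes int: "integrable (\<mu> L) g"
    and zero: "\<And>\<phi>. \<phi> \<in> test_functions L \<Longrightarrow> (\<integral>x. \<phi> x *\<^sub>R g x \<partial>\<mu> L) = 0"
  shows "AE x in \<mu> L. g x = 0"
proof -
  let ?G = "\<lambda>x. indicator {0<..<L} x *\<^sub>R g x"
  have intG: "integrable lebesgue ?G"
    using int by (subst (asm) integrable_restrict_space) auto
  have ivl: "(\<integral>x. indicator {a<..<b} x *\<^sub>R g x \<partial>\<mu> L) = 0" if ab: "0 \<le> a" "b \<le> L" for a b
  proof (cases "a < b")
    case True
    obtain \<phi> where \<phi>: "\<And>n. \<phi> n \<in> test_functions L" "\<And>n x. 0 \<le> \<phi> n x \<and> \<phi> n x \<le> (1::real)"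
      "\<And>x. (\<lambda>n. \<phi> n x) \<longlonglongrightarrow> indicator {a<..<b} x"
      using test_function_between[OF ab(1) True ab(2)] by blast
    have "(\<lambda>n. (\<integral>x. \<phi> n x *\<^sub>R g x \<partial>\<mu> L)) \<longlonglongrightarrow> (\<integral>x. indicator {a<..<b} x *\<^sub>R g x \<partial>\<mu> L)"
    proof (rule integral_dominated_convergence)
      show "integrable (\<mu> L) (\<lambda>x. norm (g x))" using int by simp
      show "(\<lambda>x. indicat_real {a<..<b} x *\<^sub>R g x) \<in> borel_measurable (\<mu> L)"
        using int by (intro borel_measurable_scaleR measurable_restrict_space1[where f = "indicat_real {a<..<b}"]
          borel_measurable_indicator) auto
      show "(\<lambda>x. \<phi> n x *\<^sub>R g x) \<in> borel_measurable (\<mu> L)" for n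
        using integrable_test_scaleR[OF int \<phi>(1)] by auto
      show "AE x in \<mu> L. (\<lambda>n. \<phi> n x *\<^sub>R g x) \<longlonglongrightarrow> indicat_real {a<..<b} x *\<^sub>R g x"
        using \<phi>(3) by (auto intro!: tendsto_intros)
      show "AE x in \<mu> L. norm (\<phi> n x *\<^sub>R g x) \<le> norm (g x)" for n
        using \<phi>(2) by (auto intro!: mult_left_le_one_le)
    qed
    then have "(\<lambda>n. 0) \<longlonglongrightarrow> (\<integral>x. indicator {a<..<b} x *\<^sub>R g x \<partial>\<mu> L)"
      by (simp only: zero[OF \<phi>(1)])
    from LIMSEQ_unique[OF this tendsto_const] show ?thesis .
  qed simp
  have "AE x in lebesgue. ?G x = 0"
  proof (rule AE_zero_if_open_interval_integrals_zero[OF intG])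
    have *: "(\<integral>x. indicator {a<..<b} x *\<^sub>R ?G x \<partial>lebesgue) = 0" for a b
    proof -
      have "(\<integral>x. indicator {a<..<b} x *\<^sub>R ?G x \<partial>lebesgue) = (\<integral>x. indicator {max 0 a<..<min b L} x *\<^sub>R g x \<partial>\<mu> L)"
        by (subst integral_restrict_space) (auto simp: indicator_def intro!: Bochner_Integration.integral_cong)
      then show ?thesis using ivl[of "max 0 a" "min b L"] by auto
    qed
    have "integral\<^sup>L lebesgue ?G = (\<integral>x. indicator {0<..<L} x *\<^sub>R ?G x \<partial>lebesgue)"
      by (rule Bochner_Integration.integral_cong) (auto simp: indicator_def)
    then show "integral\<^sup>L lebesgue ?G = 0" using * by metis
    show "(\<integral>x. indicator {a<..<b} x *\<^sub>R ?G x \<partial>lebesgue) = 0" for a b by (rule *)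
  qed
  then show ?thesis
    unfolding AE_interval_iff by eventually_elim (auto simp: indicator_def)
qed

lemma indicator_measurable_interval:
  assumes "A \<in> sets borel"
  shows "indicat_real A \<in> borel_measurable (\<mu> L)"
proof -
  have "A \<in> sets lebesgue" using assms by simp
  then show ?thesis by (intro measurable_restrict_space1 borel_measurable_indicator)
qed

section \<open>Integrals over subintervals, primitives and integration by parts\<close>

lemma integrable_interval_iff:
  fixes g :: "real \<Rightarrow> 'a::euclidean_space"
  shows "integrable (\<mu> L) g \<longleftrightarrow> g absolutely_integrable_on {0..L}"
proof -
  have "integrable (\<mu> L) g \<longleftrightarrow> g absolutely_integrable_on {0<..<L}"
    unfolding set_integrable_def by (subst integrable_restrict_space) auto
  then show ?thesis by (simp only: absolutely_integrable_on_Icc_iff_Ioo)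
qed

lemma integrable_interval_sub:
  fixes g :: "real \<Rightarrow> 'a::euclidean_space"
  assumes "integrable (\<mu> L) g" "0 \<le> a" "b \<le> L"
  shows "g absolutely_integrable_on {a..b}" "g integrable_on {a..b}" "(\<lambda>x. norm (g x)) integrable_on {a..b}"
proof -
  show *: "g absolutely_integrable_on {a..b}"
    using assms by (auto simp: integrable_interval_iff intro: set_integrable_subset)
  then show "g integrable_on {a..b}" "(\<lambda>x. norm (g x)) integrable_on {a..b}"
    by (auto simp: absolutely_integrable_on_def)
qed

lemma integral_interval:
  fixes g :: "real \<Rightarrow> 'a::euclidean_space"
  assumes "integrable (\<mu> L) g"
  shows "(\<integral>x. g x \<partial>\<mu> L) = integral {0..L} g"
  using lebesgue_integral_eq_integral[OF assms] by (simp add: integral_open_interval_real)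

lemma integrable_interval_mono:
  fixes g :: "real \<Rightarrow> 'a::euclidean_space"
  assumes "integrable (\<mu> L) g" "x \<le> L"
  shows "integrable (\<mu> x) g"
  using integrable_interval_sub(1)[OF assms(1) order_refl assms(2)] by (simp add: integrable_interval_iff)

text \<open>Moves the variable end point into an indicator, so that the primitive becomes an
  integral over a fixed measure space and Fubini applies. For negative \<open>x\<close> both sides
  are 0.\<close>

lemma integral_upto_eq:
  fixes g :: "real \<Rightarrow> 'a::euclidean_space"
  assumes "integrable (\<mu> L) g" "x \<le> L"
  shows "integral {0..x} g = (\<integral>t. indicator {..<x} t *\<^sub>R g t \<partial>\<mu> L)"
proof -
  have "integral {0..x} g = (\<integral>t. g t \<partial>\<mu> x)"
    by (rule integral_interval[symmetric]) (rule integrable_interval_mono[OF assms])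
  also have "\<dots> = (\<integral>t. indicator {0<..<L} t *\<^sub>R (indicator {..<x} t *\<^sub>R g t) \<partial>lebesgue)"
    using assms(2) by (subst integral_restrict_space)
      (auto simp: indicator_def intro!: Bochner_Integration.integral_cong)
  also have "\<dots> = (\<integral>t. indicator {..<x} t *\<^sub>R g t \<partial>\<mu> L)"
    by (subst integral_restrict_space) auto
  finally show ?thesis .
qed

lemma continuous_on_primitive:
  fixes g :: "real \<Rightarrow> 'a::euclidean_space"
  assumes "integrable (\<mu> L) g"
  shows "continuous_on {0..L} (\<lambda>x. integral {0..x} g)"
  using integrable_interval_sub(2)[OF assms] by (intro indefinite_integral_continuous_1) auto

lemma primitive_diff:
  fixes g :: "real \<Rightarrow> 'a::euclidean_space"
  assumes "integrable (\<mu> L) g" "0 \<le> s" "s \<le> t" "t \<le> L"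
  shows "integral {0..t} g - integral {0..s} g = integral {s..t} g"
  using Henstock_Kurzweil_Integration.integral_combine[of 0 s t g] integrable_interval_sub(2)[OF assms(1), of 0 t] assms by (simp add: algebra_simps)

lemma continuous_integrable_interval:
  fixes f :: "real \<Rightarrow> 'a::euclidean_space"
  assumes "continuous_on {0..L} f"
  shows "integrable (\<mu> L) f"
  unfolding integrable_interval_iff by (rule absolutely_integrable_continuous_real) fact

text \<open>The inner integral after an exchange of the order of integration: \<open>x\<close> runs
  from \<open>t\<close> to \<open>L\<close>, and \<phi> vanishes at \<open>L\<close>.\<close>

lemma test_function_integral_deriv:
  assumes "\<phi> \<in> test_functions L" "0 < t" "t < L"
  shows "(\<integral>x. deriv \<phi> x * indicator {..<x} t \<partial>\<mu> L) = - \<phi> t"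
proof -
  obtain a b where ab: "0 < a" "b < L" "\<And>x. x \<notin> {a..b} \<Longrightarrow> \<phi> x = 0"
    using test_functionE[OF assms(1)] by blast
  have F: "integral {0..y} (deriv \<phi>) = \<phi> y - \<phi> 0" if "0 \<le> y" for y
    using that test_function_has_deriv[OF assms(1)]
    by (intro integral_unique fundamental_theorem_of_calculus)
      (auto simp: has_real_derivative_iff_has_vector_derivative has_vector_derivative_at_within)
  have i: "integrable (\<mu> L) (deriv \<phi>)"
    by (intro continuous_integrable_interval test_function_continuous[OF test_function_deriv[OF assms(1)]])
  have i2: "integrable (\<mu> L) (\<lambda>x. indicat_real {..<t} x *\<^sub>R deriv \<phi> x)"
    by (rule integrable_bounded_scaleR[OF i, where B = 1])
      (auto intro: indicator_measurable_interval)
  have "(\<integral>x. deriv \<phi> x * indicator {..<x} t \<partial>\<mu> L)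
     = (\<integral>x. deriv \<phi> x - indicator {..<t} x *\<^sub>R deriv \<phi> x \<partial>\<mu> L)"
  proof (rule integral_cong_AE)
    \<comment> \<open>The indicator of t < x and one minus the indicator of x < t differ exactly at
      x = t.\<close>
    have "AE x in lebesgue. x \<noteq> t"
      using AE_not_in[of "{t}" lebesgue] by (simp add: null_sets_completionI)
    then show "AE x in \<mu> L. deriv \<phi> x * indicator {..<x} t = deriv \<phi> x - indicator {..<t} x *\<^sub>R deriv \<phi> x"
      unfolding AE_interval_iff by eventually_elim (auto simp: indicator_def)
    show "(\<lambda>x. deriv \<phi> x - indicator {..<t} x *\<^sub>R deriv \<phi> x) \<in> borel_measurable (\<mu> L)"
      using i i2 by (intro borel_measurable_diff) (auto)
    have "(\<lambda>x. indicat_real {..<x} t) = indicat_real {t<..}" by (auto simp: indicator_def)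
    then have "(\<lambda>x. indicat_real {..<x} t) \<in> borel_measurable (\<mu> L)"
      by (auto intro: indicator_measurable_interval)
    then show "(\<lambda>x. deriv \<phi> x * indicat_real {..<x} t) \<in> borel_measurable (\<mu> L)"
      using i by (intro borel_measurable_times) auto
  qed
  also have "\<dots> = (\<integral>x. deriv \<phi> x \<partial>\<mu> L) - (\<integral>x. indicator {..<t} x *\<^sub>R deriv \<phi> x \<partial>\<mu> L)"
    using i i2 by (rule Bochner_Integration.integral_diff)
  also have "\<dots> = integral {0..L} (deriv \<phi>) - integral {0..t} (deriv \<phi>)"
    using integral_upto_eq[OF i, of t] integral_interval[OF i] assms(3) by simp
  also have "\<dots> = - \<phi> t"
    using assms ab by (simp add: F)
  finally show ?thesis .
qed

text \<open>Integration by parts without differentiating the primitive: both sides are the same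
  double integral over the triangle t < x, evaluated in the two orders.\<close>

lemma primitive_by_parts:
  fixes g :: "real \<Rightarrow> 'a::euclidean_space"
  assumes g: "integrable (\<mu> L) g" and \<phi>: "\<phi> \<in> test_functions L"
  shows "(\<integral>x. deriv \<phi> x *\<^sub>R integral {0..x} g \<partial>\<mu> L) = - (\<integral>x. \<phi> x *\<^sub>R g x \<partial>\<mu> L)"
proof -
  interpret sigma_finite_measure "\<mu> L" by (rule sigma_finite_measure_interval)
  interpret F: finite_measure "\<mu> L" by (rule finite_measure_interval)
  interpret P: pair_sigma_finite "\<mu> L" "\<mu> L" ..
  obtain B where B: "\<And>x. \<bar>deriv \<phi> x\<bar> \<le> B" using test_function_bounded[OF test_function_deriv[OF \<phi>]] by blast
  let ?f = "\<lambda>x t. deriv \<phi> x *\<^sub>R (indicat_real {..<x} t *\<^sub>R g t)"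
  have [measurable]: "g \<in> borel_measurable (\<mu> L)" "deriv \<phi> \<in> borel_measurable (\<mu> L)"
    "(\<lambda>x. x) \<in> borel_measurable (\<mu> L)"
    using g test_function_measurable[OF test_function_deriv[OF \<phi>]]
    by (auto intro!: continuous_borel_measurable_interval)
  have m: "case_prod ?f \<in> borel_measurable (\<mu> L \<Otimes>\<^sub>M \<mu> L)"
  proof -
    \<comment> \<open>The indicator belongs to a set that moves with \<open>x\<close>; as a
      condition on the pair it is jointly measurable.\<close>
    have "(\<lambda>p. deriv \<phi> (fst p) *\<^sub>R ((if snd p < fst p then 1 else 0) *\<^sub>R g (snd p))) \<in> borel_measurable (\<mu> L \<Otimes>\<^sub>M \<mu> L)"
      by measurable
    then show ?thesis by (simp add: indicator_def case_prod_beta of_bool_def)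
  qed
  have it: "integrable (\<mu> L) (\<lambda>t. indicat_real {..<x} t *\<^sub>R g t)" for x
    by (rule integrable_bounded_scaleR[OF g, where B = 1]) (auto intro: indicator_measurable_interval)
  have int: "integrable (\<mu> L \<Otimes>\<^sub>M \<mu> L) (case_prod ?f)"
  proof (rule P.Fubini_integrable[OF m])
    show "AE x in \<mu> L. integrable (\<mu> L) (\<lambda>y. case_prod ?f (x, y))"
      using integrable_scaleR_right[OF it] by simp
    have "norm (\<integral>y. norm (case_prod ?f (x, y)) \<partial>\<mu> L) \<le> B * (\<integral>y. norm (g y) \<partial>\<mu> L)" for x
    proof -
      have "(\<integral>y. norm (case_prod ?f (x, y)) \<partial>\<mu> L) \<le> (\<integral>y. B * norm (g y) \<partial>\<mu> L)"
      proof (rule integral_mono)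
        show "integrable (\<mu> L) (\<lambda>y. norm (case_prod ?f (x, y)))"
          unfolding prod.case by (intro integrable_norm integrable_scaleR_right it)
        show "integrable (\<mu> L) (\<lambda>y. B * norm (g y))" using g by simp
        have "0 \<le> B" using B[of x] by linarith
        then show "norm (case_prod ?f (x, y)) \<le> B * norm (g y)" for y
          using B[of x] by (auto simp: indicator_def intro: mult_right_mono)
      qed
      moreover have "0 \<le> (\<integral>y. norm (case_prod ?f (x, y)) \<partial>\<mu> L)" by simp
      ultimately show ?thesis by simp
    qed
    moreover have "(\<lambda>x. \<integral>y. norm (case_prod ?f (x, y)) \<partial>\<mu> L) \<in> borel_measurable (\<mu> L)"
    proof (rule borel_measurable_lebesgue_integral)
      have "(\<lambda>p. norm (case_prod ?f p)) \<in> borel_measurable (\<mu> L \<Otimes>\<^sub>M \<mu> L)"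
        by (rule measurable_compose[OF m borel_measurable_norm])
      then show "(\<lambda>(x, y). norm (case_prod ?f (x, y))) \<in> borel_measurable (\<mu> L \<Otimes>\<^sub>M \<mu> L)"
        by (simp only: case_prod_beta' fst_conv snd_conv prod.collapse)
    qed
    ultimately show "integrable (\<mu> L) (\<lambda>x. \<integral>y. norm (case_prod ?f (x, y)) \<partial>\<mu> L)"
      by (intro F.integrable_const_bound[where B = "B * (\<integral>y. norm (g y) \<partial>\<mu> L)"] AE_I2)
  qed
  have "(\<integral>x. deriv \<phi> x *\<^sub>R integral {0..x} g \<partial>\<mu> L) = (\<integral>x. (\<integral>t. ?f x t \<partial>\<mu> L) \<partial>\<mu> L)"
  proof (intro Bochner_Integration.integral_cong refl)
    fix x assume "x \<in> space (\<mu> L)"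
    then have "integral {0..x} g = (\<integral>t. indicator {..<x} t *\<^sub>R g t \<partial>\<mu> L)"
      by (intro integral_upto_eq[OF g]) simp
    then show "deriv \<phi> x *\<^sub>R integral {0..x} g = (\<integral>t. ?f x t \<partial>\<mu> L)"
      by (simp only: integral_scaleR_right)
  qed
  also have "\<dots> = (\<integral>t. (\<integral>x. ?f x t \<partial>\<mu> L) \<partial>\<mu> L)"
    by (rule P.Fubini_integral[OF int, symmetric])
  also have "\<dots> = (\<integral>t. (- \<phi> t) *\<^sub>R g t \<partial>\<mu> L)"
  proof (rule Bochner_Integration.integral_cong)
    fix t assume t: "t \<in> space (\<mu> L)"
    have "(\<integral>x. ?f x t \<partial>\<mu> L) = (\<integral>x. (deriv \<phi> x * indicat_real {..<x} t) *\<^sub>R g t \<partial>\<mu> L)" by simp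
    also have "\<dots> = (\<integral>x. deriv \<phi> x * indicat_real {..<x} t \<partial>\<mu> L) *\<^sub>R g t"
    proof (rule integral_scaleR_left)
      have "(\<lambda>x. indicat_real {..<x} t) = indicat_real {t<..}" by (auto simp: indicator_def)
      then have "(\<lambda>x. indicat_real {..<x} t) \<in> borel_measurable (\<mu> L)"
        by (auto intro: indicator_measurable_interval)
      then show "integrable (\<mu> L) (\<lambda>x. deriv \<phi> x * indicat_real {..<x} t)"
        using B by (intro F.integrable_const_bound[where B = B]) (auto simp: indicator_def intro: order_trans[OF abs_ge_zero])
    qed
    also have "\<dots> = (- \<phi> t) *\<^sub>R g t"
      using test_function_integral_deriv[OF \<phi>, of t] t by simp
    finally show "(\<integral>x. ?f x t \<partial>\<mu> L) = (- \<phi> t) *\<^sub>R g t" .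
  qed simp
  finally show ?thesis by simp
qed

lemma has_weak_deriv_primitive:
  fixes g :: "real \<Rightarrow> 'a::euclidean_space"
  assumes g: "integrable (\<mu> L) g"
  shows "has_weak_deriv L (\<lambda>x. c + integral {0..x} g) g"
  unfolding has_weak_deriv_def
proof (intro conjI ballI)
  have i: "integrable (\<mu> L) (\<lambda>x. integral {0..x} g)"
    by (intro continuous_integrable_interval continuous_on_primitive g)
  moreover have ic: "integrable (\<mu> L) (\<lambda>x. c)"
    by (intro continuous_integrable_interval continuous_intros)
  ultimately show "integrable (\<mu> L) (\<lambda>x. c + integral {0..x} g)" by simp
  show "integrable (\<mu> L) g" by fact
  fix \<phi> assume \<phi>: "\<phi> \<in> test_functions L"
  note \<phi>' = test_function_deriv[OF \<phi>]
  obtain a b where ab: "0 < a" "b < L" "\<And>x. x \<notin> {a..b} \<Longrightarrow> \<phi> x = 0"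
    using test_functionE[OF \<phi>] by blast
  have id: "integrable (\<mu> L) (deriv \<phi>)"
    by (intro continuous_integrable_interval test_function_continuous[OF \<phi>'])
  have "(\<integral>x. deriv \<phi> x \<partial>\<mu> L) = 0"
  proof (cases "0 \<le> L")
    case True
    then have "(\<integral>x. deriv \<phi> x \<partial>\<mu> L) = \<phi> L - \<phi> 0"
      unfolding integral_interval[OF id] using test_function_has_deriv[OF \<phi>]
      by (intro integral_unique fundamental_theorem_of_calculus)
        (auto simp: has_real_derivative_iff_has_vector_derivative has_vector_derivative_at_within)
    then show ?thesis using ab by auto
  qed (simp add: integral_interval[OF id])
  then have "(\<integral>x. deriv \<phi> x *\<^sub>R c \<partial>\<mu> L) = 0"
    using id by simp
  then show "(\<integral>x. deriv \<phi> x *\<^sub>R (c + integral {0..x} g) \<partial>\<mu> L) = - (\<integral>x. \<phi> x *\<^sub>R g x \<partial>\<mu> L)"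
    using primitive_by_parts[OF g \<phi>] integrable_test_scaleR[OF i \<phi>'] integrable_test_scaleR[OF ic \<phi>']
    by (simp add: scaleR_add_right)
qed

text \<open>The primitive starting at 0 vanishes to the left of the support, and to the right of it
  because the mean of \<theta> is 0. So mean zero is what makes the support compact.\<close>

lemma test_function_antideriv:
  assumes "L > 0" and \<theta>: "\<theta> \<in> test_functions L" and zero: "(\<integral>x. \<theta> x \<partial>\<mu> L) = 0"
  obtains \<phi> where "\<phi> \<in> test_functions L" "deriv \<phi> = \<theta>"
proof -
  obtain a' b' where ab': "0 < a'" "b' < L" "\<And>x. x \<notin> {a'..b'} \<Longrightarrow> \<theta> x = 0"
    using test_functionE[OF \<theta>] by blast
  \<comment> \<open>The support bounds of a test function need not be ordered; including L / 2 gives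
    0 < a <= b < L in every case.\<close>
  define a b where "a = min a' (L / 2)" and "b = max b' (L / 2)"
  have ab: "0 < a" "a \<le> b" "b < L"
    using ab' \<open>L > 0\<close> by (auto simp: a_def b_def)
  have ab0: "\<theta> x = 0" if "x \<notin> {a..b}" for x
  proof -
    have "{a'..b'} \<subseteq> {a..b}" by (auto simp: a_def b_def min_le_iff_disj le_max_iff_disj)
    then show ?thesis using that ab'(3) by blast
  qed
  define \<phi> where "\<phi> x = integral {0..x} \<theta>" for x
  have c: "continuous_on S \<theta>" for S by (rule test_function_continuous[OF \<theta>])
  have d: "(\<phi> has_vector_derivative \<theta> x) (at x)" for x
  proof (cases "0 < x")
    case True
    have "(\<phi> has_vector_derivative \<theta> x) (at x within {0..x+1})"
      unfolding \<phi>_def using True by (intro integral_has_vector_derivative c) auto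
    then show ?thesis using True by (simp add: at_within_Icc_at)
  next
    case False
    have left: "\<phi> y = 0" if "y < a" for y
      unfolding \<phi>_def using ab ab0 that by (intro integral_unique has_integral_is_0) auto
    have "(\<phi> has_vector_derivative 0) (at x)"
    proof (rule has_vector_derivative_transform_within_open[where f = "\<lambda>y. 0" and S = "{..<a}"])
      show "x \<in> {..<a}" using False ab(1) by simp
      show "0 = \<phi> y" if "y \<in> {..<a}" for y using left that by simp
    qed auto
    then show ?thesis using ab0[of x] False ab(1) by simp
  qed
  have z: "\<phi> x = 0" if x: "x \<notin> {a..b}" for x
  proof (cases "x < a")
    case True
    show ?thesis unfolding \<phi>_def using ab ab0 True by (intro integral_unique has_integral_is_0) auto
  next
    case False
    then have b: "b < x" using x by auto
    have "integral {0..y} \<theta> = integral {0..b} \<theta>" if "b < y" for y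
    proof -
      have "integral {0..b} \<theta> + integral {b..y} \<theta> = integral {0..y} \<theta>"
        using ab that by (intro Henstock_Kurzweil_Integration.integral_combine integrable_continuous_real c) auto
      moreover have "(\<theta> has_integral 0) (cbox b y)"
        by (rule has_integral_spike_interior[where f = "\<lambda>x. 0"]) (simp, use ab0 in simp)
      then have "integral {b..y} \<theta> = 0" by (simp add: integral_unique)
      ultimately show ?thesis by simp
    qed
    from this[OF b] this[OF ab(3)] have "\<phi> x = integral {0..L} \<theta>" by (simp add: \<phi>_def)
    then show ?thesis using zero integral_interval[OF continuous_integrable_interval[OF c]] by simp
  qed
  have "(\<phi> has_real_derivative \<theta> x) (at x)" for x
    using d by (simp add: has_real_derivative_iff_has_vector_derivative)
  then have "deriv \<phi> = \<theta>" by (intro ext DERIV_imp_deriv)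
  moreover have "smooth_on UNIV \<theta>" using \<theta> by (simp add: test_functions_def)
  then have "smooth_on UNIV \<phi>" by (rule smooth_on_UNIV_derivI[OF d])
  then have "\<phi> \<in> test_functions L" using z ab(1,3) unfolding test_functions_def by blast
  ultimately show ?thesis using that by simp
qed

section \<open>Weak derivatives and continuous representatives\<close>

text \<open>The lemma of du Bois-Reymond. The difference \<open>d\<close> of \<open>f\<close> and
  the primitive of \<open>g\<close> is annihilated by derivatives of test functions, that is, by
  test functions of mean zero. Any test function becomes one of mean zero after subtraction of a
  multiple of a fixed \<omega> with nonzero mean; hence \<open>d\<close> minus its \<omega>-weighted
  mean \<open>c\<close> is annihilated by all test functions.\<close>

lemma has_weak_deriv_imp_primitive:
  fixes f g :: "real \<Rightarrow> 'a::euclidean_space"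
  assumes "L > 0" and w: "has_weak_deriv L f g"
  obtains c where "AE x in \<mu> L. f x = c + integral {0..x} g"
proof -
  have f: "integrable (\<mu> L) f" and g: "integrable (\<mu> L) g"
    and wd: "\<And>\<phi>. \<phi> \<in> test_functions L \<Longrightarrow> (\<integral>x. deriv \<phi> x *\<^sub>R f x \<partial>\<mu> L) = - (\<integral>x. \<phi> x *\<^sub>R g x \<partial>\<mu> L)"
    using w by (auto simp: has_weak_deriv_def)
  define d where "d x = f x - integral {0..x} g" for x
  have i: "integrable (\<mu> L) (\<lambda>x. integral {0..x} g)"
    by (intro continuous_integrable_interval continuous_on_primitive g)
  have d: "integrable (\<mu> L) d" unfolding d_def using f i by simp
  have z: "(\<integral>x. deriv \<phi> x *\<^sub>R d x \<partial>\<mu> L) = 0" if "\<phi> \<in> test_functions L" for \<phi>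
    using wd[OF that] primitive_by_parts[OF g that] integrable_test_scaleR[OF f test_function_deriv[OF that]]
      integrable_test_scaleR[OF i test_function_deriv[OF that]]
    by (simp add: d_def scaleR_diff_right)
  have itest: "integrable (\<mu> L) \<phi>" if "\<phi> \<in> test_functions L" for \<phi>
    by (intro continuous_integrable_interval test_function_continuous[OF that])
  \<comment> \<open>Approximations of the indicator of (0, L) have means tending to L > 0, so one of
    them qualifies.\<close>
  obtain \<omega> where \<omega>: "\<omega> \<in> test_functions L" "(\<integral>x. \<omega> x \<partial>\<mu> L) \<noteq> 0"
  proof -
    obtain \<phi> where \<phi>: "\<And>n. \<phi> n \<in> test_functions L" "\<And>n x. 0 \<le> \<phi> n x \<and> \<phi> n x \<le> (1::real)"
      "\<And>x. (\<lambda>n. \<phi> n x) \<longlonglongrightarrow> indicator {0<..<L} x"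
      using test_function_between[OF order_refl \<open>L > 0\<close> order_refl] by blast
    have c1: "integrable (\<mu> L) (\<lambda>x. 1 :: real)" by (intro continuous_integrable_interval continuous_intros)
    have "(\<lambda>n. (\<integral>x. \<phi> n x \<partial>\<mu> L)) \<longlonglongrightarrow> (\<integral>x. 1 \<partial>\<mu> L)"
    proof (rule integral_dominated_convergence)
      show "integrable (\<mu> L) (\<lambda>x. 1 :: real)" by fact
      show "AE x in \<mu> L. (\<lambda>n. \<phi> n x) \<longlonglongrightarrow> 1"
        using \<phi>(3) by (intro AE_intervalI) (metis greaterThanLessThan_iff indicator_simps(1))
      show "AE x in \<mu> L. norm (\<phi> n x) \<le> 1" for n using \<phi>(2)[of n] by simp
    qed (use itest[OF \<phi>(1)] in auto)
    moreover have "(\<integral>x. 1 \<partial>\<mu> L) = L" using integral_interval[OF c1] \<open>L > 0\<close> by simp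
    ultimately have "\<forall>\<^sub>F n in sequentially. (\<integral>x. \<phi> n x \<partial>\<mu> L) > 0"
      using \<open>L > 0\<close> by (auto dest: order_tendstoD)
    then obtain n where "(\<integral>x. \<phi> n x \<partial>\<mu> L) > 0" by (auto simp: eventually_sequentially)
    then show ?thesis using that[of "\<phi> n"] \<phi>(1) by simp
  qed
  define c where "c = (1 / (\<integral>x. \<omega> x \<partial>\<mu> L)) *\<^sub>R (\<integral>x. \<omega> x *\<^sub>R d x \<partial>\<mu> L)"
  have cc: "integrable (\<mu> L) (\<lambda>x. c)" by (intro continuous_integrable_interval continuous_intros)
  have "AE x in \<mu> L. d x - c = 0"
  proof (rule fundamental_lemma_variations)
    show "integrable (\<mu> L) (\<lambda>x. d x - c)" using d cc by simp
    fix \<psi> assume \<psi>: "\<psi> \<in> test_functions L"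
    define k where "k = - ((\<integral>x. \<psi> x \<partial>\<mu> L) / (\<integral>x. \<omega> x \<partial>\<mu> L))"
    have \<theta>: "(\<lambda>x. \<psi> x + k * \<omega> x) \<in> test_functions L" by (rule test_function_lin) fact+
    moreover have "(\<integral>x. \<psi> x + k * \<omega> x \<partial>\<mu> L) = 0"
      using itest[OF \<psi>] itest[OF \<omega>(1)] \<omega>(2) by (simp add: k_def)
    ultimately obtain \<phi> where \<phi>: "\<phi> \<in> test_functions L" "deriv \<phi> = (\<lambda>x. \<psi> x + k * \<omega> x)"
      using test_function_antideriv[OF \<open>L > 0\<close>] by blast
    have "0 = (\<integral>x. (\<psi> x + k * \<omega> x) *\<^sub>R d x \<partial>\<mu> L)" using z[OF \<phi>(1)] \<phi>(2) by simp
    also have "\<dots> = (\<integral>x. \<psi> x *\<^sub>R d x + k *\<^sub>R (\<omega> x *\<^sub>R d x) \<partial>\<mu> L)" by (simp add: scaleR_add_left)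
    also have "\<dots> = (\<integral>x. \<psi> x *\<^sub>R d x \<partial>\<mu> L) + k *\<^sub>R (\<integral>x. \<omega> x *\<^sub>R d x \<partial>\<mu> L)"
      using Bochner_Integration.integral_add[OF integrable_test_scaleR[OF d \<psi>]
          integrable_scaleR_right[OF integrable_test_scaleR[OF d \<omega>(1)]]]
      by (simp only: integral_scaleR_right)
    also have "k *\<^sub>R (\<integral>x. \<omega> x *\<^sub>R d x \<partial>\<mu> L) = - (\<integral>x. \<psi> x \<partial>\<mu> L) *\<^sub>R c"
      by (simp add: k_def c_def)
    finally have "(\<integral>x. \<psi> x *\<^sub>R d x \<partial>\<mu> L) = (\<integral>x. \<psi> x \<partial>\<mu> L) *\<^sub>R c" by simp
    then show "(\<integral>x. \<psi> x *\<^sub>R (d x - c) \<partial>\<mu> L) = 0"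
      using integrable_test_scaleR[OF d \<psi>] integrable_test_scaleR[OF cc \<psi>] itest[OF \<psi>]
      by (simp add: scaleR_diff_right)
  qed
  then have "AE x in \<mu> L. f x = c + integral {0..x} g"
    by eventually_elim (simp add: d_def algebra_simps)
  then show ?thesis by (rule that)
qed

lemma has_weak_deriv_unique:
  fixes f g h :: "real \<Rightarrow> 'a::euclidean_space"
  assumes "has_weak_deriv L f g" "has_weak_deriv L f h"
  shows "AE x in \<mu> L. g x = h x"
proof -
  have g: "integrable (\<mu> L) g" and h: "integrable (\<mu> L) h" using assms by (auto simp: has_weak_deriv_def)
  have "AE x in \<mu> L. g x - h x = 0"
  proof (rule fundamental_lemma_variations)
    show "integrable (\<mu> L) (\<lambda>x. g x - h x)" using g h by simp
    fix \<phi> assume \<phi>: "\<phi> \<in> test_functions L"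
    have "(\<integral>x. \<phi> x *\<^sub>R g x \<partial>\<mu> L) = (\<integral>x. \<phi> x *\<^sub>R h x \<partial>\<mu> L)"
    proof -
      have "(\<integral>x. deriv \<phi> x *\<^sub>R f x \<partial>\<mu> L) = - (\<integral>x. \<phi> x *\<^sub>R g x \<partial>\<mu> L)"
        "(\<integral>x. deriv \<phi> x *\<^sub>R f x \<partial>\<mu> L) = - (\<integral>x. \<phi> x *\<^sub>R h x \<partial>\<mu> L)"
        using assms \<phi> unfolding has_weak_deriv_def by blast+
      then show ?thesis by simp
    qed
    then show "(\<integral>x. \<phi> x *\<^sub>R (g x - h x) \<partial>\<mu> L) = 0"
      using integrable_test_scaleR[OF g \<phi>] integrable_test_scaleR[OF h \<phi>] by (simp add: scaleR_diff_right)
  qed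
  then show ?thesis by eventually_elim simp
qed

lemma has_weak_deriv_cong:
  fixes f g f' g' :: "real \<Rightarrow> 'a::euclidean_space"
  assumes w: "has_weak_deriv L f g" and "AE x in \<mu> L. f x = f' x" "AE x in \<mu> L. g x = g' x"
    and "f' \<in> borel_measurable (\<mu> L)" "g' \<in> borel_measurable (\<mu> L)"
  shows "has_weak_deriv L f' g'"
proof -
  have i: "integrable (\<mu> L) f" "integrable (\<mu> L) g" using w by (auto simp: has_weak_deriv_def)
  have i': "integrable (\<mu> L) f'" "integrable (\<mu> L) g'"
    using integrable_cong_AE_imp[OF i(1) assms(4)] integrable_cong_AE_imp[OF i(2) assms(5)] assms(2,3)
    by (auto simp: eq_commute)
  have "(\<integral>x. \<psi> x *\<^sub>R u x \<partial>\<mu> L) = (\<integral>x. \<psi> x *\<^sub>R v x \<partial>\<mu> L)"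
    if "\<psi> \<in> test_functions L" "integrable (\<mu> L) u" "integrable (\<mu> L) v" "AE x in \<mu> L. u x = v x" for u v :: "real \<Rightarrow> 'a" and \<psi>
    using that integrable_test_scaleR[OF that(2,1)] integrable_test_scaleR[OF that(3,1)]
    by (intro integral_cong_AE) auto
  note * = this
  show ?thesis
    unfolding has_weak_deriv_def
  proof (intro conjI ballI i')
    fix \<phi> assume \<phi>: "\<phi> \<in> test_functions L"
    have "(\<integral>x. deriv \<phi> x *\<^sub>R f x \<partial>\<mu> L) = - (\<integral>x. \<phi> x *\<^sub>R g x \<partial>\<mu> L)"
      using w \<phi> unfolding has_weak_deriv_def by blast
    then show "(\<integral>x. deriv \<phi> x *\<^sub>R f' x \<partial>\<mu> L) = - (\<integral>x. \<phi> x *\<^sub>R g' x \<partial>\<mu> L)"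
      unfolding *[OF \<phi> i(2) i'(2) assms(3)] *[OF test_function_deriv[OF \<phi>] i(1) i'(1) assms(2)] .
  qed
qed

lemma wderiv_spec:
  assumes "has_weak_deriv L f g"
  shows "has_weak_deriv L f (wderiv L f)" "AE x in \<mu> L. wderiv L f x = g x"
proof -
  show "has_weak_deriv L f (wderiv L f)" unfolding wderiv_def using assms by (rule someI[where P = "has_weak_deriv L f"])
  from has_weak_deriv_unique[OF this assms] show "AE x in \<mu> L. wderiv L f x = g x" .
qed

lemma continuous_AE_eq_imp_eq:
  fixes f g :: "real \<Rightarrow> 'a::euclidean_space"
  assumes "L > 0" "continuous_on {0..L} f" "continuous_on {0..L} g" "AE x in \<mu> L. f x = g x" "x \<in> {0..L}"
  shows "f x = g x"
proof -
  let ?d = "\<lambda>x. norm (f x - g x)"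
  have c: "continuous_on {0..L} ?d" using assms by (intro continuous_intros)
  have i: "integrable (\<mu> L) ?d" by (rule continuous_integrable_interval[OF c])
  have "(\<integral>x. ?d x \<partial>\<mu> L) = (\<integral>x. 0 \<partial>\<mu> L)"
    using i assms(4) by (intro integral_cong_AE) auto
  then have "integral {0..L} ?d = 0" using integral_interval[OF i] by simp
  then have "?d x = 0" using integral_eq_0_iff[OF c assms(1)] assms(5) by auto
  then show ?thesis by simp
qed

text \<open>The choice made by \<open>cont_rep\<close> is harmless: continuous functions on [0, L]
  that agree almost everywhere agree at every point, end points included.\<close>

lemma cont_rep_eqI:
  fixes f g :: "real \<Rightarrow> 'a::euclidean_space"
  assumes "L > 0" "continuous_on {0..L} g" "AE x in \<mu> L. g x = f x"
  shows "continuous_on {0..L} (cont_rep L f)" "AE x in \<mu> L. cont_rep L f x = f x"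
    "x \<in> {0..L} \<Longrightarrow> cont_rep L f x = g x"
proof -
  have *: "continuous_on {0..L} (cont_rep L f) \<and> (AE x in \<mu> L. cont_rep L f x = f x)"
    unfolding cont_rep_def by (rule someI[of _ g]) (use assms in simp)
  then show "continuous_on {0..L} (cont_rep L f)" "AE x in \<mu> L. cont_rep L f x = f x" by auto
  have "AE x in \<mu> L. cont_rep L f x = g x" using conjunct2[OF *] assms(3) by eventually_elim simp
  then show "x \<in> {0..L} \<Longrightarrow> cont_rep L f x = g x"
    using * assms(1,2) continuous_AE_eq_imp_eq by blast
qed

lemma cont_rep_has_weak_deriv:
  fixes f g :: "real \<Rightarrow> 'a::euclidean_space"
  assumes "L > 0" "has_weak_deriv L f g"
  shows "continuous_on {0..L} (cont_rep L f)" "AE x in \<mu> L. cont_rep L f x = f x"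
    "0 \<le> s \<Longrightarrow> s \<le> t \<Longrightarrow> t \<le> L \<Longrightarrow> cont_rep L f t - cont_rep L f s = integral {s..t} g"
proof -
  have g: "integrable (\<mu> L) g" using assms by (auto simp: has_weak_deriv_def)
  obtain c where c: "AE x in \<mu> L. f x = c + integral {0..x} g"
    using has_weak_deriv_imp_primitive[OF assms] by blast
  have *: "continuous_on {0..L} (\<lambda>x. c + integral {0..x} g)" "AE x in \<mu> L. c + integral {0..x} g = f x"
    using c by (auto intro!: continuous_intros continuous_on_primitive[OF g] elim: eventually_mono)
  note r = cont_rep_eqI[OF assms(1) *]
  show "continuous_on {0..L} (cont_rep L f)" "AE x in \<mu> L. cont_rep L f x = f x" using r(1,2) by auto
  show "cont_rep L f t - cont_rep L f s = integral {s..t} g" if "0 \<le> s" "s \<le> t" "t \<le> L"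
    using r(3)[of s] r(3)[of t] that primitive_diff[OF g that] by simp
qed

lemma has_weak_derivI:
  fixes f g :: "real \<Rightarrow> 'a::euclidean_space"
  assumes "integrable (\<mu> L) g" "\<And>x. 0 \<le> x \<Longrightarrow> x \<le> L \<Longrightarrow> f x = c + integral {0..x} g"
  shows "has_weak_deriv L f g"
proof (rule has_weak_deriv_cong[OF has_weak_deriv_primitive[OF assms(1), of c]])
  show "AE x in \<mu> L. c + integral {0..x} g = f x" using assms(2) by (intro AE_intervalI) auto
  have "continuous_on {0..L} (\<lambda>x. c + integral {0..x} g)"
    by (intro continuous_intros continuous_on_primitive[OF assms(1)])
  then have "continuous_on {0..L} f" using assms(2) by (subst continuous_on_cong[OF refl]) auto
  then show "f \<in> borel_measurable (\<mu> L)"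
    by (intro continuous_borel_measurable_interval) (auto intro: continuous_on_subset)
  show "g \<in> borel_measurable (\<mu> L)" using assms(1) by auto
qed simp

lemma has_weak_deriv_lin:
  fixes f g f' g' :: "real \<Rightarrow> 'a::euclidean_space"
  assumes "has_weak_deriv L f f'" "has_weak_deriv L g g'"
  shows "has_weak_deriv L (\<lambda>x. a *\<^sub>R f x + b *\<^sub>R g x) (\<lambda>x. a *\<^sub>R f' x + b *\<^sub>R g' x)"
proof -
  have i: "integrable (\<mu> L) f" "integrable (\<mu> L) g" "integrable (\<mu> L) f'" "integrable (\<mu> L) g'"
    using assms by (auto simp: has_weak_deriv_def)
  have *: "(\<integral>x. \<psi> x *\<^sub>R (a *\<^sub>R u x + b *\<^sub>R v x) \<partial>\<mu> L) = a *\<^sub>R (\<integral>x. \<psi> x *\<^sub>R u x \<partial>\<mu> L) + b *\<^sub>R (\<integral>x. \<psi> x *\<^sub>R v x \<partial>\<mu> L)"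
    if "integrable (\<mu> L) u" "integrable (\<mu> L) v" "\<psi> \<in> test_functions L" for u v :: "real \<Rightarrow> 'a" and \<psi>
  proof -
    have "(\<integral>x. \<psi> x *\<^sub>R (a *\<^sub>R u x + b *\<^sub>R v x) \<partial>\<mu> L) = (\<integral>x. a *\<^sub>R (\<psi> x *\<^sub>R u x) + b *\<^sub>R (\<psi> x *\<^sub>R v x) \<partial>\<mu> L)"
      by (simp only: scaleR_add_right scaleR_left_commute)
    also have "\<dots> = a *\<^sub>R (\<integral>x. \<psi> x *\<^sub>R u x \<partial>\<mu> L) + b *\<^sub>R (\<integral>x. \<psi> x *\<^sub>R v x \<partial>\<mu> L)"
      using Bochner_Integration.integral_add[OF
          integrable_scaleR_right[OF integrable_test_scaleR[OF that(1,3)]]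
          integrable_scaleR_right[OF integrable_test_scaleR[OF that(2,3)]]]
      by (simp only: integral_scaleR_right)
    finally show ?thesis .
  qed
  show ?thesis
    unfolding has_weak_deriv_def
  proof (intro conjI ballI)
    show "integrable (\<mu> L) (\<lambda>x. a *\<^sub>R f x + b *\<^sub>R g x)" "integrable (\<mu> L) (\<lambda>x. a *\<^sub>R f' x + b *\<^sub>R g' x)"
      using i by simp_all
    fix \<phi> assume \<phi>: "\<phi> \<in> test_functions L"
    have "(\<integral>x. deriv \<phi> x *\<^sub>R f x \<partial>\<mu> L) = - (\<integral>x. \<phi> x *\<^sub>R f' x \<partial>\<mu> L)"
      "(\<integral>x. deriv \<phi> x *\<^sub>R g x \<partial>\<mu> L) = - (\<integral>x. \<phi> x *\<^sub>R g' x \<partial>\<mu> L)"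
      using assms \<phi> unfolding has_weak_deriv_def by blast+
    then show "(\<integral>x. deriv \<phi> x *\<^sub>R (a *\<^sub>R f x + b *\<^sub>R g x) \<partial>\<mu> L)
      = - (\<integral>x. \<phi> x *\<^sub>R (a *\<^sub>R f' x + b *\<^sub>R g' x) \<partial>\<mu> L)"
      unfolding *[OF i(3,4) \<phi>] *[OF i(1,2) test_function_deriv[OF \<phi>]] by simp
  qed
qed

section \<open>Square integrable and Sobolev functions\<close>

text \<open>Integrate the weighted inequality 2 |a b| <= e a^2 + b^2 / e and choose the weight that
  balances the two integrals.\<close>

lemma Cauchy_Schwarz_integral:
  fixes f g :: "'a \<Rightarrow> real"
  assumes [measurable]: "f \<in> borel_measurable M" "g \<in> borel_measurable M"
    and f: "integrable M (\<lambda>x. (f x)\<^sup>2)" and g: "integrable M (\<lambda>x. (g x)\<^sup>2)"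
  shows "integrable M (\<lambda>x. f x * g x)"
    "(\<integral>x. \<bar>f x * g x\<bar> \<partial>M) \<le> sqrt (\<integral>x. (f x)\<^sup>2 \<partial>M) * sqrt (\<integral>x. (g x)\<^sup>2 \<partial>M)"
proof -
  have amgm: "2 * \<bar>a * b\<bar> \<le> e * a\<^sup>2 + b\<^sup>2 / e" if "e > 0" for a b e :: real
  proof -
    have "0 \<le> (e * \<bar>a\<bar> - \<bar>b\<bar>)\<^sup>2 / e" using that by simp
    also have "\<dots> = e * a\<^sup>2 + b\<^sup>2 / e - 2 * \<bar>a * b\<bar>"
      using that by (simp add: power2_eq_square field_simps abs_mult)
    finally show ?thesis by simp
  qed
  have "integrable M (\<lambda>x. 1 * (f x)\<^sup>2 + (g x)\<^sup>2 / 1)" using f g by simp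
  then show int: "integrable M (\<lambda>x. f x * g x)"
  proof (rule Bochner_Integration.integrable_bound)
    have "norm (f x * g x) \<le> norm (1 * (f x)\<^sup>2 + (g x)\<^sup>2 / 1)" for x
      using amgm[of 1 "f x" "g x"] by simp
    then show "AE x in M. norm (f x * g x) \<le> norm (1 * (f x)\<^sup>2 + (g x)\<^sup>2 / 1)" by simp
  qed measurable
  define A B where "A = (\<integral>x. (f x)\<^sup>2 \<partial>M)" and "B = (\<integral>x. (g x)\<^sup>2 \<partial>M)"
  have AB: "0 \<le> A" "0 \<le> B" by (auto simp: A_def B_def)
  \<comment> \<open>The shift by \<eta> keeps both factors positive, so the balancing weight
    \<open>b / a\<close> exists even if \<open>f\<close> or \<open>g\<close> vanishes; \<eta> tends
    to 0 afterwards.\<close>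
  have *: "(\<integral>x. \<bar>f x * g x\<bar> \<partial>M) \<le> (sqrt A + \<eta>) * (sqrt B + \<eta>)" if "\<eta> > 0" for \<eta>
  proof -
    define a b where "a = sqrt A + \<eta>" and "b = sqrt B + \<eta>"
    have ab: "a > 0" "b > 0" using AB that by (auto simp: a_def b_def add_nonneg_pos)
    have Aa: "A \<le> a\<^sup>2" "B \<le> b\<^sup>2"
      using AB that real_le_rsqrt[of] sqrt_le_D[of A a] sqrt_le_D[of B b] by (auto simp: a_def b_def)
    have "2 * (\<integral>x. \<bar>f x * g x\<bar> \<partial>M) = (\<integral>x. 2 * \<bar>f x * g x\<bar> \<partial>M)" by simp
    also have "\<dots> \<le> (\<integral>x. (b / a) * (f x)\<^sup>2 + (g x)\<^sup>2 / (b / a) \<partial>M)"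
    proof (rule integral_mono)
      show "integrable M (\<lambda>x. 2 * \<bar>f x * g x\<bar>)" using integrable_abs[OF int] by simp
      show "integrable M (\<lambda>x. (b / a) * (f x)\<^sup>2 + (g x)\<^sup>2 / (b / a))" using f g by simp
      show "2 * \<bar>f x * g x\<bar> \<le> (b / a) * (f x)\<^sup>2 + (g x)\<^sup>2 / (b / a)" for x
        using ab by (intro amgm) simp
    qed
    also have "\<dots> = (b / a) * A + B / (b / a)" using f g by (simp add: A_def B_def)
    also have "\<dots> \<le> (b / a) * a\<^sup>2 + b\<^sup>2 / (b / a)"
      using ab Aa by (intro add_mono mult_left_mono divide_right_mono) auto
    also have "\<dots> = 2 * (a * b)" using ab by (simp add: power2_eq_square)
    finally show ?thesis by (simp add: a_def b_def)
  qed
  have "((\<lambda>\<eta>. (sqrt A + \<eta>) * (sqrt B + \<eta>)) \<longlongrightarrow> (sqrt A + 0) * (sqrt B + 0)) (at_right 0)"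
    by (intro tendsto_intros)
  then have "(\<integral>x. \<bar>f x * g x\<bar> \<partial>M) \<le> (sqrt A + 0) * (sqrt B + 0)"
    by (rule tendsto_lowerbound) (auto simp: eventually_at_filter intro!: always_eventually *)
  then show "(\<integral>x. \<bar>f x * g x\<bar> \<partial>M) \<le> sqrt (\<integral>x. (f x)\<^sup>2 \<partial>M) * sqrt (\<integral>x. (g x)\<^sup>2 \<partial>M)"
    by (simp add: A_def B_def)
qed

lemma L2_norm_nonneg [simp]: "0 \<le> L2_norm L f"
  by (simp add: L2_norm_def)

lemma L2_norm_power2: "(L2_norm L f)\<^sup>2 = (\<integral>x. (norm (f x))\<^sup>2 \<partial>\<mu> L)"
  by (simp add: L2_norm_def)

lemma L2_measurable: "f \<in> L2 L \<Longrightarrow> f \<in> borel_measurable (\<mu> L)"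
  and L2_square_integrable: "f \<in> L2 L \<Longrightarrow> integrable (\<mu> L) (\<lambda>x. (norm (f x))\<^sup>2)"
  by (auto simp: L2_def)

lemma L2_norm_mult:
  fixes f :: "real \<Rightarrow> 'a::euclidean_space" and g :: "real \<Rightarrow> 'b::euclidean_space"
  assumes "f \<in> L2 L" "g \<in> L2 L"
  shows "integrable (\<mu> L) (\<lambda>x. norm (f x) * norm (g x))"
    "(\<integral>x. norm (f x) * norm (g x) \<partial>\<mu> L) \<le> L2_norm L f * L2_norm L g"
proof -
  have m [measurable]: "f \<in> borel_measurable (\<mu> L)" "g \<in> borel_measurable (\<mu> L)"
    using assms by (auto simp: L2_def)
  have mn: "(\<lambda>x. norm (f x)) \<in> borel_measurable (\<mu> L)" "(\<lambda>x. norm (g x)) \<in> borel_measurable (\<mu> L)"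
    by measurable
  note CS = Cauchy_Schwarz_integral[OF mn L2_square_integrable[OF assms(1)] L2_square_integrable[OF assms(2)]]
  show "integrable (\<mu> L) (\<lambda>x. norm (f x) * norm (g x))" by (rule CS(1))
  show "(\<integral>x. norm (f x) * norm (g x) \<partial>\<mu> L) \<le> L2_norm L f * L2_norm L g"
    using CS(2) by (simp add: L2_norm_def)
qed

lemma L2_inner:
  fixes f g :: "real \<Rightarrow> 'a::euclidean_space"
  assumes "f \<in> L2 L" "g \<in> L2 L"
  shows "integrable (\<mu> L) (\<lambda>x. f x \<bullet> g x)"
    "\<bar>\<integral>x. f x \<bullet> g x \<partial>\<mu> L\<bar> \<le> L2_norm L f * L2_norm L g"
proof -
  have m [measurable]: "f \<in> borel_measurable (\<mu> L)" "g \<in> borel_measurable (\<mu> L)"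
    using assms by (auto simp: L2_def)
  note i = L2_norm_mult(1)[OF assms] and n = L2_norm_mult(2)[OF assms]
  show i': "integrable (\<mu> L) (\<lambda>x. f x \<bullet> g x)"
    by (rule Bochner_Integration.integrable_bound[OF i]) (auto intro: Cauchy_Schwarz_ineq2)
  have "\<bar>\<integral>x. f x \<bullet> g x \<partial>\<mu> L\<bar> \<le> (\<integral>x. norm (f x) * norm (g x) \<partial>\<mu> L)"
    using Bochner_Integration.integral_norm_bound_integral[OF i' i] by (simp add: Cauchy_Schwarz_ineq2)
  then show "\<bar>\<integral>x. f x \<bullet> g x \<partial>\<mu> L\<bar> \<le> L2_norm L f * L2_norm L g" using n by linarith
qed

lemma L2_cong_AE:
  assumes "f \<in> L2 L" "g \<in> borel_measurable (\<mu> L)" "AE x in \<mu> L. f x = g x"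
  shows "g \<in> L2 L" "L2_norm L g = L2_norm L f"
proof -
  have [measurable]: "f \<in> borel_measurable (\<mu> L)" "g \<in> borel_measurable (\<mu> L)"
    using assms by (auto simp: L2_def)
  have ae: "AE x in \<mu> L. (norm (f x))\<^sup>2 = (norm (g x))\<^sup>2" using assms(3) by eventually_elim simp
  show "g \<in> L2 L"
    using L2_square_integrable[OF assms(1)] ae assms(2) unfolding L2_def
    by (auto elim!: integrable_cong_AE_imp intro: assms(2) simp: eq_commute)
  have "(\<integral>x. (norm (g x))\<^sup>2 \<partial>\<mu> L) = (\<integral>x. (norm (f x))\<^sup>2 \<partial>\<mu> L)"
    by (rule integral_cong_AE) (use ae in \<open>auto simp: eq_commute\<close>)
  then show "L2_norm L g = L2_norm L f" by (simp add: L2_norm_def)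
qed

lemma L2_AE_le:
  assumes "f \<in> L2 L" "g \<in> borel_measurable (\<mu> L)" "AE x in \<mu> L. norm (g x) \<le> norm (f x)"
  shows "g \<in> L2 L" "L2_norm L g \<le> L2_norm L f"
proof -
  have [measurable]: "f \<in> borel_measurable (\<mu> L)" "g \<in> borel_measurable (\<mu> L)"
    using assms by (auto simp: L2_def)
  have ae: "AE x in \<mu> L. (norm (g x))\<^sup>2 \<le> (norm (f x))\<^sup>2"
    using assms(3) by eventually_elim (simp add: power_mono)
  have i: "integrable (\<mu> L) (\<lambda>x. (norm (g x))\<^sup>2)"
    by (rule Bochner_Integration.integrable_bound[OF L2_square_integrable[OF assms(1)]]) (use ae in auto)
  then show "g \<in> L2 L" using assms(2) by (auto simp: L2_def)
  show "L2_norm L g \<le> L2_norm L f"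
    unfolding L2_norm_def using integral_mono_AE[OF i L2_square_integrable[OF assms(1)] ae] by simp
qed

lemma L2_const: "(\<lambda>x. c) \<in> L2 L"
  unfolding L2_def by (auto intro!: continuous_integrable_interval continuous_intros)

lemma L2_norm_const: "L \<ge> 0 \<Longrightarrow> L2_norm L (\<lambda>x. c) = sqrt L * norm c"
  unfolding L2_norm_def
  by (subst integral_interval) (auto intro!: continuous_integrable_interval continuous_intros simp: real_sqrt_mult)

lemma L2_bounded:
  fixes f :: "real \<Rightarrow> 'a::euclidean_space"
  assumes "L \<ge> 0" "f \<in> borel_measurable (\<mu> L)" "AE x in \<mu> L. norm (f x) \<le> B" "0 \<le> B"
  shows "f \<in> L2 L" "L2_norm L f \<le> sqrt L * B"
proof -
  have "AE x in \<mu> L. norm (f x) \<le> norm B" using assms(3,4) by simp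
  from L2_AE_le[OF L2_const assms(2) this] show "f \<in> L2 L" "L2_norm L f \<le> sqrt L * B"
    using L2_norm_const[of L B] assms(1,4) by auto
qed

lemma L2_lin:
  fixes f g :: "real \<Rightarrow> 'a::euclidean_space"
  assumes "f \<in> L2 L" "g \<in> L2 L"
  shows "(\<lambda>x. a *\<^sub>R f x + b *\<^sub>R g x) \<in> L2 L"
proof -
  have [measurable]: "f \<in> borel_measurable (\<mu> L)" "g \<in> borel_measurable (\<mu> L)"
    using assms by (auto simp: L2_def)
  have i: "integrable (\<mu> L) (\<lambda>x. 2 * a\<^sup>2 * (norm (f x))\<^sup>2 + 2 * b\<^sup>2 * (norm (g x))\<^sup>2)"
    using assms by (auto simp: L2_def)
  have "(norm (a *\<^sub>R f x + b *\<^sub>R g x))\<^sup>2 \<le> 2 * a\<^sup>2 * (norm (f x))\<^sup>2 + 2 * b\<^sup>2 * (norm (g x))\<^sup>2" for x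
  proof -
    have "(norm (a *\<^sub>R f x + b *\<^sub>R g x))\<^sup>2 \<le> (\<bar>a\<bar> * norm (f x) + \<bar>b\<bar> * norm (g x))\<^sup>2"
      by (intro power_mono) (auto intro: norm_triangle_le)
    also have "\<dots> \<le> 2 * (\<bar>a\<bar> * norm (f x))\<^sup>2 + 2 * (\<bar>b\<bar> * norm (g x))\<^sup>2"
      using zero_le_power2[of "\<bar>a\<bar> * norm (f x) - \<bar>b\<bar> * norm (g x)"] by (simp add: power2_sum power2_diff)
    finally show ?thesis by (simp add: power_mult_distrib)
  qed
  then have "integrable (\<mu> L) (\<lambda>x. (norm (a *\<^sub>R f x + b *\<^sub>R g x))\<^sup>2)"
    by (intro Bochner_Integration.integrable_bound[OF i]) auto
  then show ?thesis by (simp add: L2_def)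
qed

lemma L2_add: "f \<in> L2 L \<Longrightarrow> g \<in> L2 L \<Longrightarrow> (\<lambda>x. f x + g x) \<in> L2 L"
  and L2_diff: "f \<in> L2 L \<Longrightarrow> g \<in> L2 L \<Longrightarrow> (\<lambda>x. f x - g x) \<in> L2 L"
  and L2_scale: "f \<in> L2 L \<Longrightarrow> (\<lambda>x. a *\<^sub>R f x) \<in> L2 L"
  using L2_lin[of f L g 1 1] L2_lin[of f L g 1 "-1"] L2_lin[of f L f a 0] by simp_all

lemma L2_norm_scale: "L2_norm L (\<lambda>x. c *\<^sub>R f x) = \<bar>c\<bar> * L2_norm L f"
  by (simp add: L2_norm_def power_mult_distrib real_sqrt_mult)

lemma L2_norm_triangle:
  fixes f g :: "real \<Rightarrow> 'a::euclidean_space"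
  assumes "f \<in> L2 L" "g \<in> L2 L"
  shows "L2_norm L (\<lambda>x. f x + g x) \<le> L2_norm L f + L2_norm L g"
proof (rule power2_le_imp_le)
  have "(L2_norm L (\<lambda>x. f x + g x))\<^sup>2
      = (\<integral>x. (norm (f x))\<^sup>2 + (norm (g x))\<^sup>2 + 2 * (f x \<bullet> g x) \<partial>\<mu> L)"
    unfolding L2_norm_power2
    by (intro Bochner_Integration.integral_cong) (auto simp: power2_norm_eq_inner inner_add inner_commute)
  also have "\<dots> = (L2_norm L f)\<^sup>2 + (L2_norm L g)\<^sup>2 + 2 * (\<integral>x. f x \<bullet> g x \<partial>\<mu> L)"
    using L2_square_integrable[OF assms(1)] L2_square_integrable[OF assms(2)] L2_inner(1)[OF assms]
    by (simp add: L2_norm_power2)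
  also have "\<dots> \<le> (L2_norm L f)\<^sup>2 + (L2_norm L g)\<^sup>2 + 2 * (L2_norm L f * L2_norm L g)"
    using L2_inner(2)[OF assms] by simp
  also have "\<dots> = (L2_norm L f + L2_norm L g)\<^sup>2" by (simp add: power2_sum)
  finally show "(L2_norm L (\<lambda>x. f x + g x))\<^sup>2 \<le> (L2_norm L f + L2_norm L g)\<^sup>2" .
qed simp

lemma L2_norm_diff_le:
  fixes f g :: "real \<Rightarrow> 'a::euclidean_space"
  assumes "f \<in> L2 L" "g \<in> L2 L"
  shows "L2_norm L (\<lambda>x. f x - g x) \<le> L2_norm L f + L2_norm L g"
    "L2_norm L f \<le> L2_norm L g + L2_norm L (\<lambda>x. f x - g x)"
    "L2_norm L (\<lambda>x. f x - g x) = L2_norm L (\<lambda>x. g x - f x)"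
  using L2_norm_triangle[OF assms(1) L2_scale[OF assms(2), of "-1"]] L2_norm_scale[of L "-1" g]
    L2_norm_triangle[OF assms(2) L2_diff[OF assms]]
  by (simp_all add: L2_norm_def norm_minus_commute)

lemma L2_integrable:
  fixes f :: "real \<Rightarrow> 'a::euclidean_space"
  assumes "f \<in> L2 L"
  shows "integrable (\<mu> L) f"
  using L2_norm_mult(1)[OF assms L2_const[of "1::real"]] L2_measurable[OF assms]
  by (auto intro: Bochner_Integration.integrable_bound)

lemma continuous_L2:
  fixes f :: "real \<Rightarrow> 'a::euclidean_space"
  assumes "continuous_on {0..L} f"
  shows "f \<in> L2 L"
proof -
  have "f \<in> borel_measurable (\<mu> L)"
    using assms by (intro continuous_borel_measurable_interval) (auto intro: continuous_on_subset)
  moreover have "integrable (\<mu> L) (\<lambda>x. (norm (f x))\<^sup>2)"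
    using assms by (intro continuous_integrable_interval continuous_intros)
  ultimately show ?thesis by (simp add: L2_def)
qed

lemma integral_norm_le_L2_norm:
  fixes f :: "real \<Rightarrow> 'a::euclidean_space"
  assumes "L \<ge> 0" "f \<in> L2 L"
  shows "(\<integral>x. norm (f x) \<partial>\<mu> L) \<le> sqrt L * L2_norm L f"
  using L2_norm_mult(2)[OF assms(2) L2_const[of "1::real"]] L2_norm_const[OF assms(1), of "1::real"]
  by (simp add: mult.commute)

lemma norm_integral_le_L2_norm_sub:
  fixes f :: "real \<Rightarrow> 'a::euclidean_space"
  assumes f: "f \<in> L2 L" and st: "0 \<le> s" "s \<le> t" "t \<le> L"
  shows "norm (integral {s..t} f) \<le> sqrt (t - s) * sqrt (integral {s..t} (\<lambda>x. (norm (f x))\<^sup>2))"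
    "integral {s..t} (\<lambda>x. (norm (f x))\<^sup>2) \<le> (L2_norm L f)\<^sup>2"
proof -
  let ?M = "lebesgue_on {s..t}"
  have sub: "integrable ?M u" if "integrable (\<mu> L) u" for u :: "real \<Rightarrow> 'b::euclidean_space"
    using integrable_interval_sub(1)[OF that st(1,3)] unfolding set_integrable_def
    by (subst integrable_restrict_space) auto
  have i: "integrable ?M f" "integrable ?M (\<lambda>x. (norm (f x))\<^sup>2)" "integrable ?M (\<lambda>x. 1\<^sup>2 :: real)"
    using L2_integrable[OF f] L2_square_integrable[OF f] L2_integrable[OF L2_const] by (auto intro!: sub)
  have eq: "(\<integral>x. u x \<partial>?M) = integral {s..t} u" if "integrable ?M u" for u :: "real \<Rightarrow> 'b::euclidean_space"
    using lebesgue_integral_eq_integral[OF that] by simp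
  have "norm (integral {s..t} f) = norm (\<integral>x. f x \<partial>?M)" using eq[OF i(1)] by simp
  also have "\<dots> \<le> (\<integral>x. \<bar>1 * norm (f x)\<bar> \<partial>?M)" using integral_norm_bound[of ?M f] by simp
  also have "\<dots> \<le> sqrt (\<integral>x. 1\<^sup>2 \<partial>?M) * sqrt (\<integral>x. (norm (f x))\<^sup>2 \<partial>?M)"
    using i by (intro Cauchy_Schwarz_integral(2)) auto
  also have "\<dots> = sqrt (t - s) * sqrt (integral {s..t} (\<lambda>x. (norm (f x))\<^sup>2))"
    using eq[OF i(2)] eq[OF i(3)] st(2) by simp
  finally show "norm (integral {s..t} f) \<le> \<dots>" .
  have "integral {s..t} (\<lambda>x. (norm (f x))\<^sup>2) \<le> integral {0..L} (\<lambda>x. (norm (f x))\<^sup>2)"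
    using st integrable_interval_sub(2)[OF L2_square_integrable[OF f]]
    by (intro integral_subset_le) auto
  then show "integral {s..t} (\<lambda>x. (norm (f x))\<^sup>2) \<le> (L2_norm L f)\<^sup>2"
    unfolding L2_norm_power2 using integral_interval[OF L2_square_integrable[OF f]] by simp
qed

lemma norm_integral_le_L2_norm:
  fixes f :: "real \<Rightarrow> 'a::euclidean_space"
  assumes f: "f \<in> L2 L" and st: "0 \<le> s" "s \<le> t" "t \<le> L"
  shows "norm (integral {s..t} f) \<le> sqrt (t - s) * L2_norm L f"
proof -
  have "sqrt (integral {s..t} (\<lambda>x. (norm (f x))\<^sup>2)) \<le> sqrt ((L2_norm L f)\<^sup>2)"
    using norm_integral_le_L2_norm_sub(2)[OF assms] by (intro real_sqrt_le_mono)
  then have "sqrt (t - s) * sqrt (integral {s..t} (\<lambda>x. (norm (f x))\<^sup>2)) \<le> sqrt (t - s) * L2_norm L f"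
    using st by (intro mult_left_mono) auto
  then show ?thesis using norm_integral_le_L2_norm_sub(1)[OF assms] by linarith
qed

lemma Hsob_cong_AE:
  fixes f g :: "real \<Rightarrow> 'a::euclidean_space"
  assumes "f \<in> Hsob k L" "g \<in> borel_measurable (\<mu> L)" "AE x in \<mu> L. f x = g x"
  shows "g \<in> Hsob k L"
proof (cases k)
  case 0
  then show ?thesis using assms L2_cong_AE(1) by auto
next
  case (Suc j)
  then obtain h where h: "f \<in> L2 L" "has_weak_deriv L f h" "h \<in> Hsob j L" using assms(1) by auto
  have "has_weak_deriv L g h"
    using h(2) by (intro has_weak_deriv_cong[OF h(2) assms(3) _ assms(2)]) (auto simp: has_weak_deriv_def)
  then show ?thesis using h L2_cong_AE(1)[OF h(1) assms(2,3)] Suc by auto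
qed

text \<open>By uniqueness almost everywhere the chosen derivative inherits the regularity of any
  witness, so iterates of \<open>wderiv\<close> can replace existential witnesses from here
  on.\<close>

lemma Hsob_Suc_iff:
  "f \<in> Hsob (Suc k) L \<longleftrightarrow> f \<in> L2 L \<and> has_weak_deriv L f (wderiv L f) \<and> wderiv L f \<in> Hsob k L"
proof
  assume "f \<in> Hsob (Suc k) L"
  then obtain h where h: "f \<in> L2 L" "has_weak_deriv L f h" "h \<in> Hsob k L" by auto
  have "AE x in \<mu> L. h x = wderiv L f x" using wderiv_spec(2)[OF h(2)] by eventually_elim simp
  moreover have "wderiv L f \<in> borel_measurable (\<mu> L)"
    using wderiv_spec(1)[OF h(2)] by (auto simp: has_weak_deriv_def)
  ultimately have "wderiv L f \<in> Hsob k L" using Hsob_cong_AE[OF h(3)] by blast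
  then show "f \<in> L2 L \<and> has_weak_deriv L f (wderiv L f) \<and> wderiv L f \<in> Hsob k L"
    using h wderiv_spec(1) by blast
qed auto

lemma Hsob_1_iff: "f \<in> Hsob 1 L \<longleftrightarrow> f \<in> L2 L \<and> has_weak_deriv L f (wderiv L f) \<and> wderiv L f \<in> L2 L"
  unfolding One_nat_def Hsob_Suc_iff by simp

lemma Hsob_2_iff: "f \<in> Hsob 2 L \<longleftrightarrow> f \<in> L2 L \<and> has_weak_deriv L f (wderiv L f) \<and> wderiv L f \<in> Hsob 1 L"
  unfolding numeral_2_eq_2 One_nat_def by (rule Hsob_Suc_iff)

lemma Hsob_3_iff: "f \<in> Hsob 3 L \<longleftrightarrow> f \<in> L2 L \<and> has_weak_deriv L f (wderiv L f) \<and> wderiv L f \<in> Hsob 2 L"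
  unfolding numeral_3_eq_3 numeral_2_eq_2 by (rule Hsob_Suc_iff)

lemma Hsob_2_imp_1: "f \<in> Hsob 2 L \<Longrightarrow> f \<in> Hsob 1 L"
  using Hsob_2_iff Hsob_1_iff by blast

lemma wderiv_lin:
  fixes f g :: "real \<Rightarrow> 'a::euclidean_space"
  assumes "has_weak_deriv L f (wderiv L f)" "has_weak_deriv L g (wderiv L g)"
  shows "AE x in \<mu> L. wderiv L (\<lambda>x. a *\<^sub>R f x + b *\<^sub>R g x) x = a *\<^sub>R wderiv L f x + b *\<^sub>R wderiv L g x"
  by (rule wderiv_spec(2)[OF has_weak_deriv_lin[OF assms]])

lemma wderiv_cong_AE:
  fixes f g :: "real \<Rightarrow> 'a::euclidean_space"
  assumes "has_weak_deriv L f (wderiv L f)" "AE x in \<mu> L. f x = g x" "g \<in> borel_measurable (\<mu> L)"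
  shows "AE x in \<mu> L. wderiv L f x = wderiv L g x"
proof -
  have "has_weak_deriv L g (wderiv L f)"
    using assms(1) by (intro has_weak_deriv_cong[OF assms(1,2) _ assms(3)]) (auto simp: has_weak_deriv_def)
  from wderiv_spec(2)[OF this] show ?thesis by eventually_elim simp
qed

lemma Hsob_lin:
  fixes f g :: "real \<Rightarrow> 'a::euclidean_space"
  shows "f \<in> Hsob k L \<Longrightarrow> g \<in> Hsob k L \<Longrightarrow> (\<lambda>x. a *\<^sub>R f x + b *\<^sub>R g x) \<in> Hsob k L"
proof (induction k arbitrary: f g)
  case 0
  then show ?case by (auto intro: L2_lin)
next
  case (Suc k)
  then obtain f' g' where "f \<in> L2 L" "has_weak_deriv L f f'" "f' \<in> Hsob k L"
    "g \<in> L2 L" "has_weak_deriv L g g'" "g' \<in> Hsob k L" by auto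
  then show ?case using Suc.IH[of f' g'] has_weak_deriv_lin[of L f f' g g' a b] L2_lin by auto
qed

lemma Hsob_diff: "f \<in> Hsob k L \<Longrightarrow> g \<in> Hsob k L \<Longrightarrow> (\<lambda>x. f x - g x) \<in> Hsob k L"
  using Hsob_lin[of f k L g 1 "-1"] by simp

lemma L2_norm_le_Hsob_norm: "j \<le> k \<Longrightarrow> L2_norm L ((wderiv L ^^ j) f) \<le> Hsob_norm k L f"
  unfolding Hsob_norm_def
  by (rule real_le_rsqrt) (auto intro!: member_le_sum[where f = "\<lambda>j. (L2_norm L ((wderiv L ^^ j) f))\<^sup>2"])

lemma Hsob_norm_nonneg [simp]: "0 \<le> Hsob_norm k L f"
  by (simp add: Hsob_norm_def sum_nonneg)

lemma Hsob_norm_le_sum: "Hsob_norm k L f \<le> (\<Sum>j\<le>k. L2_norm L ((wderiv L ^^ j) f))"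
  using L2_set_le_sum[of "{..k}" "\<lambda>j. L2_norm L ((wderiv L ^^ j) f)"]
  by (simp add: Hsob_norm_def L2_set_def)

lemma Hsob_norm_1_le: "Hsob_norm 1 L f \<le> L2_norm L f + L2_norm L (wderiv L f)"
  using Hsob_norm_le_sum[of 1 L f] by simp

lemma Hsob_norm_2_le: "Hsob_norm 2 L f \<le> L2_norm L f + L2_norm L (wderiv L f) + L2_norm L (wderiv L (wderiv L f))"
  using Hsob_norm_le_sum[of 2 L f] by (simp add: numeral_2_eq_2)

lemma Hsob_norm_2_eq: "(Hsob_norm 2 L f)\<^sup>2 = (L2_norm L f)\<^sup>2 + (Hsob_norm 1 L (wderiv L f))\<^sup>2"
  by (simp add: Hsob_norm_def numeral_2_eq_2 sum_nonneg)

lemma cont_rep_Hsob: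
  fixes f :: "real \<Rightarrow> 'a::euclidean_space"
  assumes "L > 0" "f \<in> Hsob 1 L"
  shows "continuous_on {0..L} (cont_rep L f)" "AE x in \<mu> L. cont_rep L f x = f x"
    "0 \<le> s \<Longrightarrow> s \<le> t \<Longrightarrow> t \<le> L \<Longrightarrow> cont_rep L f t - cont_rep L f s = integral {s..t} (wderiv L f)"
  using cont_rep_has_weak_deriv[OF assms(1)] assms(2) Hsob_1_iff by blast+

lemma cont_rep_lin:
  fixes f g :: "real \<Rightarrow> 'a::euclidean_space"
  assumes "L > 0" "f \<in> Hsob 1 L" "g \<in> Hsob 1 L" "x \<in> {0..L}"
  shows "cont_rep L (\<lambda>x. a *\<^sub>R f x + b *\<^sub>R g x) x = a *\<^sub>R cont_rep L f x + b *\<^sub>R cont_rep L g x"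
proof (rule cont_rep_eqI(3)[OF assms(1) _ _ assms(4)])
  show "continuous_on {0..L} (\<lambda>x. a *\<^sub>R cont_rep L f x + b *\<^sub>R cont_rep L g x)"
    by (intro continuous_intros cont_rep_Hsob assms)
  show "AE x in \<mu> L. a *\<^sub>R cont_rep L f x + b *\<^sub>R cont_rep L g x = a *\<^sub>R f x + b *\<^sub>R g x"
    using cont_rep_Hsob(2)[OF assms(1,2)] cont_rep_Hsob(2)[OF assms(1,3)] by eventually_elim simp
qed

lemma cont_rep_holder:
  fixes f :: "real \<Rightarrow> 'a::euclidean_space"
  assumes "L > 0" "f \<in> Hsob 1 L" "s \<in> {0..L}" "t \<in> {0..L}"
  shows "norm (cont_rep L f t - cont_rep L f s) \<le> sqrt \<bar>t - s\<bar> * L2_norm L (wderiv L f)"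
proof -
  have *: "norm (cont_rep L f t - cont_rep L f s) \<le> sqrt (t - s) * L2_norm L (wderiv L f)"
    if "0 \<le> s" "s \<le> t" "t \<le> L" for s t
  proof -
    have "wderiv L f \<in> L2 L" using assms(2) Hsob_1_iff by blast
    from norm_integral_le_L2_norm[OF this that] show ?thesis
      using cont_rep_Hsob(3)[OF assms(1,2) that] by simp
  qed
  show ?thesis
    using *[of s t] *[of t s] assms(3,4) by (cases "s \<le> t") (auto simp: norm_minus_commute)
qed

text \<open>The value at \<open>t\<close> exceeds that at \<open>s\<close> by at most sqrt L times
  the norm of the derivative. Integration over \<open>s\<close> and division by L give the factor 1
  / sqrt L for the function and sqrt L for the derivative.\<close>

lemma cont_rep_bound:
  fixes f :: "real \<Rightarrow> 'a::euclidean_space"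
  assumes L: "L > 0" and f: "f \<in> Hsob 1 L" and t: "t \<in> {0..L}"
  shows "norm (cont_rep L f t) \<le> (1 / sqrt L + sqrt L) * Hsob_norm 1 L f"
proof -
  let ?r = "cont_rep L f" and ?H = "Hsob_norm 1 L f"
  have f': "f \<in> L2 L" using f Hsob_1_iff by blast
  have d: "L2_norm L (wderiv L f) \<le> ?H" "L2_norm L f \<le> ?H"
    using L2_norm_le_Hsob_norm[of 1 1 L f] L2_norm_le_Hsob_norm[of 0 1 L f] by auto
  have "AE s in \<mu> L. norm (?r t) \<le> norm (f s) + sqrt L * ?H"
  proof -
    have *: "norm (?r t) \<le> norm (?r s) + sqrt L * ?H" if s: "0 < s" "s < L" for s
    proof -
      have "norm (?r t) \<le> norm (?r s) + norm (?r t - ?r s)" using norm_triangle_sub by blast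
      also have "norm (?r t - ?r s) \<le> sqrt \<bar>t - s\<bar> * L2_norm L (wderiv L f)"
        using s by (intro cont_rep_holder[OF L f _ t]) auto
      also have "\<dots> \<le> sqrt L * ?H" using t s d by (intro mult_mono) auto
      finally show ?thesis by simp
    qed
    have "AE s in \<mu> L. norm (?r t) \<le> norm (?r s) + sqrt L * ?H" using * by (rule AE_intervalI)
    then show ?thesis using cont_rep_Hsob(2)[OF L f] by eventually_elim simp
  qed
  moreover have c: "integrable (\<mu> L) (\<lambda>s. k)" for k :: real
    by (intro continuous_integrable_interval continuous_intros)
  moreover have nf: "integrable (\<mu> L) (\<lambda>s. norm (f s))" using L2_integrable[OF f'] by simp
  ultimately have "(\<integral>s. norm (?r t) \<partial>\<mu> L) \<le> (\<integral>s. norm (f s) + sqrt L * ?H \<partial>\<mu> L)"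
    by (intro integral_mono_AE) (auto intro: Bochner_Integration.integrable_add)
  also have "\<dots> = (\<integral>s. norm (f s) \<partial>\<mu> L) + (\<integral>s. sqrt L * ?H \<partial>\<mu> L)"
    by (rule Bochner_Integration.integral_add[OF nf c])
  also have "(\<integral>s. norm (f s) \<partial>\<mu> L) \<le> sqrt L * ?H"
    by (rule order_trans[OF integral_norm_le_L2_norm[OF _ f']]) (use d(2) L in \<open>auto intro: mult_left_mono\<close>)
  finally have "(\<integral>s. norm (?r t) \<partial>\<mu> L) \<le> sqrt L * ?H + (\<integral>s. sqrt L * ?H \<partial>\<mu> L)" by simp
  then have "L * norm (?r t) \<le> sqrt L * ?H + L * (sqrt L * ?H)"
    unfolding integral_interval[OF c] using L by (simp add: algebra_simps)
  also have "\<dots> = L * ((1 / sqrt L + sqrt L) * ?H)"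
    using L by (simp add: field_simps) (simp flip: real_sqrt_mult power2_eq_square mult.assoc)
  finally show ?thesis using L by simp
qed

lemma Hsob_1_constructor:
  fixes f g :: "real \<Rightarrow> 'a::euclidean_space"
  assumes L: "L > 0" and g: "g \<in> L2 L" and f: "\<And>x. 0 \<le> x \<Longrightarrow> x \<le> L \<Longrightarrow> f x = c + integral {0..x} g"
  shows "continuous_on {0..L} f" "has_weak_deriv L f g" "f \<in> Hsob 1 L"
    "AE x in \<mu> L. wderiv L f x = g x" "x \<in> {0..L} \<Longrightarrow> cont_rep L f x = f x"
proof -
  have "continuous_on {0..L} (\<lambda>x. c + integral {0..x} g)"
    by (intro continuous_intros continuous_on_primitive[OF L2_integrable[OF g]])
  then show c: "continuous_on {0..L} f" using f by (subst continuous_on_cong[OF refl]) auto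
  show w: "has_weak_deriv L f g" by (rule has_weak_derivI[OF L2_integrable[OF g] f])
  then show "f \<in> Hsob 1 L" using g continuous_L2[OF c] by (auto simp: One_nat_def)
  show "AE x in \<mu> L. wderiv L f x = g x" by (rule wderiv_spec(2)[OF w])
  show "x \<in> {0..L} \<Longrightarrow> cont_rep L f x = f x"
    by (rule cont_rep_eqI(3)[OF L c]) auto
qed

section \<open>Functionals of boundary values\<close>

lemma Hsob_norm_1_AE_zero:
  fixes f :: "real \<Rightarrow> 'a::euclidean_space"
  assumes f: "f \<in> Hsob 1 L" and z: "AE x in \<mu> L. f x = 0"
  shows "Hsob_norm 1 L f = 0"
proof -
  have n0: "L2_norm L g = 0" if "AE x in \<mu> L. g x = 0" "g \<in> L2 L" for g :: "real \<Rightarrow> 'a"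
  proof -
    have "L2_norm L (\<lambda>x. 0::'a) = L2_norm L g"
      by (rule L2_cong_AE(2)[OF that(2) _ that(1)]) simp
    then show ?thesis by (simp add: L2_norm_def)
  qed
  have f': "f \<in> L2 L" "has_weak_deriv L f (wderiv L f)" "wderiv L f \<in> L2 L" using f Hsob_1_iff by blast+
  have "has_weak_deriv L f (\<lambda>x. 0)"
  proof (rule has_weak_deriv_cong[OF has_weak_deriv_primitive[of L "\<lambda>x. 0" 0]])
    show "AE x in \<mu> L. 0 + integral {0..x} (\<lambda>x. 0) = f x" using z by eventually_elim simp
  qed (use L2_measurable[OF f'(1)] in auto)
  from wderiv_spec(2)[OF this] have "AE x in \<mu> L. wderiv L f x = 0" .
  then have "L2_norm L f + L2_norm L (wderiv L f) = 0" using n0[OF z f'(1)] n0[OF _ f'(3)] by simp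
  then show ?thesis using Hsob_norm_1_le[of L f] Hsob_norm_nonneg[of 1 L f] by linarith
qed

lemma has_weak_deriv_measurable:
  "has_weak_deriv L f g \<Longrightarrow> f \<in> borel_measurable (\<mu> L)"
  "has_weak_deriv L f g \<Longrightarrow> g \<in> borel_measurable (\<mu> L)"
  by (auto simp: has_weak_deriv_def)

text \<open>Functionals on a single curve. Composed with the maps from (y, b) to y, y' and b they
  become functionals on V, against which weak convergence can be tested.\<close>

definition bounded_linear_H1 :: "real \<Rightarrow> (curve \<Rightarrow> real) \<Rightarrow> bool" where
  "bounded_linear_H1 L G \<longleftrightarrow>
     (\<forall>f\<in>Hsob 1 L. \<forall>g\<in>Hsob 1 L. \<forall>a b. G (\<lambda>x. a *\<^sub>R f x + b *\<^sub>R g x) = a * G f + b * G g) \<and>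
     (\<exists>C. \<forall>f\<in>Hsob 1 L. \<bar>G f\<bar> \<le> C * Hsob_norm 1 L f)"

text \<open>By linearity and boundedness the difference is mapped to 0. This is needed because the
  chosen derivative of a linear combination equals the combination of the chosen derivatives only
  almost everywhere.\<close>

lemma bounded_linear_H1_cong_AE:
  assumes G: "bounded_linear_H1 L G" and fg: "f \<in> Hsob 1 L" "g \<in> Hsob 1 L" "AE x in \<mu> L. f x = g x"
  shows "G f = G g"
proof -
  obtain C where C: "\<And>f. f \<in> Hsob 1 L \<Longrightarrow> \<bar>G f\<bar> \<le> C * Hsob_norm 1 L f"
    using G by (auto simp: bounded_linear_H1_def)
  let ?d = "\<lambda>x. 1 *\<^sub>R f x + (-1) *\<^sub>R g x"
  have d: "?d \<in> Hsob 1 L" by (rule Hsob_lin[OF fg(1,2)])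
  have "AE x in \<mu> L. ?d x = 0" using fg(3) by eventually_elim simp
  from Hsob_norm_1_AE_zero[OF d this] C[OF d] have "G ?d = 0" by simp
  moreover have "G ?d = 1 * G f + (-1) * G g" using G fg unfolding bounded_linear_H1_def by blast
  ultimately show ?thesis by simp
qed

lemma V_norm_ge:
  "Hsob_norm 1 L (snd u) \<le> V_norm L u" "Hsob_norm 2 L (fst u) \<le> V_norm L u"
  "Hsob_norm 1 L (fst u) \<le> V_norm L u" "Hsob_norm 1 L (wderiv L (fst u)) \<le> V_norm L u"
proof -
  show "Hsob_norm 1 L (snd u) \<le> V_norm L u" and 2: "Hsob_norm 2 L (fst u) \<le> V_norm L u"
    unfolding V_norm_def by (auto intro!: real_le_rsqrt)
  have "Hsob_norm 1 L (fst u) \<le> Hsob_norm 2 L (fst u)"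
    unfolding Hsob_norm_def by (intro real_sqrt_le_mono sum_mono2) auto
  then show "Hsob_norm 1 L (fst u) \<le> V_norm L u" using 2 by linarith
  have "(Hsob_norm 1 L (wderiv L (fst u)))\<^sup>2 \<le> (Hsob_norm 2 L (fst u))\<^sup>2"
    using Hsob_norm_2_eq[of L "fst u"] by simp
  then have "Hsob_norm 1 L (wderiv L (fst u)) \<le> Hsob_norm 2 L (fst u)"
    by (rule power2_le_imp_le) simp
  then show "Hsob_norm 1 L (wderiv L (fst u)) \<le> V_norm L u" using 2 by linarith
qed

lemma bounded_linear_V_of_H1:
  assumes lin: "\<And>u v a b. u \<in> V L \<Longrightarrow> v \<in> V L \<Longrightarrow>
      F (\<lambda>x. a *\<^sub>R fst u x + b *\<^sub>R fst v x, \<lambda>x. a *\<^sub>R snd u x + b *\<^sub>R snd v x) = a * F u + b * (F v :: real)"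
    and bd: "\<And>u. u \<in> V L \<Longrightarrow> \<bar>F u\<bar> \<le> C * V_norm L u"
  shows "bounded_linear_V L F"
  unfolding bounded_linear_V_def
proof (intro conjI ballI allI)
  fix u v :: "curve \<times> curve" and c assume "u \<in> V L" "v \<in> V L"
  then show "F (V_add u v) = F u + F v" using lin[of u v 1 1] by (simp add: V_add_def)
next
  fix u :: "curve \<times> curve" and c :: real assume u: "u \<in> V L"
  show "F (V_scale c u) = c *\<^sub>R F u" using lin[OF u u, of c 0] by (simp add: V_scale_def)
next
  show "\<exists>C. \<forall>u\<in>V L. norm (F u) \<le> C * V_norm L u"
    unfolding real_norm_def using bd by blast
qed

lemma bounded_linear_V_H1:
  assumes G: "bounded_linear_H1 L G"
  shows "bounded_linear_V L (\<lambda>u. G (fst u))" "bounded_linear_V L (\<lambda>u. G (snd u))"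
    "bounded_linear_V L (\<lambda>u. G (wderiv L (fst u)))"
proof -
  obtain C0 where C0: "\<And>f. f \<in> Hsob 1 L \<Longrightarrow> \<bar>G f\<bar> \<le> C0 * Hsob_norm 1 L f"
    using G by (auto simp: bounded_linear_H1_def)
  have C: "\<bar>G f\<bar> \<le> \<bar>C0\<bar> * K" if "f \<in> Hsob 1 L" "Hsob_norm 1 L f \<le> K" for f K
  proof -
    have "\<bar>G f\<bar> \<le> C0 * Hsob_norm 1 L f" by (rule C0[OF that(1)])
    also have "\<dots> \<le> \<bar>C0\<bar> * Hsob_norm 1 L f" by (intro mult_right_mono) auto
    also have "\<dots> \<le> \<bar>C0\<bar> * K" using that(2) by (intro mult_left_mono) auto
    finally show ?thesis .
  qed
  have lin: "G (\<lambda>x. a *\<^sub>R f x + b *\<^sub>R g x) = a * G f + b * G g" if "f \<in> Hsob 1 L" "g \<in> Hsob 1 L" for f g a b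
    using G that by (auto simp: bounded_linear_H1_def)
  have V: "fst u \<in> Hsob 2 L" "snd u \<in> Hsob 1 L" "fst u \<in> Hsob 1 L" "wderiv L (fst u) \<in> Hsob 1 L"
    "has_weak_deriv L (fst u) (wderiv L (fst u))"
    if "u \<in> V L" for u
    using that Hsob_2_imp_1[of "fst u" L] Hsob_2_iff[of "fst u" L] by (auto simp: V_def)
  show "bounded_linear_V L (\<lambda>u. G (fst u))"
    by (rule bounded_linear_V_of_H1[where C = "\<bar>C0\<bar>"])
      (simp_all only: fst_conv lin[OF V(3) V(3)] C[OF V(3) V_norm_ge(3)])
  show "bounded_linear_V L (\<lambda>u. G (snd u))"
    by (rule bounded_linear_V_of_H1[where C = "\<bar>C0\<bar>"])
      (simp_all only: snd_conv lin[OF V(2) V(2)] C[OF V(2) V_norm_ge(1)])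
  show "bounded_linear_V L (\<lambda>u. G (wderiv L (fst u)))"
  proof (rule bounded_linear_V_of_H1)
    show "\<bar>G (wderiv L (fst u))\<bar> \<le> \<bar>C0\<bar> * V_norm L u" if "u \<in> V L" for u
      using C V(4)[OF that] V_norm_ge(4) by blast
    fix u v a b assume u: "u \<in> V L" and v: "v \<in> V L"
    let ?s = "\<lambda>x. a *\<^sub>R fst u x + b *\<^sub>R fst v x"
    have "wderiv L ?s \<in> Hsob 1 L"
      using Hsob_lin[OF V(1)[OF u] V(1)[OF v]] Hsob_2_iff by blast
    then have "G (wderiv L ?s) = G (\<lambda>x. a *\<^sub>R wderiv L (fst u) x + b *\<^sub>R wderiv L (fst v) x)"
      by (intro bounded_linear_H1_cong_AE[OF G] Hsob_lin V u v wderiv_lin)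
    also have "\<dots> = a * G (wderiv L (fst u)) + b * G (wderiv L (fst v))"
      by (rule lin[OF V(4)[OF u] V(4)[OF v]])
    finally show "G (wderiv L (fst (?s, \<lambda>x. a *\<^sub>R snd u x + b *\<^sub>R snd v x)))
        = a * G (wderiv L (fst u)) + b * G (wderiv L (fst v))" by simp
  qed
qed

text \<open>In one dimension point evaluation is bounded on H^1, the end points included; this is
  why weak convergence yields pointwise convergence.\<close>

lemma bounded_linear_H1_point:
  assumes "L > 0" "t \<in> {0..L}"
  shows "bounded_linear_H1 L (\<lambda>f. cont_rep L f t \<bullet> e)"
  unfolding bounded_linear_H1_def
proof (intro conjI ballI allI exI)
  fix f g :: curve and a b assume "f \<in> Hsob 1 L" "g \<in> Hsob 1 L"
  then show "cont_rep L (\<lambda>x. a *\<^sub>R f x + b *\<^sub>R g x) t \<bullet> e = a * (cont_rep L f t \<bullet> e) + b * (cont_rep L g t \<bullet> e)"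
    using assms by (simp add: cont_rep_lin inner_add)
next
  fix f :: curve assume f: "f \<in> Hsob 1 L"
  have "\<bar>cont_rep L f t \<bullet> e\<bar> \<le> norm (cont_rep L f t) * norm e" by (rule Cauchy_Schwarz_ineq2)
  also have "\<dots> \<le> ((1 / sqrt L + sqrt L) * Hsob_norm 1 L f) * norm e"
    by (intro mult_right_mono cont_rep_bound assms f) auto
  finally show "\<bar>cont_rep L f t \<bullet> e\<bar> \<le> ((1 / sqrt L + sqrt L) * norm e) * Hsob_norm 1 L f" by (simp add: mult_ac)
qed

lemma bounded_linear_H1_wderiv:
  assumes g: "g \<in> L2 L"
  shows "bounded_linear_H1 L (\<lambda>f. \<integral>x. wderiv L f x \<bullet> g x \<partial>\<mu> L)"
  unfolding bounded_linear_H1_def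
proof (intro conjI ballI allI exI)
  fix f k :: curve and a b assume "f \<in> Hsob 1 L" "k \<in> Hsob 1 L"
  then have f: "has_weak_deriv L f (wderiv L f)" "wderiv L f \<in> L2 L"
    and k: "has_weak_deriv L k (wderiv L k)" "wderiv L k \<in> L2 L" using Hsob_1_iff by blast+
  let ?s = "\<lambda>x. a *\<^sub>R f x + b *\<^sub>R k x"
  have [measurable]: "wderiv L ?s \<in> borel_measurable (\<mu> L)" "wderiv L f \<in> borel_measurable (\<mu> L)"
     "wderiv L k \<in> borel_measurable (\<mu> L)" "g \<in> borel_measurable (\<mu> L)"
    using has_weak_deriv_measurable(2)[OF wderiv_spec(1)[OF has_weak_deriv_lin[OF f(1) k(1)]]]
      L2_measurable[OF f(2)] L2_measurable[OF k(2)] L2_measurable[OF g] by blast+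
  have "(\<integral>x. wderiv L ?s x \<bullet> g x \<partial>\<mu> L) = (\<integral>x. a * (wderiv L f x \<bullet> g x) + b * (wderiv L k x \<bullet> g x) \<partial>\<mu> L)"
    by (rule integral_cong_AE, measurable) (use wderiv_lin[OF f(1) k(1), of a b] in \<open>auto simp: inner_add\<close>)
  also have "\<dots> = a * (\<integral>x. wderiv L f x \<bullet> g x \<partial>\<mu> L) + b * (\<integral>x. wderiv L k x \<bullet> g x \<partial>\<mu> L)"
    using L2_inner(1)[OF f(2) g] L2_inner(1)[OF k(2) g] by simp
  finally show "(\<integral>x. wderiv L ?s x \<bullet> g x \<partial>\<mu> L) = \<dots>" .
next
  fix f :: curve assume "f \<in> Hsob 1 L"
  then have "wderiv L f \<in> L2 L" using Hsob_1_iff by blast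
  from L2_inner(2)[OF this g]
  have "\<bar>\<integral>x. wderiv L f x \<bullet> g x \<partial>\<mu> L\<bar> \<le> L2_norm L g * L2_norm L (wderiv L f)" by (simp add: mult.commute)
  also have "\<dots> \<le> L2_norm L g * Hsob_norm 1 L f"
    using L2_norm_le_Hsob_norm[of 1 1 L f] by (intro mult_left_mono) auto
  finally show "\<bar>\<integral>x. wderiv L f x \<bullet> g x \<partial>\<mu> L\<bar> \<le> L2_norm L g * Hsob_norm 1 L f" .
qed

text \<open>Collects the test functionals used below: point values of y, y' and b, and pairings of
  y'' and b' with square integrable fields. Only y'' and b' converge merely weakly; the point values
  allow limits in products.\<close>

lemma weakly_converges_V_tendsto:
  assumes w: "weakly_converges_V L u v" and L: "L > 0"
  shows "t \<in> {0..L} \<Longrightarrow> (\<lambda>n. cont_rep L (fst (u n)) t) \<longlonglongrightarrow> cont_rep L (fst v) t"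
    "t \<in> {0..L} \<Longrightarrow> (\<lambda>n. cont_rep L (wderiv L (fst (u n))) t) \<longlonglongrightarrow> cont_rep L (wderiv L (fst v)) t"
    "t \<in> {0..L} \<Longrightarrow> (\<lambda>n. cont_rep L (snd (u n)) t) \<longlonglongrightarrow> cont_rep L (snd v) t"
    "g \<in> L2 L \<Longrightarrow> (\<lambda>n. \<integral>x. wderiv L (wderiv L (fst (u n))) x \<bullet> g x \<partial>\<mu> L) \<longlonglongrightarrow> (\<integral>x. wderiv L (wderiv L (fst v)) x \<bullet> g x \<partial>\<mu> L)"
    "g \<in> L2 L \<Longrightarrow> (\<lambda>n. \<integral>x. wderiv L (snd (u n)) x \<bullet> g x \<partial>\<mu> L) \<longlonglongrightarrow> (\<integral>x. wderiv L (snd v) x \<bullet> g x \<partial>\<mu> L)"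
proof -
  have F: "(\<lambda>n. F (u n)) \<longlonglongrightarrow> F v" if "bounded_linear_V L F" for F :: "curve \<times> curve \<Rightarrow> real"
    using w that unfolding weakly_converges_V_def by blast
  show "(\<lambda>n. cont_rep L (fst (u n)) t) \<longlonglongrightarrow> cont_rep L (fst v) t" if t: "t \<in> {0..L}"
    unfolding tendsto_componentwise_iff[of "\<lambda>n. cont_rep L (fst (u n)) t"]
    using F[OF bounded_linear_V_H1(1)[OF bounded_linear_H1_point[OF L t]]] by blast
  show "(\<lambda>n. cont_rep L (wderiv L (fst (u n))) t) \<longlonglongrightarrow> cont_rep L (wderiv L (fst v)) t" if t: "t \<in> {0..L}"
    unfolding tendsto_componentwise_iff[of "\<lambda>n. cont_rep L (wderiv L (fst (u n))) t"]
    using F[OF bounded_linear_V_H1(3)[OF bounded_linear_H1_point[OF L t]]] by blast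
  show "(\<lambda>n. cont_rep L (snd (u n)) t) \<longlonglongrightarrow> cont_rep L (snd v) t" if t: "t \<in> {0..L}"
    unfolding tendsto_componentwise_iff[of "\<lambda>n. cont_rep L (snd (u n)) t"]
    using F[OF bounded_linear_V_H1(2)[OF bounded_linear_H1_point[OF L t]]] by blast
  show "g \<in> L2 L \<Longrightarrow> (\<lambda>n. \<integral>x. wderiv L (wderiv L (fst (u n))) x \<bullet> g x \<partial>\<mu> L) \<longlonglongrightarrow> (\<integral>x. wderiv L (wderiv L (fst v)) x \<bullet> g x \<partial>\<mu> L)"
    by (rule F[OF bounded_linear_V_H1(3)[OF bounded_linear_H1_wderiv]])
  show "g \<in> L2 L \<Longrightarrow> (\<lambda>n. \<integral>x. wderiv L (snd (u n)) x \<bullet> g x \<partial>\<mu> L) \<longlonglongrightarrow> (\<integral>x. wderiv L (snd v) x \<bullet> g x \<partial>\<mu> L)"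
    by (rule F[OF bounded_linear_V_H1(2)[OF bounded_linear_H1_wderiv]])
qed

section \<open>Classical derivatives as weak ones, and interpolation of end point values\<close>

lemma C1_imp_primitive:
  fixes f f' :: "real \<Rightarrow> 'a::euclidean_space"
  assumes "\<And>x. x \<in> {0..L} \<Longrightarrow> (f has_vector_derivative f' x) (at x within {0..L})"
    and "0 \<le> x" "x \<le> L"
  shows "f x = f 0 + integral {0..x} f'"
proof -
  have "(f' has_integral (f x - f 0)) {0..x}"
    using assms by (intro fundamental_theorem_of_calculus)
      (auto intro: has_vector_derivative_within_subset[where S = "{0..L}"])
  then show ?thesis by (simp add: integral_unique)
qed

lemma C1_Hsob_1:
  fixes f f' :: "real \<Rightarrow> 'a::euclidean_space"
  assumes L: "L > 0" and c: "continuous_on {0..L} f'"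
    and d: "\<And>x. x \<in> {0..L} \<Longrightarrow> (f has_vector_derivative f' x) (at x within {0..L})"
  shows "f \<in> Hsob 1 L" "has_weak_deriv L f f'" "x \<in> {0..L} \<Longrightarrow> cont_rep L f x = f x"
    "x \<in> {0..L} \<Longrightarrow> cont_rep L (wderiv L f) x = f' x"
proof -
  have p: "f x = f 0 + integral {0..x} f'" if "0 \<le> x" "x \<le> L" for x
    using C1_imp_primitive[OF d that] by blast
  show "f \<in> Hsob 1 L" "has_weak_deriv L f f'" "x \<in> {0..L} \<Longrightarrow> cont_rep L f x = f x"
    using Hsob_1_constructor(2,3,5)[OF L continuous_L2[OF c], of f "f 0"] p by blast+
  have "AE x in \<mu> L. wderiv L f x = f' x"
    by (rule Hsob_1_constructor(4)[OF L continuous_L2[OF c] p])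
  then have "AE x in \<mu> L. f' x = wderiv L f x" by eventually_elim simp
  then show "x \<in> {0..L} \<Longrightarrow> cont_rep L (wderiv L f) x = f' x" by (rule cont_rep_eqI(3)[OF L c])
qed

text \<open>The cubic and affine interpolants of the end point values: on them a functional that depends
  on boundary values only is a linear map on a finite-dimensional space.\<close>

definition hermite :: "real \<Rightarrow> 'a \<Rightarrow> 'a \<Rightarrow> 'a \<Rightarrow> 'a \<Rightarrow> real \<Rightarrow> 'a::real_vector" where
  "hermite L p q p' q' x = p + x *\<^sub>R q + (x\<^sup>2 / L\<^sup>2) *\<^sub>R (3 *\<^sub>R (p' - p) - L *\<^sub>R (2 *\<^sub>R q + q'))
     + (x^3 / L^3) *\<^sub>R (2 *\<^sub>R (p - p') + L *\<^sub>R (q + q'))"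

definition hermite' :: "real \<Rightarrow> 'a \<Rightarrow> 'a \<Rightarrow> 'a \<Rightarrow> 'a \<Rightarrow> real \<Rightarrow> 'a::real_vector" where
  "hermite' L p q p' q' x = q + (2 * x / L\<^sup>2) *\<^sub>R (3 *\<^sub>R (p' - p) - L *\<^sub>R (2 *\<^sub>R q + q'))
     + (3 * x\<^sup>2 / L^3) *\<^sub>R (2 *\<^sub>R (p - p') + L *\<^sub>R (q + q'))"

definition hermite'' :: "real \<Rightarrow> 'a \<Rightarrow> 'a \<Rightarrow> 'a \<Rightarrow> 'a \<Rightarrow> real \<Rightarrow> 'a::real_vector" where
  "hermite'' L p q p' q' x = (2 / L\<^sup>2) *\<^sub>R (3 *\<^sub>R (p' - p) - L *\<^sub>R (2 *\<^sub>R q + q'))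
     + (6 * x / L^3) *\<^sub>R (2 *\<^sub>R (p - p') + L *\<^sub>R (q + q'))"

lemma hermite_deriv:
  fixes p q p' q' :: "'a::euclidean_space"
  assumes "L \<noteq> 0"
  shows "(hermite L p q p' q' has_vector_derivative hermite' L p q p' q' x) (at x within S)"
    "(hermite' L p q p' q' has_vector_derivative hermite'' L p q p' q' x) (at x within S)"
  unfolding hermite_def[abs_def] hermite'_def[abs_def] hermite''_def
  using assms by (auto intro!: derivative_eq_intros simp: power2_eq_square power3_eq_cube)

lemma hermite_boundary:
  fixes p q p' q' :: "'a::euclidean_space"
  assumes "L \<noteq> 0"
  shows "hermite L p q p' q' 0 = p" "hermite L p q p' q' L = p'"
    "hermite' L p q p' q' 0 = q" "hermite' L p q p' q' L = q'"
  unfolding hermite_def hermite'_def using assms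
  by (auto intro!: euclidean_eqI[where 'a = 'a] simp: inner_add inner_diff power2_eq_square power3_eq_cube field_simps)

lemma Hsob_2_I: "f \<in> L2 L \<Longrightarrow> has_weak_deriv L f g \<Longrightarrow> g \<in> Hsob 1 L \<Longrightarrow> f \<in> Hsob 2 L"
  unfolding numeral_2_eq_2 One_nat_def Hsob.simps(2)[of "Suc 0"] by blast

text \<open>Weak convergence tests real functionals only, whereas \<open>Lbc\<close> takes values in
  a normed space. The way around this is the trace: end point values converge, and the linear map
  \<open>T\<close> that computes \<open>Lbc\<close> from them is continuous, being defined on a
  finite-dimensional space.\<close>

lemma boundary_functional_weak_limit:
  fixes Lbc :: "curve \<times> curve \<Rightarrow> 'z::real_normed_vector"
  assumes L: "L > 0" and lin: "bounded_linear_V L Lbc" and dep: "depends_on_boundary_values L Lbc"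
    and u: "\<And>n. u n \<in> V L" and v: "v \<in> V L" and w: "weakly_converges_V L u v"
    and bc: "\<And>n. Lbc (u n) = lbc"
  shows "Lbc v = lbc"
proof -
  \<comment> \<open>A linear right inverse of the trace \<open>tr\<close>: a cubic curve and an
    affine one with prescribed end point data.\<close>
  define E :: "((real^3) \<times> (real^3) \<times> (real^3)) \<times> ((real^3) \<times> (real^3) \<times> (real^3)) \<Rightarrow> curve \<times> curve" where
    "E = (\<lambda>((p, q, r), (p', q', r')). (hermite L p q p' q', \<lambda>x. r + (x / L) *\<^sub>R (r' - r)))"
  define tr where "tr u = ((cont_rep L (fst u) 0, cont_rep L (wderiv L (fst u)) 0, cont_rep L (snd u) 0),
      (cont_rep L (fst u) L, cont_rep L (wderiv L (fst u)) L, cont_rep L (snd u) L))" for u :: "curve \<times> curve"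
  have E: "E d \<in> V L \<and> tr (E d) = d" for d
  proof -
    obtain p q r p' q' r' where d: "d = ((p, q, r), (p', q', r'))" by (metis prod.collapse)
    let ?y = "hermite L p q p' q'" and ?y' = "hermite' L p q p' q'" and ?y'' = "hermite'' L p q p' q'"
      and ?b = "\<lambda>x. r + (x / L) *\<^sub>R (r' - r)" and ?b' = "\<lambda>x::real. (1 / L) *\<^sub>R (r' - r)"
    have L0: "L \<noteq> 0" using L by simp
    have c: "continuous_on {0..L} ?y'" "continuous_on {0..L} ?y''" "continuous_on {0..L} ?b'"
      using L unfolding hermite'_def[abs_def] hermite''_def[abs_def] by (auto intro!: continuous_intros)
    have b: "(?b has_vector_derivative ?b' x) (at x within {0..L})" for x
      using L0 by (auto intro!: derivative_eq_intros)
    note y = C1_Hsob_1[OF L c(1) hermite_deriv(1)[OF L0]] and y' = C1_Hsob_1[OF L c(2) hermite_deriv(2)[OF L0]]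
    note b1 = C1_Hsob_1[OF L c(3) b]
    have "?y \<in> L2 L" using y(1) Hsob_1_iff by blast
    then have "?y \<in> Hsob 2 L"
      by (rule Hsob_2_I[OF _ y(2) y'(1)])
    moreover have "tr (E d) = d"
      using L y(3)[of 0] y(3)[of L] y(4)[of 0] y(4)[of L] b1(3)[of 0] b1(3)[of L] hermite_boundary[OF L0, of p q p' q']
      by (simp add: tr_def E_def d)
    ultimately show ?thesis using b1(1) by (simp add: V_def E_def d)
  qed
  define T where "T d = Lbc (E d)" for d
  have T: "T (tr u) = Lbc u" if u: "u \<in> V L" for u
  proof -
    obtain y b where yb: "u = (y, b)" by fastforce
    obtain z d where zd: "E (tr u) = (z, d)" by fastforce
    have "tr (z, d) = tr (y, b)" using E[of "tr u"] zd yb by metis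
    then have "\<forall>x\<in>{0, L}. cont_rep L y x = cont_rep L z x \<and>
        cont_rep L (wderiv L y) x = cont_rep L (wderiv L z) x \<and> cont_rep L b x = cont_rep L d x"
      by (simp add: tr_def)
    moreover have "(z, d) \<in> V L" using E zd by metis
    ultimately have "Lbc (y, b) = Lbc (z, d)"
      using dep u yb unfolding depends_on_boundary_values_def by blast
    then show ?thesis using yb zd by (simp add: T_def)
  qed
  have "linear T"
  proof (rule linearI)
    show "T (c + d) = T c + T d" for c d
    proof -
      have "E (c + d) = V_add (E c) (E d)"
        by (cases c rule: prod.exhaust, cases d rule: prod.exhaust)
          (auto simp: E_def V_add_def hermite_def algebra_simps split: prod.splits)
      then show ?thesis using lin E unfolding T_def bounded_linear_V_def by simp
    qed
    show "T (a *\<^sub>R d) = a *\<^sub>R T d" for a d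
    proof -
      have "E (a *\<^sub>R d) = V_scale a (E d)"
        by (cases d rule: prod.exhaust)
          (auto simp: E_def V_scale_def hermite_def algebra_simps split: prod.splits)
      then show ?thesis using lin E unfolding T_def bounded_linear_V_def by simp
    qed
  qed
  then have "bounded_linear T" by (simp add: linear_conv_bounded_linear)
  moreover have "(\<lambda>n. tr (u n)) \<longlonglongrightarrow> tr v"
    unfolding tr_def using L by (intro tendsto_Pair weakly_converges_V_tendsto(1-3)[OF w L]) auto
  ultimately have "(\<lambda>n. T (tr (u n))) \<longlonglongrightarrow> T (tr v)"
    by (rule bounded_linear.tendsto)
  then have "(\<lambda>n. lbc) \<longlonglongrightarrow> Lbc v" using T[OF u] T[OF v] bc by simp
  then show ?thesis by (simp add: LIMSEQ_const_iff)
qed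

section \<open>The integrand, its envelope representation and its regularization\<close>

text \<open>\<open>Qbar\<close> is the upper envelope of a family of nonnegative quadratic forms; this is where its
  convexity comes from.\<close>

definition Qopt :: "real \<Rightarrow> real \<Rightarrow> real" where
  "Qopt a b = (if \<bar>b\<bar> \<le> \<bar>a\<bar> then b\<^sup>2 / a\<^sup>2 else 1)"

lemma Qopt_bounds: "0 \<le> Qopt a b" "Qopt a b \<le> 1"
proof -
  have "b\<^sup>2 \<le> a\<^sup>2" if "\<bar>b\<bar> \<le> \<bar>a\<bar>" using that by (simp add: abs_le_square_iff)
  then show "0 \<le> Qopt a b" "Qopt a b \<le> 1"
    by (auto simp: Qopt_def divide_le_eq)
qed

text \<open>For |b| <= |a| the gap is the square (b^2 - l a^2)^2 / a^2, which also reveals the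
  maximizer l = b^2 / a^2. For |b| > |a| the gap factors as (1 - l) (2 b^2 - (1 + l) a^2), so the
  maximum sits at the end point l = 1. Both values are those of \<open>Qopt\<close>.\<close>

lemma Qbar_ge:
  assumes l: "0 \<le> l" "l \<le> 1"
  shows "(1 - l\<^sup>2) * a\<^sup>2 + 2 * (1 + l) * b\<^sup>2 \<le> Qbar a b"
proof (cases "\<bar>b\<bar> \<le> \<bar>a\<bar>")
  case True
  show ?thesis
  proof (cases "a = 0")
    case False
    have "0 \<le> (b\<^sup>2 - l * a\<^sup>2)\<^sup>2 / a\<^sup>2" by simp
    also have "\<dots> = (a\<^sup>2 + b\<^sup>2)\<^sup>2 / a\<^sup>2 - ((1 - l\<^sup>2) * a\<^sup>2 + 2 * (1 + l) * b\<^sup>2)"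
      using False by (simp add: field_simps power2_eq_square)
    finally show ?thesis using True by (simp add: Qbar_def)
  qed (use True in \<open>simp add: Qbar_def\<close>)
next
  case False
  then have "a\<^sup>2 \<le> b\<^sup>2" by (simp add: abs_le_square_iff[symmetric])
  then have "(1 + l) * a\<^sup>2 \<le> 2 * b\<^sup>2" using l by (intro mult_mono) auto
  then have "0 \<le> (1 - l) * (2 * b\<^sup>2 - (1 + l) * a\<^sup>2)" using l by simp
  also have "\<dots> = 4 * b\<^sup>2 - ((1 - l\<^sup>2) * a\<^sup>2 + 2 * (1 + l) * b\<^sup>2)" by (simp add: algebra_simps power2_eq_square)
  finally show ?thesis using False by (simp add: Qbar_def)
qed

lemma Qbar_eq: "Qbar a b = (1 - (Qopt a b)\<^sup>2) * a\<^sup>2 + 2 * (1 + Qopt a b) * b\<^sup>2"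
proof (cases "\<bar>b\<bar> \<le> \<bar>a\<bar>")
  case True
  show ?thesis
    using True by (cases "a = 0") (auto simp: Qbar_def Qopt_def field_simps power2_eq_square)
qed (simp add: Qbar_def Qopt_def)

text \<open>The parameter that is optimal for one pair competes for the other, so the difference is
  controlled by one form of the family. The constants 1 and 4 are the largest values of the
  coefficients 1 - l^2 and 2 (1 + l) on [0, 1].\<close>

lemma Qbar_Lipschitz: "\<bar>Qbar a b - Qbar a' b'\<bar> \<le> \<bar>a\<^sup>2 - a'\<^sup>2\<bar> + 4 * \<bar>b\<^sup>2 - b'\<^sup>2\<bar>"
proof -
  have *: "Qbar a b - Qbar a' b' \<le> \<bar>a\<^sup>2 - a'\<^sup>2\<bar> + 4 * \<bar>b\<^sup>2 - b'\<^sup>2\<bar>" for a b a' b'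
  proof -
    define l where "l = Qopt a b"
    have l: "0 \<le> l" "l \<le> 1" using Qopt_bounds by (auto simp: l_def)
    then have l2: "0 \<le> 1 - l\<^sup>2" "1 - l\<^sup>2 \<le> 1" by (auto simp: power_le_one)
    have "Qbar a b - Qbar a' b' \<le> (1 - l\<^sup>2) * (a\<^sup>2 - a'\<^sup>2) + 2 * (1 + l) * (b\<^sup>2 - b'\<^sup>2)"
      using Qbar_eq[of a b] Qbar_ge[OF l, of a' b'] by (simp add: l_def algebra_simps)
    also have "(1 - l\<^sup>2) * (a\<^sup>2 - a'\<^sup>2) \<le> (1 - l\<^sup>2) * \<bar>a\<^sup>2 - a'\<^sup>2\<bar>" using l2 by (intro mult_left_mono) auto
    also have "\<dots> \<le> 1 * \<bar>a\<^sup>2 - a'\<^sup>2\<bar>" using l2 by (intro mult_right_mono) auto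
    also have "2 * (1 + l) * (b\<^sup>2 - b'\<^sup>2) \<le> 2 * (1 + l) * \<bar>b\<^sup>2 - b'\<^sup>2\<bar>" using l by (intro mult_left_mono) auto
    also have "\<dots> \<le> 4 * \<bar>b\<^sup>2 - b'\<^sup>2\<bar>" using l by (intro mult_right_mono) auto
    finally show ?thesis by simp
  qed
  show ?thesis using *[of a b a' b'] *[of a' b' a b] by (simp add: abs_minus_commute)
qed

lemma Qbar_bounds: "0 \<le> Qbar a b" "Qbar a b \<le> a\<^sup>2 + 4 * b\<^sup>2"
proof -
  show "0 \<le> Qbar a b" by (simp add: Qbar_def)
  show "Qbar a b \<le> a\<^sup>2 + 4 * b\<^sup>2" using Qbar_Lipschitz[of a b 0 0] by (simp add: Qbar_def)
qed

text \<open>With the exact modulus in place of \<open>m\<close> the regularized integrand would be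
  \<open>Qbar\<close> itself. The error \<open>d\<close> of the modulus enters once directly and
  once through the fraction, where it costs 4 d; half of the sum is 5 / 2 d.\<close>

lemma psi_approximates_Qbar:
  assumes w: "m (a\<^sup>2 - b\<^sup>2) > 0" and d: "\<bar>m (a\<^sup>2 - b\<^sup>2) - \<bar>a\<^sup>2 - b\<^sup>2\<bar>\<bar> \<le> d"
  shows "\<bar>1 / 2 * (a\<^sup>2 + 5 * b\<^sup>2 + psi m (a\<^sup>2) (b\<^sup>2)) - Qbar a b\<bar> \<le> 5 / 2 * d" "0 \<le> psi m (a\<^sup>2) (b\<^sup>2)"
proof -
  define s t k where "s = a\<^sup>2" and "t = b\<^sup>2" and "k = m (s - t)"
  have st: "0 \<le> s" "0 \<le> t" "0 < k" "\<bar>k - \<bar>s - t\<bar>\<bar> \<le> d"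
    using assms by (auto simp: s_def t_def k_def)
  show "0 \<le> psi m (a\<^sup>2) (b\<^sup>2)"
    unfolding psi_def using st by (fold s_def t_def, fold k_def) simp
  let ?D = "s + t + \<bar>s - t\<bar>"
  \<comment> \<open>The denominator \<open>?D\<close> is twice the maximum of \<open>s\<close> and
    \<open>t\<close>, so a single formula covers both branches of \<open>Qbar\<close>, including s =
    t = 0 with 0 / 0 = 0.\<close>
  have Q: "Qbar a b = 1 / 2 * (s + 5 * t + (\<bar>s - t\<bar> + 4 * t\<^sup>2 / ?D))"
  proof (cases "\<bar>b\<bar> \<le> \<bar>a\<bar>")
    case True
    then have ts: "t \<le> s" by (simp add: s_def t_def abs_le_square_iff)
    then have D: "?D = 2 * s" "\<bar>s - t\<bar> = s - t" by auto
    have "Qbar a b = (s + t)\<^sup>2 / s" using True by (simp add: Qbar_def s_def t_def)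
    also have "\<dots> = 1 / 2 * (s + 5 * t + (s - t + 4 * t\<^sup>2 / (2 * s)))"
      using st(2) ts by (cases "s = 0") (auto simp: field_simps power2_eq_square)
    finally show ?thesis using D by simp
  next
    case False
    then have ts: "s < t" by (simp add: s_def t_def abs_le_square_iff[symmetric] not_le[symmetric])
    then have D: "?D = 2 * t" "\<bar>s - t\<bar> = t - s" by auto
    have "Qbar a b = 4 * t" using False by (simp add: Qbar_def t_def)
    then show ?thesis unfolding D using ts st by (simp add: field_simps power2_eq_square)
  qed
  \<comment> \<open>Both denominators are at least \<open>t\<close>; hence the factor t^2 over their
    product is at most 1, and the estimate does not degenerate near the origin.\<close>
  have frac: "\<bar>4 * t\<^sup>2 / (s + t + k) - 4 * t\<^sup>2 / ?D\<bar> \<le> 4 * d"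
  proof (cases "t = 0")
    case False
    then have t: "0 < t" "t \<le> s + t + k" "t \<le> ?D" using st by auto
    then have pos: "0 < s + t + k" "0 < ?D" by linarith+
    have eq: "4 * t\<^sup>2 / (s + t + k) - 4 * t\<^sup>2 / ?D = 4 * (\<bar>s - t\<bar> - k) * (t\<^sup>2 / ((s + t + k) * ?D))"
      using pos by (simp add: field_simps)
    have p: "0 \<le> t\<^sup>2 / ((s + t + k) * ?D)" using pos by simp
    have "\<bar>4 * t\<^sup>2 / (s + t + k) - 4 * t\<^sup>2 / ?D\<bar> = 4 * \<bar>k - \<bar>s - t\<bar>\<bar> * (t\<^sup>2 / ((s + t + k) * ?D))"
      unfolding eq abs_mult abs_of_nonneg[OF p] abs_numeral abs_minus_commute[of "\<bar>s - t\<bar>" k] ..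
    also have "\<dots> \<le> 4 * d * 1"
    proof (rule mult_mono)
      have "t * t \<le> (s + t + k) * ?D" using t by (intro mult_mono) auto
      then show "t\<^sup>2 / ((s + t + k) * ?D) \<le> 1" using pos by (simp add: power2_eq_square)
    qed (use st pos in auto)
    finally show ?thesis by simp
  qed (use st in auto)
  have split: "1 / 2 * (a\<^sup>2 + 5 * b\<^sup>2 + psi m (a\<^sup>2) (b\<^sup>2)) - Qbar a b
     = 1 / 2 * (k - \<bar>s - t\<bar>) + 1 / 2 * (4 * t\<^sup>2 / (s + t + k) - 4 * t\<^sup>2 / ?D)"
    unfolding Q psi_def by (fold s_def t_def, fold k_def) (simp add: algebra_simps)
  have "\<bar>1 / 2 * X + 1 / 2 * Y\<bar> \<le> 5 / 2 * d" if "\<bar>X\<bar> \<le> d" "\<bar>Y\<bar> \<le> 4 * d" for X Y :: real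
    using that unfolding abs_le_iff by linarith
  from this[OF st(4) frac] show "\<bar>1 / 2 * (a\<^sup>2 + 5 * b\<^sup>2 + psi m (a\<^sup>2) (b\<^sup>2)) - Qbar a b\<bar> \<le> 5 / 2 * d"
    unfolding split .
qed

lemma regularized_modulusD:
  assumes "regularized_modulus m c0 c1 c2 cuni" "c0 > 0" "\<delta> > 0"
  shows "continuous_on UNIV (m \<delta>)" "m \<delta> x > 0" "\<bar>m \<delta> x - \<bar>x\<bar>\<bar> \<le> cuni * \<delta>" "0 \<le> cuni * \<delta>"
proof -
  have "Ck_on (Suc (Suc 0)) UNIV (m \<delta>)" and *: "m \<delta> x \<ge> c0 * \<delta>" "\<bar>m \<delta> x - \<bar>x\<bar>\<bar> \<le> cuni * \<delta>" for x
    using assms unfolding regularized_modulus_def by (auto simp: numeral_2_eq_2)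
  then have "Ck_on 0 UNIV (m \<delta>)" using Ck_on_UNIV_Suc_imp by blast
  then show "continuous_on UNIV (m \<delta>)" by simp
  have "0 < c0 * \<delta>" using assms by simp
  then show "m \<delta> x > 0" using *(1)[of x] by linarith
  show "\<bar>m \<delta> x - \<bar>x\<bar>\<bar> \<le> cuni * \<delta>" by (rule *(2))
  then show "0 \<le> cuni * \<delta>" by linarith
qed

section \<open>Splines as Sobolev functions\<close>

lemma mesh_mono:
  assumes "mesh L N x" "i \<le> j" "j \<le> N"
  shows "x i \<le> x j"
  using assms(2,3)
proof (induction j rule: dec_induct)
  case (step j)
  then have "x j < x (Suc j)" using assms(1) by (auto simp: mesh_def)
  then show ?case using step by simp
qed simp

lemma mesh_node_range: "mesh L N x \<Longrightarrow> j \<le> N \<Longrightarrow> x j \<in> {0..L}"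
  using mesh_mono[of L N x 0 j] mesh_mono[of L N x j N] by (auto simp: mesh_def)

lemma mesh_cover:
  assumes m: "mesh L N x" and t: "t \<in> {0..L}"
  obtains j where "j < N" "t \<in> {x j..x (Suc j)}"
proof -
  have N: "N \<ge> 1" "x 0 = 0" "x N = L" using m by (auto simp: mesh_def)
  have "\<exists>j<k. t \<in> {x j..x (Suc j)}" if "1 \<le> k" "k \<le> N" "t \<le> x k" for k
    using that
  proof (induction k rule: dec_induct)
    case base
    then show ?case using t N by auto
  next
    case (step k)
    then show ?case by (cases "t \<le> x k") (auto simp: less_Suc_eq not_le)
  qed
  from this[of N] obtain j where "j < N" "t \<in> {x j..x (Suc j)}" using N t by auto
  then show ?thesis by (rule that)
qed

lemma mesh_size_ge:
  assumes "mesh L N x" "j < N"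
  shows "x (Suc j) - x j \<le> mesh_size N x" "0 < mesh_size N x"
proof -
  show *: "x (Suc j) - x j \<le> mesh_size N x" unfolding mesh_size_def using assms(2) by (intro Max_ge) auto
  have "x j < x (Suc j)" using assms by (auto simp: mesh_def)
  with * show "0 < mesh_size N x" by linarith
qed

lemma mesh_near_node:
  assumes m: "mesh L N x" and t: "t \<in> {0..L}"
  obtains j where "j \<le> N" "\<bar>t - x j\<bar> \<le> mesh_size N x"
proof -
  obtain j where j: "j < N" "t \<in> {x j..x (Suc j)}" using mesh_cover[OF m t] by blast
  then have "\<bar>t - x j\<bar> \<le> mesh_size N x" using mesh_size_ge(1)[OF m j(1)] by auto
  then show ?thesis using that[of j] j by simp
qed

text \<open>A spline may have kinks at the nodes, so the fundamental theorem of calculus is used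
  with the finite set of nodes as exceptional set. The density \<open>deriv f\<close> is
  uncontrolled there, which is why its bound holds almost everywhere and its measurability is drawn
  from integrability.\<close>

lemma piecewise_poly_primitive:
  fixes f :: "real \<Rightarrow> real"
  assumes L: "L > 0" and m: "mesh L N x" and c: "continuous_on {0..L} f"
    and pw: "\<And>j. j < N \<Longrightarrow> \<exists>q. \<forall>t\<in>{x j<..<x (Suc j)}. f t = poly q t"
  obtains g B where "g \<in> borel_measurable (\<mu> L)" "AE t in \<mu> L. \<bar>g t\<bar> \<le> B" "0 \<le> B"
    "\<And>t. 0 \<le> t \<Longrightarrow> t \<le> L \<Longrightarrow> (g has_integral (f t - f 0)) {0..t}"
proof -
  obtain q where q: "\<And>j t. j < N \<Longrightarrow> t \<in> {x j<..<x (Suc j)} \<Longrightarrow> f t = poly (q j) t"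
    using pw by metis
  define g where "g = deriv f"
  let ?S = "x ` {..N}"
  have d: "(f has_real_derivative poly (pderiv (q j)) t) (at t)" if "j < N" "t \<in> {x j<..<x (Suc j)}" for j t
  proof -
    have "((\<lambda>t. poly (q j) t) has_real_derivative poly (pderiv (q j)) t) (at t)" by (rule poly_DERIV)
    then show ?thesis
      by (rule has_field_derivative_transform_within_open[where S = "{x j<..<x (Suc j)}"])
        (use that q in auto)
  qed
  then have g: "g t = poly (pderiv (q j)) t" if "j < N" "t \<in> {x j<..<x (Suc j)}" for j t
    using that by (auto simp: g_def intro: DERIV_imp_deriv)
  have el: "\<exists>j<N. t \<in> {x j<..<x (Suc j)}" if t: "t \<in> {0<..<L} - ?S" for t
  proof -
    obtain j where j: "j < N" "t \<in> {x j..x (Suc j)}" using mesh_cover[OF m, of t] t by auto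
    then have "t \<noteq> x j" "t \<noteq> x (Suc j)" using t by auto
    then show ?thesis using j by (intro exI[of _ j]) auto
  qed
  have int: "(g has_integral (f t - f 0)) {0..t}" if t: "0 \<le> t" "t \<le> L" for t
  proof (rule fundamental_theorem_of_calculus_interior_strong[where S = ?S])
    show "continuous_on {0..t} f" using c t by (auto intro: continuous_on_subset)
    fix s assume "s \<in> {0<..<t} - ?S"
    then obtain j where "j < N" "s \<in> {x j<..<x (Suc j)}" using el[of s] t by auto
    then show "(f has_vector_derivative g s) (at s)"
      using d g by (simp add: has_real_derivative_iff_has_vector_derivative)
  qed (use t in auto)
  have "\<exists>b. \<forall>t\<in>{x j..x (Suc j)}. \<bar>poly (pderiv (q j)) t\<bar> \<le> b" for j
  proof -
    have "compact ((\<lambda>t. poly (pderiv (q j)) t) ` {x j..x (Suc j)})"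
      by (intro compact_continuous_image continuous_intros) simp
    then show ?thesis by (auto dest!: compact_imp_bounded simp: bounded_iff)
  qed
  then obtain b where b: "\<And>j t. t \<in> {x j..x (Suc j)} \<Longrightarrow> \<bar>poly (pderiv (q j)) t\<bar> \<le> b j" by metis
  define B where "B = (\<Sum>j<N. \<bar>b j\<bar>)"
  have B: "\<bar>g t\<bar> \<le> B" if t: "t \<in> {0<..<L} - ?S" for t
  proof -
    obtain j where j: "j < N" "t \<in> {x j<..<x (Suc j)}" using el[OF t] by blast
    then have "\<bar>g t\<bar> \<le> \<bar>b j\<bar>" using b[of t j] g[OF j] by auto
    also have "\<dots> \<le> B" unfolding B_def using j(1) by (intro member_le_sum) auto
    finally show ?thesis .
  qed
  have "?S \<in> null_sets lebesgue" by (intro finite_imp_null_set_lborel null_sets_completionI) simp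
  then have "AE t in lebesgue. t \<notin> ?S" by (rule AE_not_in)
  then have AE: "AE t in \<mu> L. \<bar>g t\<bar> \<le> B" unfolding AE_interval_iff by eventually_elim (use B in blast)
  have "g integrable_on {0<..<L}"
    using int[of L] L integrable_on_open_interval_real[of g 0 L] by (auto simp: integrable_on_def)
  then have "g \<in> borel_measurable (\<mu> L)" by (rule integrable_imp_measurable)
  moreover have "0 \<le> B" unfolding B_def by (intro sum_nonneg) auto
  ultimately show ?thesis using that AE int by blast
qed

lemma Basis_vec_real: "(Basis :: (real^'n) set) = range (\<lambda>i. axis i 1)"
  by (auto simp: Basis_vec_def)

lemma piecewise_poly_Hsob_1:
  fixes f :: "real \<Rightarrow> real^'n"
  assumes L: "L > 0" and m: "mesh L N x" and c: "\<And>i. continuous_on {0..L} (\<lambda>t. f t $ i)"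
    and pw: "\<And>i j. j < N \<Longrightarrow> \<exists>q. \<forall>t\<in>{x j<..<x (Suc j)}. f t $ i = poly q t"
  shows "f \<in> Hsob 1 L" "t \<in> {0..L} \<Longrightarrow> cont_rep L f t = f t"
proof -
  have "\<exists>g B. g \<in> borel_measurable (\<mu> L) \<and> (AE t in \<mu> L. \<bar>g t\<bar> \<le> B) \<and> 0 \<le> B \<and>
    (\<forall>t. 0 \<le> t \<and> t \<le> L \<longrightarrow> (g has_integral (f t $ i - f 0 $ i)) {0..t})" for i
    using piecewise_poly_primitive[OF L m c[of i] pw[of _ i]] by metis
  then obtain g B where g: "\<And>i. g i \<in> borel_measurable (\<mu> L)" "\<And>i. AE t in \<mu> L. \<bar>g i t\<bar> \<le> B i" "\<And>i. 0 \<le> B i"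
    "\<And>i t. 0 \<le> t \<Longrightarrow> t \<le> L \<Longrightarrow> (g i has_integral (f t $ i - f 0 $ i)) {0..t}" by metis
  define G where "G t = (\<chi> i. g i t)" for t
  have Gi: "G t \<bullet> axis i 1 = g i t" for t i by (simp add: G_def inner_axis)
  have mG: "G \<in> borel_measurable (\<mu> L)"
    by (subst borel_measurable_euclidean_space) (auto simp: Basis_vec_real Gi g(1))
  have "AE t in \<mu> L. \<forall>i. \<bar>g i t\<bar> \<le> B i" using g(2) by (simp add: AE_all_countable)
  then have "AE t in \<mu> L. norm (G t) \<le> (\<Sum>i\<in>UNIV. B i)"
  proof eventually_elim
    case (elim t)
    have "norm (G t) \<le> (\<Sum>i\<in>UNIV. \<bar>G t $ i\<bar>)" by (rule norm_le_l1_cart)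
    also have "\<dots> \<le> (\<Sum>i\<in>UNIV. B i)" using elim by (intro sum_mono) (simp add: G_def)
    finally show ?case .
  qed
  then have G: "G \<in> L2 L" using L g(3) by (intro L2_bounded(1)[OF _ mG]) (auto intro: sum_nonneg)
  have p: "f t = f 0 + integral {0..t} G" if t: "0 \<le> t" "t \<le> L" for t
  proof -
    have "(G has_integral (f t - f 0)) {0..t}"
      by (subst has_integral_componentwise_iff)
        (use g(4)[OF t] in \<open>auto simp: Basis_vec_real Gi inner_diff_left inner_axis G_def\<close>)
    then show ?thesis by (simp add: integral_unique)
  qed
  show "f \<in> Hsob 1 L" by (rule Hsob_1_constructor(3)[OF L G p])
  show "t \<in> {0..L} \<Longrightarrow> cont_rep L f t = f t" by (rule Hsob_1_constructor(5)[OF L G p])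
qed

text \<open>\<open>spline\<close> speaks about components, so the derivative of \<open>y\<close> is
  assembled from theirs. It is continuous and piecewise polynomial, hence again in H^1. The
  identities for \<open>cont_rep\<close> translate nodal conditions on classical values into
  statements on Sobolev representatives.\<close>

lemma V_disc_in_V:
  assumes L: "L > 0" and m: "mesh L N x" and yb: "(y, b) \<in> V_disc L N x"
  shows "(y, b) \<in> V L"
    "t \<in> {0..L} \<Longrightarrow> cont_rep L (wderiv L y) t = vector_derivative y (at t within {0..L})"
    "t \<in> {0..L} \<Longrightarrow> cont_rep L b t = b t"
proof -
  have y: "\<And>i. (\<lambda>t. y t $ i) \<in> spline 3 1 L N x" and b: "\<And>i. (\<lambda>t. b t $ i) \<in> spline 1 0 L N x"
    using yb by (auto simp: V_disc_def)
  have b1: "b \<in> Hsob 1 L" and b2: "t \<in> {0..L} \<Longrightarrow> cont_rep L b t = b t" for t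
  proof -
    have c: "continuous_on {0..L} (\<lambda>t. b t $ i)" for i using b[of i] by (simp add: spline_def)
    have pw: "\<exists>q. \<forall>t\<in>{x j<..<x (Suc j)}. b t $ i = poly q t" if "j < N" for i j
      using b[of i] that by (force simp: spline_def)
    show "b \<in> Hsob 1 L" "t \<in> {0..L} \<Longrightarrow> cont_rep L b t = b t"
      using piecewise_poly_Hsob_1[OF L m c pw] by blast+
  qed
  let ?v = "\<lambda>i t. vector_derivative (\<lambda>t. y t $ i) (at t within {0..L})"
  define y' where "y' t = (\<chi> i. ?v i t)" for t
  have dv: "((\<lambda>t. y t $ i) has_vector_derivative ?v i t) (at t within {0..L})" and cv: "continuous_on {0..L} (?v i)"
    if "t \<in> {0..L}" for i t
    using y[of i] that by (auto simp: spline_def One_nat_def vector_derivative_works)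
  have dy: "(y has_vector_derivative y' t) (at t within {0..L})" if "t \<in> {0..L}" for t
    unfolding has_vector_derivative_def
    by (subst has_derivative_componentwise_within)
      (use dv[OF that] in \<open>auto simp: Basis_vec_real inner_axis y'_def has_vector_derivative_def\<close>)
  have cy: "continuous_on {0..L} (\<lambda>t. y' t $ i)" for i
    using cv[of 0 i] L by (simp add: y'_def)
  have pw: "\<exists>q. \<forall>t\<in>{x j<..<x (Suc j)}. y' t $ i = poly q t" if j: "j < N" for i j
  proof -
    obtain q where q: "\<And>t. t \<in> {x j..x (Suc j)} \<Longrightarrow> y t $ i = poly q t"
      using y[of i] j by (auto simp: spline_def)
    have "?v i t = poly (pderiv q) t" if t: "t \<in> {x j<..<x (Suc j)}" for t
    proof -
      have r: "t \<in> {0<..<L}" using t mesh_node_range[OF m, of j] mesh_node_range[OF m, of "Suc j"] j by auto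
      have "(poly q has_real_derivative poly (pderiv q) t) (at t)" by (rule poly_DERIV)
      then have "((\<lambda>t. y t $ i) has_real_derivative poly (pderiv q) t) (at t)"
        by (rule has_field_derivative_transform_within_open[where S = "{x j<..<x (Suc j)}"])
          (use t q in auto)
      then have "vector_derivative (\<lambda>t. y t $ i) (at t) = poly (pderiv q) t"
        by (simp add: has_real_derivative_iff_has_vector_derivative vector_derivative_at)
      then show ?thesis using r by (simp add: at_within_Icc_at)
    qed
    then show ?thesis by (auto simp: y'_def)
  qed
  note y'1 = piecewise_poly_Hsob_1[OF L m cy pw]
  have cy': "continuous_on {0..L} y'"
    by (subst continuous_on_componentwise) (auto simp: Basis_vec_real inner_axis cy)
  note y1 = C1_Hsob_1[OF L cy' dy]
  have "y \<in> L2 L" using y1(1) Hsob_1_iff by blast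
  then have "y \<in> Hsob 2 L"
    using y1(2) y'1(1) by (rule Hsob_2_I)
  then show "(y, b) \<in> V L" using b1 by (simp add: V_def)
  show "t \<in> {0..L} \<Longrightarrow> cont_rep L b t = b t" by (rule b2)
  show "cont_rep L (wderiv L y) t = vector_derivative y (at t within {0..L})" if t: "t \<in> {0..L}"
    using C1_Hsob_1(4)[OF L cy' dy t] vector_derivative_within_closed_interval[OF L t dy[OF t]] by simp
qed

section \<open>Comparison of the regularized energy with the limit energy\<close>

lemma Qbar_integrable:
  fixes f g :: "real \<Rightarrow> 'a::euclidean_space"
  assumes "f \<in> L2 L" "g \<in> L2 L"
  shows "integrable (\<mu> L) (\<lambda>x. Qbar (norm (f x)) (norm (g x)))"
proof -
  have [measurable]: "f \<in> borel_measurable (\<mu> L)" "g \<in> borel_measurable (\<mu> L)"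
    using assms L2_measurable by blast+
  have i: "integrable (\<mu> L) (\<lambda>x. (norm (f x))\<^sup>2 + 4 * (norm (g x))\<^sup>2)"
    using L2_square_integrable[OF assms(1)] L2_square_integrable[OF assms(2)] by auto
  have m: "(\<lambda>x. Qbar (norm (f x)) (norm (g x))) \<in> borel_measurable (\<mu> L)"
    unfolding Qbar_def by measurable
  show ?thesis
    by (rule Bochner_Integration.integrable_bound[OF i m]) (use Qbar_bounds in \<open>auto simp: abs_of_nonneg\<close>)
qed

lemma V_wderivs:
  assumes "(y, b) \<in> V L"
  shows "wderiv L (wderiv L y) \<in> L2 L" "wderiv L b \<in> L2 L" "wderiv L y \<in> L2 L" "b \<in> L2 L" "y \<in> L2 L"
    "wderiv L y \<in> Hsob 1 L" "b \<in> Hsob 1 L" "y \<in> Hsob 1 L" "y \<in> Hsob 2 L"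
  using assms Hsob_2_iff[of y L] Hsob_1_iff[of b L] Hsob_1_iff[of "wderiv L y" L] Hsob_2_imp_1[of y L]
  unfolding V_def by blast+

text \<open>The pointwise error is a multiple of \<delta> that does not depend on the arguments, so
  its integral is small for every pair, without any bound on its norm. Nonnegativity of the
  integrand lets the energy bound each penalty.\<close>

lemma regularized_energy:
  assumes L: "L > 0" and rm: "regularized_modulus m c0 c1 c2 cuni" "c0 > 0" "\<delta> > 0" and V: "(y, b) \<in> V L"
  defines "\<Phi> \<equiv> \<lambda>x. (norm (wderiv L (wderiv L y) x))\<^sup>2 + 5 * (norm (wderiv L b x))\<^sup>2
        + psi (m \<delta>) ((norm (wderiv L (wderiv L y) x))\<^sup>2) ((norm (wderiv L b x))\<^sup>2)"
  shows "\<bar>1 / 2 * (\<integral>x. \<Phi> x \<partial>\<mu> L) - energy L (y, b)\<bar> \<le> 5 / 2 * (cuni * \<delta>) * L"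
    "0 \<le> (\<integral>x. \<Phi> x \<partial>\<mu> L)"
proof -
  let ?A = "wderiv L (wderiv L y)" and ?B = "wderiv L b" and ?d = "cuni * \<delta>"
  let ?Q = "\<lambda>x. Qbar (norm (?A x)) (norm (?B x))"
  note A = V_wderivs(1,2)[OF V]
  have [measurable]: "?A \<in> borel_measurable (\<mu> L)" "?B \<in> borel_measurable (\<mu> L)"
    using A L2_measurable by blast+
  have [measurable]: "m \<delta> \<in> borel_measurable borel"
    using regularized_modulusD(1)[OF rm] by (simp add: borel_measurable_continuous_onI)
  have iQ: "integrable (\<mu> L) ?Q" by (rule Qbar_integrable[OF A])
  have ic: "integrable (\<mu> L) (\<lambda>x. k)" for k :: real
    by (intro continuous_integrable_interval continuous_intros)
  have ab: "\<bar>1 / 2 * \<Phi> x - ?Q x\<bar> \<le> 5 / 2 * ?d" "0 \<le> \<Phi> x" for x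
  proof -
    show "\<bar>1 / 2 * \<Phi> x - ?Q x\<bar> \<le> 5 / 2 * ?d"
      unfolding \<Phi>_def by (intro psi_approximates_Qbar(1) regularized_modulusD[OF rm])
    have "0 \<le> psi (m \<delta>) ((norm (?A x))\<^sup>2) ((norm (?B x))\<^sup>2)"
      by (rule psi_approximates_Qbar(2)[where d = ?d]) (rule regularized_modulusD[OF rm])+
    then show "0 \<le> \<Phi> x" unfolding \<Phi>_def by simp
  qed
  show "0 \<le> (\<integral>x. \<Phi> x \<partial>\<mu> L)" using ab(2) by simp
  have m\<Phi>: "\<Phi> \<in> borel_measurable (\<mu> L)" unfolding \<Phi>_def psi_def by measurable
  have idiff: "integrable (\<mu> L) (\<lambda>x. 1 / 2 * \<Phi> x - ?Q x)"
  proof (rule Bochner_Integration.integrable_bound[OF ic[of "5 / 2 * ?d"]])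
    have "norm (1 / 2 * \<Phi> x - ?Q x) \<le> norm (5 / 2 * ?d)" for x
      using ab(1)[of x] unfolding real_norm_def by (rule order_trans) (rule abs_ge_self)
    then show "AE x in \<mu> L. norm (1 / 2 * \<Phi> x - ?Q x) \<le> norm (5 / 2 * ?d)" by (intro AE_I2)
  qed (use m\<Phi> iQ in simp)
  have "integrable (\<mu> L) (\<lambda>x. (1 / 2 * \<Phi> x - ?Q x) + ?Q x)" using idiff iQ by (rule Bochner_Integration.integrable_add)
  then have i\<Phi>: "integrable (\<mu> L) (\<lambda>x. 1 / 2 * \<Phi> x)" by simp
  have "1 / 2 * (\<integral>x. \<Phi> x \<partial>\<mu> L) - energy L (y, b) = (\<integral>x. 1 / 2 * \<Phi> x \<partial>\<mu> L) - (\<integral>x. ?Q x \<partial>\<mu> L)"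
    by (simp add: energy_def)
  also have "\<dots> = (\<integral>x. 1 / 2 * \<Phi> x - ?Q x \<partial>\<mu> L)"
    by (rule Bochner_Integration.integral_diff[OF i\<Phi> iQ, symmetric])
  also have "\<bar>\<dots>\<bar> \<le> (\<integral>x. 5 / 2 * ?d \<partial>\<mu> L)"
    using Bochner_Integration.integral_norm_bound_integral[OF idiff ic[of "5 / 2 * ?d"]] ab(1) by simp
  also have "\<dots> = 5 / 2 * ?d * L"
    unfolding integral_interval[OF ic] using L by simp
  finally show "\<bar>1 / 2 * (\<integral>x. \<Phi> x \<partial>\<mu> L) - energy L (y, b)\<bar> \<le> 5 / 2 * (cuni * \<delta>) * L" .
qed

section \<open>The lower bound\<close>

text \<open>The parameter \<open>l\<close> that is optimal for the limit is frozen. The resulting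
  form has nonnegative coefficients and lies above its tangent at the limit, since |a|^2 >= 2 a . c
  - |c|^2. The tangent is affine in y'' and b' with square integrable coefficients, so
  \<open>R\<close>, its integral along the sequence, converges.\<close>

lemma energy_lower_semicontinuous:
  fixes u :: "nat \<Rightarrow> curve \<times> curve"
  assumes L: "L > 0" and u: "\<And>n. u n \<in> V L" and v: "v \<in> V L" and w: "weakly_converges_V L u v"
  obtains R where "\<And>n. R n \<le> energy L (u n)" "R \<longlonglongrightarrow> energy L v"
proof -
  let ?A = "wderiv L (wderiv L (fst v))" and ?B = "wderiv L (snd v)"
  let ?An = "\<lambda>n. wderiv L (wderiv L (fst (u n)))" and ?Bn = "\<lambda>n. wderiv L (snd (u n))"
  have A: "?A \<in> L2 L" "?B \<in> L2 L" using V_wderivs(1,2)[of "fst v" "snd v" L] v by auto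
  have An: "?An n \<in> L2 L" "?Bn n \<in> L2 L" for n using V_wderivs(1,2)[of "fst (u n)" "snd (u n)" L] u by auto
  define l where "l x = Qopt (norm (?A x)) (norm (?B x))" for x
  have l: "0 \<le> l x" "l x \<le> 1" for x using Qopt_bounds by (auto simp: l_def)
  have l2: "0 \<le> 1 - (l x)\<^sup>2" "1 - (l x)\<^sup>2 \<le> 1" for x using l[of x] by (auto simp: power_le_one)
  have [measurable]: "?A \<in> borel_measurable (\<mu> L)" "?B \<in> borel_measurable (\<mu> L)"
    using A L2_measurable by blast+
  have [measurable]: "l \<in> borel_measurable (\<mu> L)" unfolding l_def Qopt_def by measurable
  define G H where "G x = (2 * (1 - (l x)\<^sup>2)) *\<^sub>R ?A x" and "H x = (4 * (1 + l x)) *\<^sub>R ?B x" for x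
  have mGH: "G \<in> borel_measurable (\<mu> L)" "H \<in> borel_measurable (\<mu> L)"
    unfolding G_def H_def by measurable
  have "norm (G x) \<le> norm (2 *\<^sub>R ?A x)" "norm (H x) \<le> norm (8 *\<^sub>R ?B x)" for x
    unfolding G_def H_def norm_scaleR using l[of x] l2[of x] by (intro mult_right_mono; simp)+
  then have GH: "G \<in> L2 L" "H \<in> L2 L"
    by (auto intro!: L2_AE_le(1)[OF L2_scale[OF A(1), of 2] mGH(1)] L2_AE_le(1)[OF L2_scale[OF A(2), of 8] mGH(2)])
  let ?Q = "\<lambda>x. Qbar (norm (?A x)) (norm (?B x))"
  define R where "R n = (\<integral>x. ?An n x \<bullet> G x \<partial>\<mu> L) + (\<integral>x. ?Bn n x \<bullet> H x \<partial>\<mu> L) - energy L v" for n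
  have Q: "?A x \<bullet> G x + ?B x \<bullet> H x = 2 * ?Q x" for x
    unfolding Qbar_eq by (fold l_def) (simp add: G_def H_def power2_norm_eq_inner algebra_simps)
  have "(\<lambda>n. R n) \<longlonglongrightarrow> (\<integral>x. ?A x \<bullet> G x \<partial>\<mu> L) + (\<integral>x. ?B x \<bullet> H x \<partial>\<mu> L) - energy L v"
    unfolding R_def by (intro tendsto_intros weakly_converges_V_tendsto(4,5)[OF w L] GH)
  also have "(\<integral>x. ?A x \<bullet> G x \<partial>\<mu> L) + (\<integral>x. ?B x \<bullet> H x \<partial>\<mu> L) = (\<integral>x. ?A x \<bullet> G x + ?B x \<bullet> H x \<partial>\<mu> L)"
    by (rule Bochner_Integration.integral_add[symmetric]) (intro L2_inner A GH)+
  also have "\<dots> = 2 * energy L v" unfolding Q by (simp add: energy_def case_prod_beta)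
  finally have "R \<longlonglongrightarrow> energy L v" by simp
  moreover have "R n \<le> energy L (u n)" for n
  proof -
    have iAn: "integrable (\<mu> L) (\<lambda>x. ?An n x \<bullet> G x)" "integrable (\<mu> L) (\<lambda>x. ?Bn n x \<bullet> H x)"
      by (intro L2_inner An GH)+
    note iQ = Qbar_integrable[OF A] and iQn = Qbar_integrable[OF An]
    have "R n = (\<integral>x. ?An n x \<bullet> G x + ?Bn n x \<bullet> H x - ?Q x \<partial>\<mu> L)"
      using iAn iQ by (simp add: R_def energy_def case_prod_beta)
    also have "\<dots> \<le> (\<integral>x. Qbar (norm (?An n x)) (norm (?Bn n x)) \<partial>\<mu> L)"
    proof (rule integral_mono)
      show "integrable (\<mu> L) (\<lambda>x. ?An n x \<bullet> G x + ?Bn n x \<bullet> H x - ?Q x)" using iAn iQ by simp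
      show "integrable (\<mu> L) (\<lambda>x. Qbar (norm (?An n x)) (norm (?Bn n x)))" by (rule iQn)
      fix x
      have *: "2 * (a \<bullet> b) - (norm b)\<^sup>2 \<le> (norm a)\<^sup>2" for a b :: "real^3"
        using zero_le_power2[of "norm (a - b)"] by (simp add: power2_norm_eq_inner inner_diff inner_commute algebra_simps)
      have "?An n x \<bullet> G x + ?Bn n x \<bullet> H x - ?Q x
         = (1 - (l x)\<^sup>2) * (2 * (?An n x \<bullet> ?A x) - (norm (?A x))\<^sup>2)
         + 2 * (1 + l x) * (2 * (?Bn n x \<bullet> ?B x) - (norm (?B x))\<^sup>2)"
        unfolding Qbar_eq by (fold l_def) (simp add: G_def H_def algebra_simps)
      also have "\<dots> \<le> (1 - (l x)\<^sup>2) * (norm (?An n x))\<^sup>2 + 2 * (1 + l x) * (norm (?Bn n x))\<^sup>2"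
        using l[of x] l2[of x] by (intro add_mono mult_left_mono *) auto
      also have "\<dots> \<le> Qbar (norm (?An n x)) (norm (?Bn n x))" by (rule Qbar_ge[OF l])
      finally show "?An n x \<bullet> G x + ?Bn n x \<bullet> H x - ?Q x \<le> Qbar (norm (?An n x)) (norm (?Bn n x))" .
    qed
    also have "\<dots> = energy L (u n)" by (simp add: energy_def case_prod_beta)
    finally show ?thesis .
  qed
  ultimately show ?thesis using that by blast
qed

lemma unit_norm_limit:
  fixes f :: "real \<Rightarrow> 'a::euclidean_space" and F :: "nat \<Rightarrow> real \<Rightarrow> 'a"
  assumes L: "L > 0" and F: "\<And>n. F n \<in> Hsob 1 L" and C: "\<And>n. L2_norm L (wderiv L (F n)) \<le> C"
    and t: "t \<in> {0..L}" and lim: "(\<lambda>n. cont_rep L (F n) t) \<longlonglongrightarrow> y" and h: "h \<longlonglongrightarrow> 0"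
    and s: "\<And>n. s n \<in> {0..L}" "\<And>n. \<bar>t - s n\<bar> \<le> h n" "\<And>n. norm (cont_rep L (F n) (s n)) = 1"
  shows "norm y = 1"
proof -
  have C0: "0 \<le> C" using C[of 0] L2_norm_nonneg[of L "wderiv L (F 0)"] by linarith
  have "(\<lambda>n. norm (cont_rep L (F n) t) - 1) \<longlonglongrightarrow> 0"
  proof (rule tendsto_rabs_zero_cancel[OF tendsto_sandwich[OF _ _ tendsto_const]])
    show "\<forall>\<^sub>F n in sequentially. 0 \<le> \<bar>norm (cont_rep L (F n) t) - 1\<bar>" by simp
    have "\<bar>norm (cont_rep L (F n) t) - 1\<bar> \<le> sqrt (h n) * C" for n
    proof -
      have "\<bar>norm (cont_rep L (F n) t) - 1\<bar> \<le> norm (cont_rep L (F n) t - cont_rep L (F n) (s n))"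
        using norm_triangle_ineq3[of "cont_rep L (F n) t" "cont_rep L (F n) (s n)"] s(3)[of n] by simp
      also have "\<dots> \<le> sqrt \<bar>t - s n\<bar> * L2_norm L (wderiv L (F n))" by (rule cont_rep_holder[OF L F s(1) t])
      also have "\<dots> \<le> sqrt (h n) * C"
        using s(2)[of n] C[of n] by (intro mult_mono) (auto intro: order_trans[OF abs_ge_zero])
      finally show ?thesis .
    qed
    then show "\<forall>\<^sub>F n in sequentially. \<bar>norm (cont_rep L (F n) t) - 1\<bar> \<le> sqrt (h n) * C" by simp
    show "(\<lambda>n. sqrt (h n) * C) \<longlonglongrightarrow> 0" using h by (auto intro!: tendsto_eq_intros)
  qed
  then have "(\<lambda>n. norm (cont_rep L (F n) t)) \<longlonglongrightarrow> 1" by (simp add: LIM_zero_iff)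
  then show ?thesis using tendsto_norm[OF lim] LIMSEQ_unique by blast
qed

lemma square_integral_zero_AE:
  fixes f :: "'a \<Rightarrow> real"
  assumes "integrable M (\<lambda>x. (f x)\<^sup>2)" "(\<integral>x. (f x)\<^sup>2 \<partial>M) = 0"
  shows "AE x in M. f x = 0"
  using integral_nonneg_eq_0_iff_AE[OF assms(1)] assms(2) by auto

lemma liminf_finite_subseq:
  fixes E :: "nat \<Rightarrow> real"
  assumes "liminf (\<lambda>n. ereal (E n)) < \<infinity>"
  shows "\<exists>r M. strict_mono (r :: nat \<Rightarrow> nat) \<and> (\<forall>n. E (r n) \<le> M)"
proof -
  obtain z where "liminf (\<lambda>n. ereal (E n)) < z" "z < \<infinity>" using assms dense by blast
  then obtain k where k: "k < z" "\<not> (\<forall>\<^sub>F n in sequentially. k < ereal (E n))"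
    using le_Liminf_iff[of z sequentially "\<lambda>n. ereal (E n)"] by (meson not_le)
  obtain M where M: "k \<le> ereal M"
    using k(1) \<open>z < \<infinity>\<close> by (cases k) auto
  have "infinite {n. ereal (E n) \<le> k}"
    using k(2) by (simp add: frequently_cofinite[symmetric] cofinite_eq_sequentially not_eventually not_less)
  then obtain r :: "nat \<Rightarrow> nat" where r: "strict_mono r" "\<And>n. r n \<in> {n. ereal (E n) \<le> k}"
    using infinite_enumerate by blast
  have "E (r n) \<le> M" for n
    using r(2)[of n] M order_trans[of "ereal (E (r n))" k "ereal M"] by simp
  then show ?thesis using r(1) by (intro exI[of _ r] exI[of _ M] conjI allI)
qed

lemma orthonormal_frame_rotation:
  fixes a b :: "real^3"
  assumes "norm a = 1" "norm b = 1" "a \<bullet> b = 0"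
  shows "rotation_matrix (transpose (vector [a, b, cross3 a b] :: real^3^3))"
proof -
  let ?M = "vector [a, b, cross3 a b] :: real^3^3"
  have aa: "a \<bullet> a = 1" "b \<bullet> b = 1" using assms(1,2) by (simp_all flip: power2_norm_eq_inner)
  have "(norm (cross3 a b))\<^sup>2 = 1" using norm_cross[of a b] assms by simp
  then have n: "norm (cross3 a b) = 1" by (simp add: power2_eq_1_iff) (use norm_ge_zero[of "cross3 a b"] in linarith)
  have rows: "row 1 ?M = a" "row 2 ?M = b" "row 3 ?M = cross3 a b"
    by (simp_all add: row_def vec_eq_iff)
  have o: "cross3 a b \<bullet> a = 0" "cross3 a b \<bullet> b = 0" "a \<bullet> cross3 a b = 0" "b \<bullet> cross3 a b = 0" "b \<bullet> a = 0"
    using assms(3) by (simp_all add: dot_cross_self inner_commute)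
  have "orthogonal_matrix ?M"
    unfolding orthogonal_matrix_orthonormal_rows
    using assms n o by (simp add: forall_3 rows orthogonal_def)
  moreover have "det ?M = 1"
  proof -
    have "det ?M = a \<bullet> cross3 b (cross3 a b)" by (simp add: dot_cross_det)
    also have "\<dots> = 1" using Lagrange[of b a b] assms aa by (simp add: inner_commute)
    finally show ?thesis .
  qed
  ultimately show ?thesis
    by (simp add: rotation_matrix_def det_transpose)
qed


lemma rotation_frame_orthonormal:
  fixes a b c :: "real^3"
  assumes "rotation_matrix (transpose (vector [a, b, c] :: real^3^3))"
  shows "norm a = 1" "norm b = 1" "a \<bullet> b = 0"
proof -
  let ?M = "vector [a, b, c] :: real^3^3"
  have "orthogonal_matrix ?M" using assms by (simp add: rotation_matrix_def)
  moreover have "row 1 ?M = a" "row 2 ?M = b" by (simp_all add: row_def vec_eq_iff)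
  moreover have "(1::3) \<noteq> 2" by simp
  ultimately show "norm a = 1" "norm b = 1" "a \<bullet> b = 0"
    unfolding orthogonal_matrix_orthonormal_rows orthogonal_def by metis+
qed

text \<open>The second orthogonality follows by testing the weak convergence of \<open>b\<^sub>n'\<close> with the field
  \<open>(y' \<bullet> b') y'\<close>.\<close>

lemma discrete_limit_orthogonality:
  fixes u :: "nat \<Rightarrow> curve \<times> curve"
  assumes L: "L > 0" and u: "\<And>n. u n \<in> V L" and v: "v \<in> V L" and w: "weakly_converges_V L u v"
    and C: "\<And>n. V_norm L (u n) \<le> C" and r: "strict_mono r"
    and nU: "\<And>t. t \<in> {0..L} \<Longrightarrow> norm (cont_rep L (wderiv L (fst v)) t) = 1"
    and J: "(\<lambda>n. \<integral>x. (wderiv L (fst (u (r n))) x \<bullet> snd (u (r n)) x)\<^sup>2 \<partial>\<mu> L) \<longlonglongrightarrow> 0"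
    and K: "(\<lambda>n. \<integral>x. (wderiv L (fst (u (r n))) x \<bullet> wderiv L (snd (u (r n))) x)\<^sup>2 \<partial>\<mu> L) \<longlonglongrightarrow> 0"
  shows "AE x in \<mu> L. wderiv L (fst v) x \<bullet> snd v x = 0"
    "AE x in \<mu> L. wderiv L (fst v) x \<bullet> wderiv L (snd v) x = 0"
proof -
  let ?U = "\<lambda>n. wderiv L (fst (u n))" and ?b = "\<lambda>n. snd (u n)" and ?B = "\<lambda>n. wderiv L (snd (u n))"
  let ?cU = "cont_rep L (wderiv L (fst v))" and ?cb = "cont_rep L (snd v)" and ?Bv = "wderiv L (snd v)"
  have H: "?U n \<in> Hsob 1 L" "?b n \<in> Hsob 1 L" "?B n \<in> L2 L" "?U n \<in> L2 L" "?b n \<in> L2 L" for n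
    using V_wderivs[of "fst (u n)" "snd (u n)" L] u by auto
  have Hv: "wderiv L (fst v) \<in> Hsob 1 L" "snd v \<in> Hsob 1 L" "?Bv \<in> L2 L"
    using V_wderivs[of "fst v" "snd v" L] v by auto
  have C0: "0 \<le> C" using C[of 0] V_norm_ge(1)[of L "u 0"] Hsob_norm_nonneg[of 1 L "snd (u 0)"] by linarith
  define P where "P = (1 / sqrt L + sqrt L) * C"
  have P0: "0 \<le> P" using C0 L by (simp add: P_def)
  have bd: "norm (cont_rep L f t) \<le> P" if "f \<in> Hsob 1 L" "Hsob_norm 1 L f \<le> V_norm L (u n)" "t \<in> {0..L}" for f :: curve and n t
  proof -
    have "norm (cont_rep L f t) \<le> (1 / sqrt L + sqrt L) * Hsob_norm 1 L f"
      by (rule cont_rep_bound[OF L that(1,3)])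
    also have "\<dots> \<le> P" unfolding P_def using that(2) C[of n] L by (intro mult_left_mono) auto
    finally show ?thesis .
  qed
  have bdU: "norm (cont_rep L (?U n) t) \<le> P" and bdb: "norm (cont_rep L (?b n) t) \<le> P" if "t \<in> {0..L}" for n t
    using bd[OF H(1) V_norm_ge(4) that] bd[OF H(2) V_norm_ge(1) that] by auto
  have nB: "L2_norm L (?B n) \<le> C" for n
    using L2_norm_le_Hsob_norm[of 1 1 L "snd (u n)"] V_norm_ge(1)[of L "u n"] C[of n] by simp
  have eqU: "AE x in \<mu> L. \<forall>n. cont_rep L (?U n) x = ?U n x" and eqb: "AE x in \<mu> L. \<forall>n. cont_rep L (?b n) x = ?b n x"
    using cont_rep_Hsob(2)[OF L H(1)] cont_rep_Hsob(2)[OF L H(2)] by (simp_all add: AE_all_countable)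
  have cvU: "continuous_on {0..L} ?cU" and cvb: "continuous_on {0..L} ?cb"
    using cont_rep_Hsob(1)[OF L Hv(1)] cont_rep_Hsob(1)[OF L Hv(2)] by auto
  have [measurable]: "?cU \<in> borel_measurable (\<mu> L)" "?cb \<in> borel_measurable (\<mu> L)" "?Bv \<in> borel_measurable (\<mu> L)"
    using L2_measurable[OF continuous_L2[OF cvU]] L2_measurable[OF continuous_L2[OF cvb]] L2_measurable[OF Hv(3)] by auto
  have [measurable]: "?U n \<in> borel_measurable (\<mu> L)" "?b n \<in> borel_measurable (\<mu> L)" "?B n \<in> borel_measurable (\<mu> L)" for n
    using L2_measurable[OF H(3)] L2_measurable[OF H(4)] L2_measurable[OF H(5)] by auto
  have ic: "integrable (\<mu> L) (\<lambda>x. k)" for k :: real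
    by (intro continuous_integrable_interval continuous_intros)
  have rt: "filterlim r sequentially sequentially" using r by (rule filterlim_subseq)
  have inI: "AE x in \<mu> L. x \<in> {0..L}" by (rule AE_intervalI) auto
  have limU: "(\<lambda>n. cont_rep L (?U n) t) \<longlonglongrightarrow> ?cU t" and limb: "(\<lambda>n. cont_rep L (?b n) t) \<longlonglongrightarrow> ?cb t"
    if "t \<in> {0..L}" for t
    using weakly_converges_V_tendsto(2,3)[OF w L that] by auto
  have eqv: "AE x in \<mu> L. ?cU x = wderiv L (fst v) x" "AE x in \<mu> L. ?cb x = snd v x"
    using cont_rep_Hsob(2)[OF L Hv(1)] cont_rep_Hsob(2)[OF L Hv(2)] by auto

  \<comment> \<open>Both factors converge pointwise and are bounded by \<open>P\<close>, so the
    first penalty passes to the limit by dominated convergence.\<close>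
  have "(\<lambda>n. \<integral>x. (?U (r n) x \<bullet> ?b (r n) x)\<^sup>2 \<partial>\<mu> L) \<longlonglongrightarrow> (\<integral>x. (?cU x \<bullet> ?cb x)\<^sup>2 \<partial>\<mu> L)"
  proof (rule integral_dominated_convergence[where w = "\<lambda>x. (P * P)\<^sup>2"])
    show "AE x in \<mu> L. (\<lambda>n. (?U (r n) x \<bullet> ?b (r n) x)\<^sup>2) \<longlonglongrightarrow> (?cU x \<bullet> ?cb x)\<^sup>2"
      using eqU eqb inI
    proof eventually_elim
      case (elim x)
      have "(\<lambda>n. (cont_rep L (?U (r n)) x \<bullet> cont_rep L (?b (r n)) x)\<^sup>2) \<longlonglongrightarrow> (?cU x \<bullet> ?cb x)\<^sup>2"
        by (intro tendsto_intros filterlim_compose[OF limU[OF elim(3)] rt] filterlim_compose[OF limb[OF elim(3)] rt])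
      then show ?case using elim by simp
    qed
    show "AE x in \<mu> L. norm ((?U (r n) x \<bullet> ?b (r n) x)\<^sup>2) \<le> (P * P)\<^sup>2" for n
      using eqU eqb inI
    proof eventually_elim
      case (elim x)
      have "\<bar>?U (r n) x \<bullet> ?b (r n) x\<bar> \<le> norm (?U (r n) x) * norm (?b (r n) x)" by (rule Cauchy_Schwarz_ineq2)
      also have "\<dots> \<le> P * P" using bdU[OF elim(3), of "r n"] bdb[OF elim(3), of "r n"] elim P0 by (intro mult_mono) auto
      finally have "\<bar>?U (r n) x \<bullet> ?b (r n) x\<bar>\<^sup>2 \<le> (P * P)\<^sup>2" by (intro power_mono) auto
      then show ?case by simp
    qed
  qed (use ic in \<open>measurable\<close>)
  from LIMSEQ_unique[OF this J] have z: "(\<integral>x. (?cU x \<bullet> ?cb x)\<^sup>2 \<partial>\<mu> L) = 0" .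
  have "AE x in \<mu> L. ?cU x \<bullet> ?cb x = 0"
    by (rule square_integral_zero_AE[OF _ z])
      (intro continuous_integrable_interval continuous_intros cvU cvb)
  with eqv show "AE x in \<mu> L. wderiv L (fst v) x \<bullet> snd v x = 0" by eventually_elim simp

  define \<omega> where "\<omega> x = ?cU x \<bullet> ?Bv x" for x
  define g where "g x = \<omega> x *\<^sub>R ?cU x" for x
  have [measurable]: "\<omega> \<in> borel_measurable (\<mu> L)" "g \<in> borel_measurable (\<mu> L)"
    unfolding \<omega>_def g_def by measurable
  have \<omega>B: "\<bar>\<omega> x\<bar> \<le> norm (?Bv x)" if "x \<in> {0..L}" for x
    using Cauchy_Schwarz_ineq2[of "?cU x" "?Bv x"] nU[OF that] by (simp add: \<omega>_def)
  have "AE x in \<mu> L. norm (\<omega> x) \<le> norm (?Bv x)"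
    using inI by eventually_elim (use \<omega>B in simp)
  then have \<omega>: "\<omega> \<in> L2 L" by (intro L2_AE_le(1)[OF Hv(3)]) measurable
  have "AE x in \<mu> L. norm (g x) \<le> norm (?Bv x)"
    using inI by eventually_elim (use \<omega>B nU in \<open>simp add: g_def\<close>)
  then have g: "g \<in> L2 L" by (intro L2_AE_le(1)[OF Hv(3)]) measurable
  have lim1: "(\<lambda>n. \<integral>x. ?B (r n) x \<bullet> g x \<partial>\<mu> L) \<longlonglongrightarrow> (\<integral>x. ?Bv x \<bullet> g x \<partial>\<mu> L)"
    by (rule filterlim_compose[OF weakly_converges_V_tendsto(5)[OF w L g] rt])
  \<comment> \<open>The penalty controls the product of b_n' with y_n', not with the limit y'. The
    replacement error \<open>d n\<close> tends to 0 strongly in L^2: it vanishes pointwise and is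
    dominated by (1 + P) |\<omega>|.\<close>
  define d where "d n x = \<omega> x *\<^sub>R (?cU x - ?U n x)" for n x
  have [measurable]: "d n \<in> borel_measurable (\<mu> L)" for n unfolding d_def by measurable
  have dle: "AE x in \<mu> L. norm (d n x) \<le> norm ((1 + P) *\<^sub>R \<omega> x)" for n
    using eqU inI
  proof eventually_elim
    case (elim x)
    have "norm (?cU x - ?U n x) \<le> 1 + P"
      using norm_triangle_ineq4[of "?cU x" "?U n x"] nU[OF elim(2)] bdU[OF elim(2), of n] elim by simp
    then have "\<bar>\<omega> x\<bar> * norm (?cU x - ?U n x) \<le> \<bar>\<omega> x\<bar> * (1 + P)" by (intro mult_left_mono) auto
    then show ?case using P0 by (simp add: d_def mult.commute abs_mult)
  qed
  have dL2: "d n \<in> L2 L" for n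
    by (rule L2_AE_le(1)[OF L2_scale[OF \<omega>] _ dle]) measurable
  have "(\<lambda>n. \<integral>x. (norm (d n x))\<^sup>2 \<partial>\<mu> L) \<longlonglongrightarrow> (\<integral>x. 0 \<partial>\<mu> L)"
  proof (rule integral_dominated_convergence[where w = "\<lambda>x. (norm ((1 + P) *\<^sub>R \<omega> x))\<^sup>2"])
    show "integrable (\<mu> L) (\<lambda>x. (norm ((1 + P) *\<^sub>R \<omega> x))\<^sup>2)" by (rule L2_square_integrable[OF L2_scale[OF \<omega>]])
    show "AE x in \<mu> L. (\<lambda>n. (norm (d n x))\<^sup>2) \<longlonglongrightarrow> 0"
      using eqU inI
    proof eventually_elim
      case (elim x)
      have "(\<lambda>n. (norm (\<omega> x *\<^sub>R (?cU x - cont_rep L (?U n) x)))\<^sup>2) \<longlonglongrightarrow> (norm (\<omega> x *\<^sub>R (?cU x - ?cU x)))\<^sup>2"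
        by (intro tendsto_intros limU[OF elim(2)])
      then show ?case using elim by (simp add: d_def)
    qed
    show "AE x in \<mu> L. norm ((norm (d n x))\<^sup>2) \<le> (norm ((1 + P) *\<^sub>R \<omega> x))\<^sup>2" for n
      using dle[of n]
    proof eventually_elim
      case (elim x)
      from power_mono[OF elim norm_ge_zero, of 2] show ?case by simp
    qed
  qed measurable
  then have "(\<lambda>n. L2_norm L (d n)) \<longlonglongrightarrow> sqrt 0"
    unfolding L2_norm_def by (intro tendsto_real_sqrt) simp
  then have limd: "(\<lambda>n. L2_norm L (d (r n))) \<longlonglongrightarrow> 0"
    using filterlim_compose[OF _ rt, of "\<lambda>n. L2_norm L (d n)"] by simp
  define k where "k n x = ?U n x \<bullet> ?B n x" for n x
  have [measurable]: "k n \<in> borel_measurable (\<mu> L)" for n unfolding k_def by measurable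
  have kL2: "k n \<in> L2 L" for n
  proof (rule L2_AE_le(1)[OF L2_scale[OF H(3), of P]])
    show "AE x in \<mu> L. norm (k n x) \<le> norm (P *\<^sub>R ?B n x)"
      using eqU inI
    proof eventually_elim
      case (elim x)
      have "\<bar>k n x\<bar> \<le> norm (?U n x) * norm (?B n x)" unfolding k_def by (rule Cauchy_Schwarz_ineq2)
      also have "\<dots> \<le> P * norm (?B n x)" using bdU[OF elim(2), of n] elim by (intro mult_right_mono) auto
      finally show ?case using P0 by simp
    qed
  qed measurable
  have "(\<lambda>n. L2_norm L (k (r n))) \<longlonglongrightarrow> sqrt 0"
    using tendsto_real_sqrt[OF K] by (simp add: L2_norm_def k_def)
  then have limk: "(\<lambda>n. L2_norm L (k (r n))) \<longlonglongrightarrow> 0" by simp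
  have bound: "\<bar>\<integral>x. ?B n x \<bullet> g x \<partial>\<mu> L\<bar> \<le> L2_norm L \<omega> * L2_norm L (k n) + C * L2_norm L (d n)" for n
  proof -
    \<comment> \<open>With g = \<omega> y' the integrand splits into \<omega> times y_n' . b_n',
      small by the second penalty, and b_n' . \<open>d n\<close>, a bounded factor times a strongly
      vanishing one.\<close>
    have "(\<integral>x. ?B n x \<bullet> g x \<partial>\<mu> L) = (\<integral>x. \<omega> x \<bullet> k n x + ?B n x \<bullet> d n x \<partial>\<mu> L)"
      by (intro Bochner_Integration.integral_cong refl)
        (simp add: g_def k_def d_def inner_diff_right inner_commute algebra_simps)
    also have "\<dots> = (\<integral>x. \<omega> x \<bullet> k n x \<partial>\<mu> L) + (\<integral>x. ?B n x \<bullet> d n x \<partial>\<mu> L)"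
      by (rule Bochner_Integration.integral_add[OF L2_inner(1)[OF \<omega> kL2] L2_inner(1)[OF H(3) dL2]])
    also have "\<bar>\<dots>\<bar> \<le> L2_norm L \<omega> * L2_norm L (k n) + L2_norm L (?B n) * L2_norm L (d n)"
      by (intro order_trans[OF abs_triangle_ineq] add_mono L2_inner(2) \<omega> kL2 H(3) dL2)
    also have "\<dots> \<le> L2_norm L \<omega> * L2_norm L (k n) + C * L2_norm L (d n)"
      using nB[of n] by (intro add_left_mono mult_right_mono) auto
    finally show ?thesis .
  qed
  have "(\<lambda>n. \<integral>x. ?B (r n) x \<bullet> g x \<partial>\<mu> L) \<longlonglongrightarrow> 0"
  proof (rule Lim_null_comparison)
    show "\<forall>\<^sub>F n in sequentially. norm (\<integral>x. ?B (r n) x \<bullet> g x \<partial>\<mu> L)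
        \<le> L2_norm L \<omega> * L2_norm L (k (r n)) + C * L2_norm L (d (r n))"
      using bound by simp
    show "(\<lambda>n. L2_norm L \<omega> * L2_norm L (k (r n)) + C * L2_norm L (d (r n))) \<longlonglongrightarrow> 0"
    proof -
      have "(\<lambda>n. L2_norm L \<omega> * L2_norm L (k (r n)) + C * L2_norm L (d (r n))) \<longlonglongrightarrow> L2_norm L \<omega> * 0 + C * 0"
        by (intro tendsto_intros limk limd)
      then show ?thesis by simp
    qed
  qed
  from LIMSEQ_unique[OF lim1 this] have "(\<integral>x. ?Bv x \<bullet> g x \<partial>\<mu> L) = 0" .
  moreover have "?Bv x \<bullet> g x = (\<omega> x)\<^sup>2" for x by (simp add: g_def \<omega>_def power2_eq_square inner_commute)
  ultimately have "(\<integral>x. (\<omega> x)\<^sup>2 \<partial>\<mu> L) = 0" by simp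
  then have "AE x in \<mu> L. \<omega> x = 0"
    using L2_square_integrable[OF \<omega>] by (intro square_integral_zero_AE) auto
  with eqv(1) show "AE x in \<mu> L. wderiv L (fst v) x \<bullet> wderiv L (snd v) x = 0"
    by eventually_elim (simp add: \<omega>_def)
qed

text \<open>All three summands of the discrete energy are nonnegative. Hence each penalty integral
  is at most 2 \<epsilon> times the energy, and dropping both penalties gives the lower
  comparison.\<close>

lemma energy_disc_split:
  fixes y b :: curve
  assumes L: "L > 0" and rm: "regularized_modulus m c0 c1 c2 cuni" "c0 > 0" "\<delta> > 0" and V: "(y, b) \<in> V L"
    and \<epsilon>: "\<epsilon>1 > 0" "\<epsilon>2 > 0"
  defines "J \<equiv> \<integral>x. (wderiv L y x \<bullet> b x)\<^sup>2 \<partial>\<mu> L" and "K \<equiv> \<integral>x. (wderiv L y x \<bullet> wderiv L b x)\<^sup>2 \<partial>\<mu> L"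
  shows "energy L (y, b) - 5 / 2 * (cuni * \<delta>) * L \<le> energy_disc L (m \<delta>) \<epsilon>1 \<epsilon>2 (y, b)"
    "J \<le> 2 * \<epsilon>1 * energy_disc L (m \<delta>) \<epsilon>1 \<epsilon>2 (y, b)"
    "K \<le> 2 * \<epsilon>2 * energy_disc L (m \<delta>) \<epsilon>1 \<epsilon>2 (y, b)"
    "\<bar>energy_disc L (m \<delta>) \<epsilon>1 \<epsilon>2 (y, b) - energy L (y, b)\<bar> \<le> 5 / 2 * (cuni * \<delta>) * L + J / (2 * \<epsilon>1) + K / (2 * \<epsilon>2)"
proof -
  define I where "I = (\<integral>x. (norm (wderiv L (wderiv L y) x))\<^sup>2 + 5 * (norm (wderiv L b x))\<^sup>2
        + psi (m \<delta>) ((norm (wderiv L (wderiv L y) x))\<^sup>2) ((norm (wderiv L b x))\<^sup>2) \<partial>\<mu> L)"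
  have I: "\<bar>1 / 2 * I - energy L (y, b)\<bar> \<le> 5 / 2 * (cuni * \<delta>) * L" "0 \<le> I"
    unfolding I_def using regularized_energy[OF L rm V] by auto
  have E: "energy_disc L (m \<delta>) \<epsilon>1 \<epsilon>2 (y, b) = 1 / 2 * I + J / (2 * \<epsilon>1) + K / (2 * \<epsilon>2)"
    by (simp add: energy_disc_def I_def J_def K_def)
  have JK: "0 \<le> J" "0 \<le> K" by (auto simp: J_def K_def)
  then have JK': "0 \<le> J / (2 * \<epsilon>1)" "0 \<le> K / (2 * \<epsilon>2)" using \<epsilon> by auto
  show "energy L (y, b) - 5 / 2 * (cuni * \<delta>) * L \<le> energy_disc L (m \<delta>) \<epsilon>1 \<epsilon>2 (y, b)"
    using I(1) JK' unfolding E abs_le_iff by linarith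
  show "\<bar>energy_disc L (m \<delta>) \<epsilon>1 \<epsilon>2 (y, b) - energy L (y, b)\<bar> \<le> 5 / 2 * (cuni * \<delta>) * L + J / (2 * \<epsilon>1) + K / (2 * \<epsilon>2)"
    using I(1) JK' unfolding E abs_le_iff by linarith
  have "J / (2 * \<epsilon>1) \<le> energy_disc L (m \<delta>) \<epsilon>1 \<epsilon>2 (y, b)" "K / (2 * \<epsilon>2) \<le> energy_disc L (m \<delta>) \<epsilon>1 \<epsilon>2 (y, b)"
    unfolding E using I(2) JK' by linarith+
  then show "J \<le> 2 * \<epsilon>1 * energy_disc L (m \<delta>) \<epsilon>1 \<epsilon>2 (y, b)"
    "K \<le> 2 * \<epsilon>2 * energy_disc L (m \<delta>) \<epsilon>1 \<epsilon>2 (y, b)"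
    using \<epsilon> by (simp_all add: divide_le_eq mult.commute)
qed

text \<open>The energy inequality drops the penalties and uses the whole sequence. Admissibility is
  a separate matter: unit length and boundary condition survive along the whole sequence, but
  orthogonality needs bounded energies and is obtained along the subsequence
  \<open>r\<close>.\<close>

lemma liminf_inequality:
  fixes Lbc :: "curve \<times> curve \<Rightarrow> 'z::real_normed_vector" and \<epsilon>1 \<epsilon>2 \<delta> :: "nat \<Rightarrow> real"
  assumes L: "L > 0"
    and lin: "bounded_linear_V L Lbc" and dep: "depends_on_boundary_values L Lbc"
    and c0: "c0 > 0" and rm: "regularized_modulus m c0 c1 c2 cuni"
    and mesh: "\<And>n. mesh L (N n) (x n)" and h: "(\<lambda>n. mesh_size (N n) (x n)) \<longlonglongrightarrow> 0"
    and \<epsilon>: "\<And>n. \<epsilon>1 n > 0" "\<epsilon>1 \<longlonglongrightarrow> 0" "\<And>n. \<epsilon>2 n > 0" "\<epsilon>2 \<longlonglongrightarrow> 0" and \<delta>: "\<And>n. \<delta> n > 0" "\<delta> \<longlonglongrightarrow> 0"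
    and yb: "(y, b) \<in> V L" and da: "\<And>n. (yh n, bh n) \<in> disc_admissible L Lbc lbc (N n) (x n)"
    and C: "\<And>n. V_norm L (yh n, bh n) \<le> C" and w: "weakly_converges_V L (\<lambda>n. (yh n, bh n)) (y, b)"
  defines "D \<equiv> \<lambda>n. energy_disc L (m (\<delta> n)) (\<epsilon>1 n) (\<epsilon>2 n) (yh n, bh n)"
  shows "liminf (\<lambda>n. ereal (D n)) < \<infinity> \<Longrightarrow> (y, b) \<in> admissible L Lbc lbc"
    "ereal (energy L (y, b)) \<le> liminf (\<lambda>n. ereal (D n))"
proof -
  have Vd: "(yh n, bh n) \<in> V_disc L (N n) (x n)" and nodes: "\<And>j. j \<le> N n \<Longrightarrow>
      norm (vector_derivative (yh n) (at (x n j) within {0..L})) = 1 \<and> norm (bh n (x n j)) = 1"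
    and bc: "Lbc (yh n, bh n) = lbc" for n
    using da[of n] by (auto simp: disc_admissible_def)
  note VV = V_disc_in_V[OF L mesh Vd]
  have split: "energy L (yh n, bh n) - 5 / 2 * (cuni * \<delta> n) * L \<le> D n"
    "(\<integral>t. (wderiv L (yh n) t \<bullet> bh n t)\<^sup>2 \<partial>\<mu> L) \<le> 2 * \<epsilon>1 n * D n"
    "(\<integral>t. (wderiv L (yh n) t \<bullet> wderiv L (bh n) t)\<^sup>2 \<partial>\<mu> L) \<le> 2 * \<epsilon>2 n * D n" for n
    unfolding D_def by (rule energy_disc_split[OF L rm c0 \<delta>(1) VV(1) \<epsilon>(1) \<epsilon>(3)])+
  obtain R where R: "\<And>n. R n \<le> energy L (yh n, bh n)" "R \<longlonglongrightarrow> energy L (y, b)"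
    using energy_lower_semicontinuous[where u = "\<lambda>n. (yh n, bh n)", OF L VV(1) yb w] by blast
  define R' where "R' n = R n - 5 / 2 * (cuni * \<delta> n) * L" for n
  have "R' \<longlonglongrightarrow> energy L (y, b) - 5 / 2 * (cuni * 0) * L"
    unfolding R'_def by (intro tendsto_intros R \<delta>)
  then have "(\<lambda>n. ereal (R' n)) \<longlonglongrightarrow> ereal (energy L (y, b))" by simp
  then have "ereal (energy L (y, b)) = liminf (\<lambda>n. ereal (R' n))"
    by (intro lim_imp_Liminf[symmetric]) auto
  also have "\<dots> \<le> liminf (\<lambda>n. ereal (D n))"
  proof (intro Liminf_mono always_eventually allI)
    fix n
    show "ereal (R' n) \<le> ereal (D n)"
    proof -
      have "R' n \<le> D n" using R(1)[of n] split(1)[of n] unfolding R'_def by linarith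
      then show ?thesis by simp
    qed
  qed
  finally show "ereal (energy L (y, b)) \<le> liminf (\<lambda>n. ereal (D n))" .

  assume "liminf (\<lambda>n. ereal (D n)) < \<infinity>"
  then have "\<exists>r M. strict_mono (r :: nat \<Rightarrow> nat) \<and> (\<forall>n. D (r n) \<le> M)"
    by (rule liminf_finite_subseq)
  then obtain r :: "nat \<Rightarrow> nat" and M where "strict_mono r \<and> (\<forall>n. D (r n) \<le> M)" by (elim exE)
  then have r: "strict_mono r" "\<And>n. D (r n) \<le> M" by simp_all
  note rt = filterlim_subseq[OF r(1)]
  have V: "y \<in> Hsob 2 L" "wderiv L y \<in> Hsob 1 L" "b \<in> Hsob 1 L" using V_wderivs[OF yb] by auto
  have nrm: "norm (cont_rep L (wderiv L y) t) = 1" "norm (cont_rep L b t) = 1" if t: "t \<in> {0..L}" for t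
  proof -
    have "\<exists>j\<le>N n. \<bar>t - x n j\<bar> \<le> mesh_size (N n) (x n)" for n
      using mesh_near_node[OF mesh t] by metis
    then obtain j where j: "\<And>n. j n \<le> N n" "\<And>n. \<bar>t - x n (j n)\<bar> \<le> mesh_size (N n) (x n)" by metis
    have xr: "x n (j n) \<in> {0..L}" for n by (rule mesh_node_range[OF mesh j(1)])
    note Vn = V_wderivs[OF VV(1)]
    show "norm (cont_rep L (wderiv L y) t) = 1"
    proof (rule unit_norm_limit[OF L _ _ t _ h xr j(2), of "\<lambda>n. wderiv L (yh n)" C])
      show "wderiv L (yh n) \<in> Hsob 1 L" for n by (rule Vn(6))
      show "L2_norm L (wderiv L (wderiv L (yh n))) \<le> C" for n
        using L2_norm_le_Hsob_norm[of 1 1 L "wderiv L (yh n)"] V_norm_ge(4)[of L "(yh n, bh n)"] C[of n] by simp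
      show "(\<lambda>n. cont_rep L (wderiv L (yh n)) t) \<longlonglongrightarrow> cont_rep L (wderiv L y) t"
        using weakly_converges_V_tendsto(2)[OF w L t] by simp
      show "norm (cont_rep L (wderiv L (yh n)) (x n (j n))) = 1" for n
        using nodes[OF j(1)] VV(2)[OF xr] by simp
    qed
    show "norm (cont_rep L b t) = 1"
    proof (rule unit_norm_limit[OF L _ _ t _ h xr j(2), of bh C])
      show "bh n \<in> Hsob 1 L" for n by (rule Vn(7))
      show "L2_norm L (wderiv L (bh n)) \<le> C" for n
        using L2_norm_le_Hsob_norm[of 1 1 L "bh n"] V_norm_ge(1)[of L "(yh n, bh n)"] C[of n] by simp
      show "(\<lambda>n. cont_rep L (bh n) t) \<longlonglongrightarrow> cont_rep L b t"
        using weakly_converges_V_tendsto(3)[OF w L t] by simp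
      show "norm (cont_rep L (bh n) (x n (j n))) = 1" for n
        using nodes[OF j(1)] VV(3)[OF xr] by simp
    qed
  qed
  \<comment> \<open>A penalty integral is at most 2 \<epsilon> times an energy bounded by
    \<open>M\<close> along \<open>r\<close>.\<close>
  have pen: "(\<lambda>n. q (r n)) \<longlonglongrightarrow> 0"
    if q: "\<And>n. 0 \<le> q n" "\<And>n. q n \<le> 2 * \<epsilon> n * D n" and e: "\<And>n. \<epsilon> n > 0" "\<epsilon> \<longlonglongrightarrow> 0" for q \<epsilon> :: "nat \<Rightarrow> real"
  proof (rule tendsto_sandwich[OF _ _ tendsto_const])
    show "\<forall>\<^sub>F n in sequentially. 0 \<le> q (r n)" using q(1) by simp
    have "q (r n) \<le> 2 * \<epsilon> (r n) * M" for n
    proof -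
      have "2 * \<epsilon> (r n) * D (r n) \<le> 2 * \<epsilon> (r n) * M"
        using e(1)[of "r n"] by (intro mult_left_mono r(2)) simp
      then show ?thesis using q(2)[of "r n"] by linarith
    qed
    then show "\<forall>\<^sub>F n in sequentially. q (r n) \<le> 2 * \<epsilon> (r n) * M" by simp
    have "(\<lambda>n. 2 * \<epsilon> (r n) * M) \<longlonglongrightarrow> 2 * 0 * M"
      by (intro tendsto_intros filterlim_compose[OF e(2) rt])
    then show "(\<lambda>n. 2 * \<epsilon> (r n) * M) \<longlonglongrightarrow> 0" by simp
  qed
  have J: "(\<lambda>n. \<integral>t. (wderiv L (yh (r n)) t \<bullet> bh (r n) t)\<^sup>2 \<partial>\<mu> L) \<longlonglongrightarrow> 0"
    by (rule pen[OF _ split(2) \<epsilon>(1,2)]) simp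
  have K: "(\<lambda>n. \<integral>t. (wderiv L (yh (r n)) t \<bullet> wderiv L (bh (r n)) t)\<^sup>2 \<partial>\<mu> L) \<longlonglongrightarrow> 0"
    by (rule pen[OF _ split(3) \<epsilon>(3,4)]) simp
  have orth: "AE t in \<mu> L. wderiv L y t \<bullet> b t = 0" "AE t in \<mu> L. wderiv L y t \<bullet> wderiv L b t = 0"
    using discrete_limit_orthogonality[where u = "\<lambda>n. (yh n, bh n)" and v = "(y, b)" and r = r, unfolded fst_conv snd_conv,
        OF L VV(1) yb w C r(1) nrm(1) J K] by simp_all
  have inI: "AE t in \<mu> L. t \<in> {0..L}" by (rule AE_intervalI) auto
  have "AE t in \<mu> L. rotation_matrix
        (transpose (vector [wderiv L y t, b t, cross3 (wderiv L y t) (b t)] :: real ^ 3 ^ 3))"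
    using orth(1) inI cont_rep_Hsob(2)[OF L V(2)] cont_rep_Hsob(2)[OF L V(3)]
  proof eventually_elim
    case (elim t)
    then show ?case using nrm[of t] by (intro orthonormal_frame_rotation) auto
  qed
  moreover have "Lbc (y, b) = lbc"
    by (rule boundary_functional_weak_limit[where u = "\<lambda>n. (yh n, bh n)", OF L lin dep VV(1) yb w bc])
  ultimately show "(y, b) \<in> admissible L Lbc lbc"
    using yb orth(2) by (simp add: admissible_def A_frame_def)
qed

section \<open>Spline approximation\<close>

lemma integral_continuous_affine:
  fixes a b :: real
  assumes "a \<le> b"
  shows "integral {a..b} (\<lambda>t. c + (t - a) *\<^sub>R d) = (b - a) *\<^sub>R c + ((b - a)\<^sup>2 / 2) *\<^sub>R (d :: 'a::euclidean_space)"
    "integral {a..b} (\<lambda>t. (t - a) *\<^sub>R (c + (t - a) *\<^sub>R d)) = ((b - a)\<^sup>2 / 2) *\<^sub>R c + ((b - a)^3 / 3) *\<^sub>R d"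
    "integral {a..b} (\<lambda>t. c + (t - a) *\<^sub>R d + ((t - a)\<^sup>2 / 2) *\<^sub>R e)
      = (b - a) *\<^sub>R c + ((b - a)\<^sup>2 / 2) *\<^sub>R d + ((b - a)^3 / 6) *\<^sub>R e"
proof -
  have "((\<lambda>t. c + (t - a) *\<^sub>R d) has_integral
      ((b - a) *\<^sub>R c + ((b - a)\<^sup>2 / 2) *\<^sub>R d) - ((a - a) *\<^sub>R c + ((a - a)\<^sup>2 / 2) *\<^sub>R d)) {a..b}"
    using assms by (intro fundamental_theorem_of_calculus)
      (auto intro!: derivative_eq_intros simp: power2_eq_square)
  then show "integral {a..b} (\<lambda>t. c + (t - a) *\<^sub>R d) = (b - a) *\<^sub>R c + ((b - a)\<^sup>2 / 2) *\<^sub>R d"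
    by (simp add: integral_unique)
  have "((\<lambda>t. (t - a) *\<^sub>R c + (t - a)\<^sup>2 *\<^sub>R d) has_integral
      (((b - a)\<^sup>2 / 2) *\<^sub>R c + ((b - a)^3 / 3) *\<^sub>R d) - (((a - a)\<^sup>2 / 2) *\<^sub>R c + ((a - a)^3 / 3) *\<^sub>R d)) {a..b}"
  proof (intro fundamental_theorem_of_calculus assms)
    fix t assume "t \<in> {a..b}"
    have "((\<lambda>t. (t - a)\<^sup>2 / 2) has_real_derivative t - a) (at t within {a..b})"
      "((\<lambda>t. (t - a)^3 / 3) has_real_derivative (t - a)\<^sup>2) (at t within {a..b})"
      by (auto intro!: derivative_eq_intros)
    from this[THEN has_vector_derivative_scaleR[OF _ has_vector_derivative_const]]
    show "((\<lambda>t. ((t - a)\<^sup>2 / 2) *\<^sub>R c + ((t - a)^3 / 3) *\<^sub>R d) has_vector_derivative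
        (t - a) *\<^sub>R c + (t - a)\<^sup>2 *\<^sub>R d) (at t within {a..b})"
      using has_vector_derivative_add by fastforce
  qed
  moreover have "(\<lambda>t. (t - a) *\<^sub>R (c + (t - a) *\<^sub>R d)) = (\<lambda>t. (t - a) *\<^sub>R c + (t - a)\<^sup>2 *\<^sub>R d)"
    by (simp add: scaleR_add_right power2_eq_square)
  ultimately show "integral {a..b} (\<lambda>t. (t - a) *\<^sub>R (c + (t - a) *\<^sub>R d)) = ((b - a)\<^sup>2 / 2) *\<^sub>R c + ((b - a)^3 / 3) *\<^sub>R d"
    by (simp add: integral_unique)
  have "((\<lambda>t. c + (t - a) *\<^sub>R d + ((t - a)\<^sup>2 / 2) *\<^sub>R e) has_integral
      ((b - a) *\<^sub>R c + ((b - a)\<^sup>2 / 2) *\<^sub>R d + ((b - a)^3 / 6) *\<^sub>R e)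
      - ((a - a) *\<^sub>R c + ((a - a)\<^sup>2 / 2) *\<^sub>R d + ((a - a)^3 / 6) *\<^sub>R e)) {a..b}"
  proof (intro fundamental_theorem_of_calculus assms)
    fix t assume "t \<in> {a..b}"
    have "((\<lambda>t. t - a) has_real_derivative 1) (at t within {a..b})"
      "((\<lambda>t. (t - a)\<^sup>2 / 2) has_real_derivative t - a) (at t within {a..b})"
      "((\<lambda>t. (t - a)^3 / 6) has_real_derivative (t - a)\<^sup>2 / 2) (at t within {a..b})"
      by (auto intro!: derivative_eq_intros)
    note * = this[THEN has_vector_derivative_scaleR[OF _ has_vector_derivative_const]]
    show "((\<lambda>t. (t - a) *\<^sub>R c + ((t - a)\<^sup>2 / 2) *\<^sub>R d + ((t - a)^3 / 6) *\<^sub>R e) has_vector_derivative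
        c + (t - a) *\<^sub>R d + ((t - a)\<^sup>2 / 2) *\<^sub>R e) (at t within {a..b})"
      using has_vector_derivative_add[OF has_vector_derivative_add[OF *(1)[of c] *(2)[of d]] *(3)[of e]] by simp
  qed
  then show "integral {a..b} (\<lambda>t. c + (t - a) *\<^sub>R d + ((t - a)\<^sup>2 / 2) *\<^sub>R e)
      = (b - a) *\<^sub>R c + ((b - a)\<^sup>2 / 2) *\<^sub>R d + ((b - a)^3 / 6) *\<^sub>R e"
    by (simp add: integral_unique)
qed

text \<open>If the error \<open>e = W - p\<close> is orthogonal to \<open>p - W a\<close>, then \<open>p - W a\<close> is the best
  approximation of \<open>W - W a\<close>, whose size is controlled by its oscillation.\<close>

lemma projection_error:
  fixes W p :: "real \<Rightarrow> 'a::euclidean_space"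
  assumes "a \<le> b" and W: "continuous_on {a..b} W" and p: "continuous_on {a..b} p"
    and orth: "integral {a..b} (\<lambda>t. (W t - p t) \<bullet> (p t - W a)) = 0"
    and k: "\<And>t. t \<in> {a..b} \<Longrightarrow> (norm (W t - W a))\<^sup>2 \<le> k"
  shows "integral {a..b} (\<lambda>t. (norm (W t - p t))\<^sup>2) \<le> (b - a) * k"
proof -
  let ?e = "\<lambda>t. W t - p t" and ?d = "\<lambda>t. W t - W a"
  have i: "f integrable_on {a..b}" if "continuous_on {a..b} f" for f :: "real \<Rightarrow> real"
    by (rule integrable_continuous_real[OF that])
  have ce: "continuous_on {a..b} ?e" "continuous_on {a..b} ?d" "continuous_on {a..b} (\<lambda>t. p t - W a)"
    using W p by (auto intro!: continuous_intros)
  have "integral {a..b} (\<lambda>t. (norm (?e t))\<^sup>2) = integral {a..b} (\<lambda>t. ?e t \<bullet> ?d t - ?e t \<bullet> (p t - W a))"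
    by (rule Henstock_Kurzweil_Integration.integral_cong)
      (simp add: power2_norm_eq_inner inner_diff_right inner_diff_left inner_commute algebra_simps)
  also have "\<dots> = integral {a..b} (\<lambda>t. ?e t \<bullet> ?d t)"
    using orth by (subst Henstock_Kurzweil_Integration.integral_diff) (auto intro!: i continuous_intros ce)
  also have "\<dots> \<le> integral {a..b} (\<lambda>t. 1 / 2 * (norm (?e t))\<^sup>2 + 1 / 2 * k)"
  proof (rule integral_le)
    show "(\<lambda>t. ?e t \<bullet> ?d t) integrable_on {a..b}" "(\<lambda>t. 1 / 2 * (norm (?e t))\<^sup>2 + 1 / 2 * k) integrable_on {a..b}"
      by (intro i continuous_intros ce)+
    fix t assume t: "t \<in> {a..b}"
    have "0 \<le> (norm (?e t - ?d t))\<^sup>2" by simp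
    also have "\<dots> = (norm (?e t))\<^sup>2 + (norm (?d t))\<^sup>2 - 2 * (?e t \<bullet> ?d t)"
      unfolding power2_norm_eq_inner by (simp only: inner_diff_left inner_diff_right inner_commute) (simp add: algebra_simps)
    finally show "?e t \<bullet> ?d t \<le> 1 / 2 * (norm (?e t))\<^sup>2 + 1 / 2 * k" using k[OF t] by simp
  qed
  also have "\<dots> = 1 / 2 * integral {a..b} (\<lambda>t. (norm (?e t))\<^sup>2) + 1 / 2 * ((b - a) * k)"
    using assms(1) by (subst Henstock_Kurzweil_Integration.integral_add) (auto intro!: i continuous_intros ce)
  finally show ?thesis by simp
qed

text \<open>An affine function is determined by its moments of order 0 and 1. If these agree with
  the moments of \<open>W\<close>, the error is orthogonal to every affine function, in particular
  to \<open>p - W a\<close>, as \<open>projection_error\<close> requires.\<close>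

lemma affine_projection:
  fixes W :: "real \<Rightarrow> 'a::euclidean_space"
  assumes "a < b" and W: "continuous_on {a..b} W"
    and k: "\<And>t. t \<in> {a..b} \<Longrightarrow> (norm (W t - W a))\<^sup>2 \<le> k"
  shows "\<exists>A B. integral {a..b} (\<lambda>t. A + (t - a) *\<^sub>R B) = integral {a..b} W \<and>
    integral {a..b} (\<lambda>t. (t - a) *\<^sub>R (A + (t - a) *\<^sub>R B)) = integral {a..b} (\<lambda>t. (t - a) *\<^sub>R W t) \<and>
    integral {a..b} (\<lambda>t. (norm (W t - (A + (t - a) *\<^sub>R B)))\<^sup>2) \<le> (b - a) * k"
proof -
  define l where "l = b - a"
  have l: "l > 0" using assms(1) by (simp add: l_def)
  define m0 m1 where "m0 = integral {a..b} W" and "m1 = integral {a..b} (\<lambda>t. (t - a) *\<^sub>R W t)"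
  \<comment> \<open>Solution of the system m0 = l A + (l^2 / 2) B, m1 = (l^2 / 2) A + (l^3 / 3) B,
    whose determinant is l^4 / 12.\<close>
  define B where "B = (12 / l^3) *\<^sub>R (m1 - (l / 2) *\<^sub>R m0)"
  define A where "A = (1 / l) *\<^sub>R m0 - (l / 2) *\<^sub>R B"
  let ?p = "\<lambda>t. A + (t - a) *\<^sub>R B"
  have cp: "continuous_on {a..b} ?p" by (intro continuous_intros)
  have lA: "l *\<^sub>R A = m0 - (l\<^sup>2 / 2) *\<^sub>R B"
    using l by (simp add: A_def scaleR_diff_right power2_eq_square)
  have "l *\<^sub>R A + (l\<^sup>2 / 2) *\<^sub>R B = m0" unfolding lA by simp
  then have 0: "integral {a..b} ?p = m0"
    using integral_continuous_affine(1)[of a b A B] assms(1) by (simp add: l_def)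
  have lB: "(l^3 / 12) *\<^sub>R B = m1 - (l / 2) *\<^sub>R m0" using l by (simp add: B_def)
  have "(l\<^sup>2 / 2) *\<^sub>R A + (l^3 / 3) *\<^sub>R B = (l / 2) *\<^sub>R (l *\<^sub>R A) + (l^3 / 3) *\<^sub>R B"
    by (simp add: power2_eq_square)
  also have "\<dots> = (l / 2) *\<^sub>R m0 + ((l^3 / 3) *\<^sub>R B - (l^3 / 4) *\<^sub>R B)"
    unfolding lA by (simp add: scaleR_diff_right power2_eq_square power3_eq_cube mult.assoc)
  also have "(l^3 / 3) *\<^sub>R B - (l^3 / 4) *\<^sub>R B = (l^3 / 3 - l^3 / 4) *\<^sub>R B" by (rule scaleR_diff_left[symmetric])
  also have "l^3 / 3 - l^3 / 4 = l^3 / 12" by simp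
  finally have "(l\<^sup>2 / 2) *\<^sub>R A + (l^3 / 3) *\<^sub>R B = m1" unfolding lB by simp
  then have 1: "integral {a..b} (\<lambda>t. (t - a) *\<^sub>R ?p t) = m1"
    using integral_continuous_affine(2)[of a b A B] assms(1) by (simp add: l_def)
  have i: "f integrable_on {a..b}" if "continuous_on {a..b} f" for f :: "real \<Rightarrow> 'b::euclidean_space"
    by (rule integrable_continuous_real[OF that])
  have "integral {a..b} (\<lambda>t. W t - ?p t) = 0"
    using 0 by (subst Henstock_Kurzweil_Integration.integral_diff) (auto intro!: i W cp simp: m0_def)
  moreover have "(\<lambda>t. W t - ?p t) integrable_on {a..b}" by (intro i continuous_intros W)
  ultimately have h0: "((\<lambda>t. W t - ?p t) has_integral 0) {a..b}" by (simp add: has_integral_iff)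
  have "integral {a..b} (\<lambda>t. (t - a) *\<^sub>R W t - (t - a) *\<^sub>R ?p t) = 0"
    using 1 by (subst Henstock_Kurzweil_Integration.integral_diff) (auto intro!: i continuous_intros W simp: m1_def)
  moreover have "(\<lambda>t. (t - a) *\<^sub>R W t - (t - a) *\<^sub>R ?p t) integrable_on {a..b}" by (intro i continuous_intros W)
  ultimately have h1: "((\<lambda>t. (t - a) *\<^sub>R W t - (t - a) *\<^sub>R ?p t) has_integral 0) {a..b}" by (simp add: has_integral_iff)
  \<comment> \<open>Splits \<open>p - W a\<close> into the constant A - W a and the linear part (t -
    a) B, against which the two vanishing moments of the error are tested.\<close>
  have "((\<lambda>t. (W t - ?p t) \<bullet> (A - W a) + ((t - a) *\<^sub>R W t - (t - a) *\<^sub>R ?p t) \<bullet> B) has_integral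
      0 \<bullet> (A - W a) + 0 \<bullet> B) {a..b}"
    using has_integral_linear[OF h0 bounded_linear_inner_left[of "A - W a"]]
      has_integral_linear[OF h1 bounded_linear_inner_left[of B]]
    by (intro has_integral_add) (simp_all add: o_def)
  then have "integral {a..b} (\<lambda>t. (W t - ?p t) \<bullet> (A - W a) + ((t - a) *\<^sub>R W t - (t - a) *\<^sub>R ?p t) \<bullet> B) = 0"
    by (simp add: integral_unique)
  also have "(\<lambda>t. (W t - ?p t) \<bullet> (A - W a) + ((t - a) *\<^sub>R W t - (t - a) *\<^sub>R ?p t) \<bullet> B) = (\<lambda>t. (W t - ?p t) \<bullet> (?p t - W a))"
    by (simp add: fun_eq_iff inner_diff_left inner_diff_right inner_add_left inner_add_right algebra_simps)
  finally have orth: "integral {a..b} (\<lambda>t. (W t - ?p t) \<bullet> (?p t - W a)) = 0" .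
  have "integral {a..b} (\<lambda>t. (norm (W t - ?p t))\<^sup>2) \<le> (b - a) * k"
    using assms(1) by (intro projection_error[OF _ W cp orth k]) auto
  then show ?thesis using 0 1 unfolding m0_def m1_def by blast
qed

text \<open>The slope 0 is written out so that constants and affine functions share the format
  expected by \<open>piecewise_affine_primitive\<close>.\<close>

lemma mean_projection:
  fixes W :: "real \<Rightarrow> 'a::euclidean_space"
  assumes "a < b" and W: "continuous_on {a..b} W"
    and k: "\<And>t. t \<in> {a..b} \<Longrightarrow> (norm (W t - W a))\<^sup>2 \<le> k"
  shows "\<exists>A. integral {a..b} (\<lambda>t. A + (t - a) *\<^sub>R 0) = integral {a..b} W \<and>
    integral {a..b} (\<lambda>t. (norm (W t - (A + (t - a) *\<^sub>R 0)))\<^sup>2) \<le> (b - a) * k"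
proof -
  define A where "A = (1 / (b - a)) *\<^sub>R integral {a..b} W"
  have 0: "integral {a..b} (\<lambda>t. A) = integral {a..b} W" using assms(1) by (simp add: A_def)
  have iW: "W integrable_on {a..b}" by (rule integrable_continuous_real[OF W])
  have iA: "(\<lambda>t. A) integrable_on {a..b}" by (intro integrable_continuous_real continuous_intros)
  have "((\<lambda>t. W t - A) has_integral 0) {a..b}"
    using has_integral_diff[OF integrable_integral[OF iW] integrable_integral[OF iA]] unfolding 0 by simp
  from has_integral_linear[OF this bounded_linear_inner_left[of "A - W a"]]
  have "integral {a..b} (\<lambda>t. (W t - A) \<bullet> (A - W a)) = 0" by (simp add: o_def integral_unique)
  then have "integral {a..b} (\<lambda>t. (norm (W t - A))\<^sup>2) \<le> (b - a) * k"
    using assms(1) by (intro projection_error[OF _ W continuous_on_const _ k]) auto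
  then show ?thesis using 0 by (intro exI[of _ A]) simp
qed

text \<open>Open elements make the summands disjoint; the value is 0 at the nodes, which is
  invisible to integrals.\<close>

definition piecewise_affine :: "nat \<Rightarrow> (nat \<Rightarrow> real) \<Rightarrow> (nat \<Rightarrow> 'a) \<Rightarrow> (nat \<Rightarrow> 'a) \<Rightarrow> real \<Rightarrow> 'a::real_vector" where
  "piecewise_affine N x A B t = (\<Sum>j<N. indicat_real {x j<..<x (Suc j)} t *\<^sub>R (A j + (t - x j) *\<^sub>R B j))"

lemma piecewise_affine_eq:
  assumes m: "mesh L N x" and j: "j < N" "t \<in> {x j<..<x (Suc j)}"
  shows "piecewise_affine N x A B t = A j + (t - x j) *\<^sub>R B j"
proof -
  have "indicat_real {x i<..<x (Suc i)} t *\<^sub>R (A i + (t - x i) *\<^sub>R B i)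
      = (if i = j then A j + (t - x j) *\<^sub>R B j else 0)" if i: "i < N" for i
  proof (cases i j rule: linorder_cases)
    case less
    then have "x (Suc i) \<le> x j" using mesh_mono[OF m, of "Suc i" j] j by auto
    then show ?thesis using less j by (auto simp: indicator_def)
  next
    case greater
    then have "x (Suc j) \<le> x i" using mesh_mono[OF m, of "Suc j" i] i by auto
    then show ?thesis using greater j by (auto simp: indicator_def)
  qed (use j in auto)
  then have "piecewise_affine N x A B t = (\<Sum>i<N. if i = j then A j + (t - x j) *\<^sub>R B j else 0)"
    unfolding piecewise_affine_def by (intro sum.cong) auto
  then show ?thesis using j(1) by simp
qed

lemma piecewise_affine_L2:
  fixes A B :: "nat \<Rightarrow> 'a::euclidean_space"
  assumes L: "L > 0" and m: "mesh L N x"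
  shows "piecewise_affine N x A B \<in> L2 L"
proof -
  have "(\<lambda>t. A j + (t - x j) *\<^sub>R B j) \<in> borel_measurable (\<mu> L)" for j
    by (intro continuous_borel_measurable_interval continuous_intros)
  then have m': "piecewise_affine N x A B \<in> borel_measurable (\<mu> L)"
    unfolding piecewise_affine_def[abs_def]
    by (intro borel_measurable_sum borel_measurable_scaleR indicator_measurable_interval) auto
  have "AE t in \<mu> L. norm (piecewise_affine N x A B t) \<le> (\<Sum>j<N. norm (A j) + L * norm (B j))"
  proof (rule AE_intervalI)
    fix t assume t: "0 < t" "t < L"
    have "norm (piecewise_affine N x A B t)
        \<le> (\<Sum>j<N. norm (indicat_real {x j<..<x (Suc j)} t *\<^sub>R (A j + (t - x j) *\<^sub>R B j)))"
      unfolding piecewise_affine_def by (rule norm_sum)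
    also have "\<dots> \<le> (\<Sum>j<N. norm (A j) + L * norm (B j))"
    proof (rule sum_mono)
      fix j assume "j \<in> {..<N}"
      then have "x j \<in> {0..L}" using mesh_node_range[OF m, of j] by simp
      then have "\<bar>t - x j\<bar> \<le> L" using t by auto
      then have "norm (A j + (t - x j) *\<^sub>R B j) \<le> norm (A j) + L * norm (B j)"
        by (intro order_trans[OF norm_triangle_ineq] add_left_mono) (simp add: mult_right_mono)
      moreover have "0 \<le> norm (A j) + L * norm (B j)" using L by simp
      ultimately show "norm (indicat_real {x j<..<x (Suc j)} t *\<^sub>R (A j + (t - x j) *\<^sub>R B j)) \<le> norm (A j) + L * norm (B j)"
        by (auto simp: indicator_def)
    qed
    finally show "norm (piecewise_affine N x A B t) \<le> (\<Sum>j<N. norm (A j) + L * norm (B j))" .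
  qed
  then show ?thesis using L by (intro L2_bounded(1)[OF _ m']) (auto intro!: sum_nonneg)
qed

lemma integral_spike_open:
  fixes f g :: "real \<Rightarrow> 'a::euclidean_space"
  assumes "\<And>t. a < t \<Longrightarrow> t < b \<Longrightarrow> f t = g t"
  shows "integral {a..b} f = integral {a..b} g"
  by (rule integral_spike[of "{a, b}"]) (use assms in auto)

lemma integral_mesh_sum:
  fixes f :: "real \<Rightarrow> real"
  assumes m: "mesh L N x" and f: "f integrable_on {0..L}"
  shows "integral {0..L} f = (\<Sum>j<N. integral {x j..x (Suc j)} f)"
proof -
  have "integral {0..x k} f = (\<Sum>j<k. integral {x j..x (Suc j)} f)" if "k \<le> N" for k
    using that
  proof (induction k)
    case 0
    then show ?case using m by (simp add: mesh_def)
  next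
    case (Suc k)
    have r: "x k \<in> {0..L}" "x (Suc k) \<in> {0..L}" "x k \<le> x (Suc k)"
      using mesh_node_range[OF m] mesh_mono[OF m, of k "Suc k"] Suc by auto
    have "integral {0..x k} f + integral {x k..x (Suc k)} f = integral {0..x (Suc k)} f"
      using r by (intro Henstock_Kurzweil_Integration.integral_combine)
        (auto intro: integrable_subinterval_real[OF f])
    then show ?case using Suc by simp
  qed
  from this[of N] show ?thesis using m by (simp add: mesh_def)
qed

text \<open>Equal element averages of \<open>v'\<close> and \<open>U'\<close> are what makes \<open>v\<close> interpolate \<open>U\<close> at the nodes.\<close>

lemma piecewise_affine_primitive:
  fixes U W Z :: "real \<Rightarrow> 'a::euclidean_space"
  assumes L: "L > 0" and m: "mesh L N x"
    and W: "continuous_on {0..L} W" and Z: "Z \<in> L2 L"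
    and dU: "\<And>t. t \<in> {0..L} \<Longrightarrow> (U has_vector_derivative W t) (at t within {0..L})"
    and avg: "\<And>j. j < N \<Longrightarrow> integral {x j..x (Suc j)} (\<lambda>t. A j + (t - x j) *\<^sub>R B j) = integral {x j..x (Suc j)} W"
    and err: "\<And>j. j < N \<Longrightarrow> integral {x j..x (Suc j)} (\<lambda>t. (norm (W t - (A j + (t - x j) *\<^sub>R B j)))\<^sup>2)
        \<le> (x (Suc j) - x j) * ((x (Suc j) - x j) * integral {x j..x (Suc j)} (\<lambda>t. (norm (Z t))\<^sup>2))"
  defines "w \<equiv> piecewise_affine N x A B"
  defines "v \<equiv> \<lambda>t. U 0 + integral {0..t} w"
  shows "j \<le> N \<Longrightarrow> v (x j) = U (x j)"
    "j < N \<Longrightarrow> t \<in> {x j..x (Suc j)} \<Longrightarrow> v t = U (x j) + (t - x j) *\<^sub>R A j + ((t - x j)\<^sup>2 / 2) *\<^sub>R B j"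
    "L2_norm L (\<lambda>t. W t - w t) \<le> mesh_size N x * L2_norm L Z"
proof -
  have wL2: "w \<in> L2 L" unfolding w_def by (rule piecewise_affine_L2[OF L m])
  have el: "x j \<in> {0..L}" "x (Suc j) \<in> {0..L}" "x j < x (Suc j)" if "j < N" for j
    using mesh_node_range[OF m, of j] mesh_node_range[OF m, of "Suc j"] m that by (auto simp: mesh_def)
  have iw: "integral {x j..t} w = (t - x j) *\<^sub>R A j + ((t - x j)\<^sup>2 / 2) *\<^sub>R B j"
    if j: "j < N" and t: "t \<in> {x j..x (Suc j)}" for j t
  proof -
    have "integral {x j..t} w = integral {x j..t} (\<lambda>t. A j + (t - x j) *\<^sub>R B j)"
      unfolding w_def by (intro integral_spike_open piecewise_affine_eq[OF m j]) (use t in auto)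
    then show ?thesis using integral_continuous_affine(1)[of "x j" t "A j" "B j"] t by simp
  qed
  have step: "v t = v (x j) + integral {x j..t} w" if j: "j < N" and t: "t \<in> {x j..x (Suc j)}" for j t
    using primitive_diff[OF L2_integrable[OF wL2], of "x j" t] el[OF j] t by (simp add: v_def algebra_simps)
  have node: "v (x j) = U (x j)" if "j \<le> N" for j
    using that
  proof (induction j)
    case 0
    have "x 0 = 0" using m by (simp add: mesh_def)
    then show ?case by (simp add: v_def)
  next
    case (Suc j)
    then have j: "j < N" by simp
    have "integral {x j..x (Suc j)} w = integral {x j..x (Suc j)} (\<lambda>t. A j + (t - x j) *\<^sub>R B j)"
      using piecewise_affine_eq[OF m j] unfolding w_def by (intro integral_spike_open) auto
    also have "\<dots> = integral {x j..x (Suc j)} W" by (rule avg[OF j])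
    also have "\<dots> = U (x (Suc j)) - U (x j)"
      using el[OF j] by (intro integral_unique fundamental_theorem_of_calculus)
        (auto intro!: has_vector_derivative_within_subset[OF dU])
    finally show ?case using step[OF j, of "x (Suc j)"] el[OF j] Suc by simp
  qed
  then show "j \<le> N \<Longrightarrow> v (x j) = U (x j)" .
  show "v t = U (x j) + (t - x j) *\<^sub>R A j + ((t - x j)\<^sup>2 / 2) *\<^sub>R B j" if j: "j < N" and t: "t \<in> {x j..x (Suc j)}"
    using step[OF j t] iw[OF j t] node[of j] j by simp
  have e: "(\<lambda>t. W t - w t) \<in> L2 L" by (rule L2_diff[OF continuous_L2[OF W] wL2])
  let ?h = "mesh_size N x"
  have iZ: "(\<lambda>t. (norm (Z t))\<^sup>2) integrable_on {0..L}"
    by (rule integrable_interval_sub(2)[OF L2_square_integrable[OF Z]]) auto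
  show "L2_norm L (\<lambda>t. W t - w t) \<le> ?h * L2_norm L Z"
  proof (rule power2_le_imp_le)
    have "(L2_norm L (\<lambda>t. W t - w t))\<^sup>2 = integral {0..L} (\<lambda>t. (norm (W t - w t))\<^sup>2)"
      unfolding L2_norm_power2 by (rule integral_interval[OF L2_square_integrable[OF e]])
    also have "\<dots> = (\<Sum>j<N. integral {x j..x (Suc j)} (\<lambda>t. (norm (W t - w t))\<^sup>2))"
      by (rule integral_mesh_sum[OF m integrable_interval_sub(2)[OF L2_square_integrable[OF e]]]) auto
    also have "\<dots> \<le> (\<Sum>j<N. ?h\<^sup>2 * integral {x j..x (Suc j)} (\<lambda>t. (norm (Z t))\<^sup>2))"
    proof (rule sum_mono)
      fix j assume "j \<in> {..<N}"
      then have j: "j < N" by simp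
      let ?l = "x (Suc j) - x j" and ?z = "integral {x j..x (Suc j)} (\<lambda>t. (norm (Z t))\<^sup>2)"
      have "integral {x j..x (Suc j)} (\<lambda>t. (norm (W t - w t))\<^sup>2)
          = integral {x j..x (Suc j)} (\<lambda>t. (norm (W t - (A j + (t - x j) *\<^sub>R B j)))\<^sup>2)"
      proof (intro integral_spike_open)
        fix t assume "x j < t" "t < x (Suc j)"
        then have "w t = A j + (t - x j) *\<^sub>R B j" unfolding w_def by (intro piecewise_affine_eq[OF m j]) simp
        then show "(norm (W t - w t))\<^sup>2 = (norm (W t - (A j + (t - x j) *\<^sub>R B j)))\<^sup>2" by simp
      qed
      also have "\<dots> \<le> ?l * (?l * ?z)" by (rule err[OF j])
      also have "\<dots> = ?l\<^sup>2 * ?z" by (simp add: power2_eq_square)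
      also have "\<dots> \<le> ?h\<^sup>2 * ?z"
      proof (intro mult_right_mono power_mono)
        show "?l \<le> ?h" by (rule mesh_size_ge(1)[OF m j])
        show "0 \<le> ?l" using el[OF j] by simp
        show "0 \<le> ?z" using el[OF j] by (intro integral_nonneg integrable_subinterval_real[OF iZ]) auto
      qed
      finally show "integral {x j..x (Suc j)} (\<lambda>t. (norm (W t - w t))\<^sup>2) \<le> ?h\<^sup>2 * ?z" .
    qed
    also have "\<dots> = ?h\<^sup>2 * integral {0..L} (\<lambda>t. (norm (Z t))\<^sup>2)"
      unfolding integral_mesh_sum[OF m iZ] by (simp add: sum_distrib_left)
    also have "\<dots> = (?h * L2_norm L Z)\<^sup>2"
      unfolding power_mult_distrib L2_norm_power2 integral_interval[OF L2_square_integrable[OF Z]] ..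
    finally show "(L2_norm L (\<lambda>t. W t - w t))\<^sup>2 \<le> (?h * L2_norm L Z)\<^sup>2" .
    have "0 < N" using m by (simp add: mesh_def)
    then have "0 < ?h" by (rule mesh_size_ge(2)[OF m])
    then show "0 \<le> ?h * L2_norm L Z" by simp
  qed
qed

text \<open>Cauchy-Schwarz on the element. Keeping the share of |Z|^2 in that element on the right
  is essential: after summation the squared error is of order h^2, while the global norm would leave
  only order h.\<close>

lemma element_oscillation:
  fixes W Z :: "real \<Rightarrow> 'a::euclidean_space"
  assumes Z: "Z \<in> L2 L" and W: "\<And>s t. 0 \<le> s \<Longrightarrow> s \<le> t \<Longrightarrow> t \<le> L \<Longrightarrow> W t - W s = integral {s..t} Z"
    and ab: "0 \<le> a" "b \<le> L" and t: "t \<in> {a..b}"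
  shows "(norm (W t - W a))\<^sup>2 \<le> (b - a) * integral {a..b} (\<lambda>t. (norm (Z t))\<^sup>2)"
proof -
  have i: "(\<lambda>t. (norm (Z t))\<^sup>2) integrable_on {a..b}"
    by (rule integrable_interval_sub(2)[OF L2_square_integrable[OF Z] ab])
  have "integral {a..t} (\<lambda>t. (norm (Z t))\<^sup>2) \<le> integral {a..b} (\<lambda>t. (norm (Z t))\<^sup>2)"
    using t by (intro integral_subset_le i integrable_subinterval_real[OF i]) auto
  then have "sqrt (t - a) * sqrt (integral {a..t} (\<lambda>t. (norm (Z t))\<^sup>2))
      \<le> sqrt (b - a) * sqrt (integral {a..b} (\<lambda>t. (norm (Z t))\<^sup>2))"
    using t integral_nonneg[OF integrable_subinterval_real[OF i, of a t]] by (intro mult_mono) auto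
  moreover have "norm (W t - W a) \<le> sqrt (t - a) * sqrt (integral {a..t} (\<lambda>t. (norm (Z t))\<^sup>2))"
    using W[of a t] norm_integral_le_L2_norm_sub(1)[OF Z, of a t] ab t by simp
  ultimately have "norm (W t - W a) \<le> sqrt ((b - a) * integral {a..b} (\<lambda>t. (norm (Z t))\<^sup>2))"
    by (simp add: real_sqrt_mult)
  then have "(norm (W t - W a))\<^sup>2 \<le> (sqrt ((b - a) * integral {a..b} (\<lambda>t. (norm (Z t))\<^sup>2)))\<^sup>2"
    by (rule power_mono) simp
  also have "\<dots> = (b - a) * integral {a..b} (\<lambda>t. (norm (Z t))\<^sup>2)"
    using t by (intro real_sqrt_pow2 mult_nonneg_nonneg integral_nonneg[OF i]) auto
  finally show ?thesis .
qed

lemma shifted_cubic_poly: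
  fixes a :: real
  obtains q :: "real poly" where "degree q \<le> 3" "\<And>t. poly q t = k0 + k1 * (t - a) + k2 * (t - a)\<^sup>2 + k3 * (t - a)^3"
proof
  show "degree (pcompose [:k0, k1, k2, k3:] [:- a, 1:]) \<le> 3"
    by (simp add: degree_pcompose)
  show "poly (pcompose [:k0, k1, k2, k3:] [:- a, 1:]) t = k0 + k1 * (t - a) + k2 * (t - a)\<^sup>2 + k3 * (t - a)^3" for t
    by (simp add: poly_pcompose power2_eq_square power3_eq_cube algebra_simps)
qed

text \<open>The second derivative of the spline is the elementwise \<open>L\<^sup>2\<close> projection of \<open>W\<close> onto affine
  functions: equality of the moments of order 0 gives interpolation of \<open>U\<close>, that of the moments of
  order 1 interpolation of \<open>Y\<close>.\<close>

lemma cubic_spline_approximation: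
  fixes Y U W Z :: "real \<Rightarrow> real^'n"
  assumes L: "L > 0" and m: "mesh L N x"
    and W: "continuous_on {0..L} W" and Z: "Z \<in> L2 L"
    and dY: "\<And>t. t \<in> {0..L} \<Longrightarrow> (Y has_vector_derivative U t) (at t within {0..L})"
    and dU: "\<And>t. t \<in> {0..L} \<Longrightarrow> (U has_vector_derivative W t) (at t within {0..L})"
    and WZ: "\<And>s t. 0 \<le> s \<Longrightarrow> s \<le> t \<Longrightarrow> t \<le> L \<Longrightarrow> W t - W s = integral {s..t} Z"
  shows "\<exists>yh uh w. (\<forall>i. (\<lambda>t. yh t $ i) \<in> spline 3 1 L N x) \<and>
    (\<forall>t\<in>{0..L}. (yh has_vector_derivative uh t) (at t within {0..L})) \<and>
    w \<in> L2 L \<and> (\<forall>t. 0 \<le> t \<longrightarrow> t \<le> L \<longrightarrow> uh t = U 0 + integral {0..t} w) \<and>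
    (\<forall>j\<le>N. uh (x j) = U (x j)) \<and> (\<forall>j\<le>N. yh (x j) = Y (x j)) \<and>
    L2_norm L (\<lambda>t. W t - w t) \<le> mesh_size N x * L2_norm L Z"
proof -
  have el: "0 \<le> x j" "x (Suc j) \<le> L" "x j < x (Suc j)" if "j < N" for j
    using mesh_node_range[OF m, of j] mesh_node_range[OF m, of "Suc j"] m that by (auto simp: mesh_def)
  define R where "R j A B \<longleftrightarrow>
    integral {x j..x (Suc j)} (\<lambda>t. A + (t - x j) *\<^sub>R B) = integral {x j..x (Suc j)} W \<and>
    integral {x j..x (Suc j)} (\<lambda>t. (t - x j) *\<^sub>R (A + (t - x j) *\<^sub>R B)) = integral {x j..x (Suc j)} (\<lambda>t. (t - x j) *\<^sub>R W t) \<and>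
    integral {x j..x (Suc j)} (\<lambda>t. (norm (W t - (A + (t - x j) *\<^sub>R B)))\<^sup>2)
      \<le> (x (Suc j) - x j) * ((x (Suc j) - x j) * integral {x j..x (Suc j)} (\<lambda>t. (norm (Z t))\<^sup>2))" for j A B
  have "\<exists>A B. R j A B" if "j < N" for j
    unfolding R_def using el[OF that]
    by (intro affine_projection element_oscillation[OF Z WZ] continuous_on_subset[OF W]) auto
  then obtain A B where R: "\<And>j. j < N \<Longrightarrow> R j (A j) (B j)" by metis
  note avg = R[unfolded R_def, THEN conjunct1] and mom = R[unfolded R_def, THEN conjunct2, THEN conjunct1]
    and err = R[unfolded R_def, THEN conjunct2, THEN conjunct2]
  define w where "w = piecewise_affine N x A B"
  define uh where "uh t = U 0 + integral {0..t} w" for t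
  have P: "j \<le> N \<Longrightarrow> uh (x j) = U (x j)"
    "j < N \<Longrightarrow> t \<in> {x j..x (Suc j)} \<Longrightarrow> uh t = U (x j) + (t - x j) *\<^sub>R A j + ((t - x j)\<^sup>2 / 2) *\<^sub>R B j"
    "L2_norm L (\<lambda>t. W t - w t) \<le> mesh_size N x * L2_norm L Z" for j t
    unfolding uh_def w_def
    by (rule piecewise_affine_primitive[OF L m W Z dU avg err]; assumption)+
  have wL2: "w \<in> L2 L" unfolding w_def by (rule piecewise_affine_L2[OF L m])
  have cu: "continuous_on {0..L} uh" by (rule Hsob_1_constructor(1)[OF L wL2]) (simp add: uh_def)
  define yh where "yh t = Y 0 + integral {0..t} uh" for t
  have dyh: "(yh has_vector_derivative uh t) (at t within {0..L})" if "t \<in> {0..L}" for t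
    unfolding yh_def using has_vector_derivative_add[OF has_vector_derivative_const integral_has_vector_derivative[OF cu that]]
    by simp
  have step: "yh t = yh (x j) + (t - x j) *\<^sub>R U (x j) + ((t - x j)\<^sup>2 / 2) *\<^sub>R A j + ((t - x j)^3 / 6) *\<^sub>R B j"
    if j: "j < N" and t: "t \<in> {x j..x (Suc j)}" for j t
  proof -
    have "yh t = yh (x j) + integral {x j..t} uh"
      using primitive_diff[OF L2_integrable[OF continuous_L2[OF cu]], of "x j" t] el[OF j] t by (simp add: yh_def algebra_simps)
    also have "integral {x j..t} uh = integral {x j..t} (\<lambda>s. U (x j) + (s - x j) *\<^sub>R A j + ((s - x j)\<^sup>2 / 2) *\<^sub>R B j)"
      using P(2)[OF j] t by (intro Henstock_Kurzweil_Integration.integral_cong) auto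
    also have "\<dots> = (t - x j) *\<^sub>R U (x j) + ((t - x j)\<^sup>2 / 2) *\<^sub>R A j + ((t - x j)^3 / 6) *\<^sub>R B j"
      using t by (intro integral_continuous_affine(3)) simp
    finally show ?thesis by (simp add: add.assoc)
  qed
  have node: "yh (x j) = Y (x j)" if "j \<le> N" for j
    using that
  proof (induction j)
    case 0
    have "x 0 = 0" using m by (simp add: mesh_def)
    then show ?case by (simp add: yh_def)
  next
    case (Suc j)
    then have j: "j < N" by simp
    let ?a = "x j" and ?b = "x (Suc j)"
    define l where "l = ?b - ?a"
    have sub: "t \<in> {0..L}" if "t \<in> {?a..?b}" for t using that el[OF j] by auto
    have dY': "(Y has_vector_derivative U t) (at t within {?a..?b})" and dU': "(U has_vector_derivative W t) (at t within {?a..?b})"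
      if "t \<in> {?a..?b}" for t
      using el[OF j] has_vector_derivative_within_subset[OF dY[OF sub[OF that]], of "{?a..?b}"]
        has_vector_derivative_within_subset[OF dU[OF sub[OF that]], of "{?a..?b}"] by auto
    have cU: "continuous_on {?a..?b} U"
      using dU' has_vector_derivative_continuous unfolding continuous_on_eq_continuous_within by blast
    have cW: "continuous_on {?a..?b} W" using el[OF j] by (auto intro: continuous_on_subset[OF W])
    have iY: "integral {?a..?b} U = Y ?b - Y ?a"
      using el[OF j] dY' by (intro integral_unique fundamental_theorem_of_calculus) auto
    \<comment> \<open>Integration by parts of the first moment of W = U': the integral of
      \<open>U\<close> over the element is l U(b) minus that moment. Since the projection preserves
      the moment, the integral of \<open>uh\<close> obeys the same formula; the coefficient of
      \<open>B j\<close> is 1/2 - 1/3 = 1/6.\<close>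
    have "((\<lambda>t. U t + (t - ?a) *\<^sub>R W t) has_integral (?b - ?a) *\<^sub>R U ?b - (?a - ?a) *\<^sub>R U ?a) {?a..?b}"
    proof (rule fundamental_theorem_of_calculus)
      fix t assume t: "t \<in> {?a..?b}"
      have "((\<lambda>t. t - ?a) has_real_derivative 1) (at t within {?a..?b})" by (auto intro!: derivative_eq_intros)
      from has_vector_derivative_scaleR[OF this dU'[OF t]]
      show "((\<lambda>t. (t - ?a) *\<^sub>R U t) has_vector_derivative U t + (t - ?a) *\<^sub>R W t) (at t within {?a..?b})"
        by (simp add: add.commute)
    qed (use el[OF j] in simp)
    then have "integral {?a..?b} (\<lambda>t. U t + (t - ?a) *\<^sub>R W t) = l *\<^sub>R U ?b"
      by (simp add: integral_unique l_def)
    then have "integral {?a..?b} U + integral {?a..?b} (\<lambda>t. (t - ?a) *\<^sub>R W t) = l *\<^sub>R U ?b"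
      by (subst (asm) Henstock_Kurzweil_Integration.integral_add)
        (auto intro!: integrable_continuous_real continuous_intros cU cW)
    moreover have "integral {?a..?b} (\<lambda>t. (t - ?a) *\<^sub>R W t) = (l\<^sup>2 / 2) *\<^sub>R A j + (l^3 / 3) *\<^sub>R B j"
      using mom[OF j] integral_continuous_affine(2)[of ?a ?b "A j" "B j"] el[OF j] by (simp add: l_def)
    moreover have "U ?b = U ?a + l *\<^sub>R A j + (l\<^sup>2 / 2) *\<^sub>R B j"
      using P(2)[OF j, of ?b] P(1)[of "Suc j"] el[OF j] Suc.prems by (simp add: l_def)
    ultimately have "integral {?a..?b} U = l *\<^sub>R (U ?a + l *\<^sub>R A j + (l\<^sup>2 / 2) *\<^sub>R B j) - ((l\<^sup>2 / 2) *\<^sub>R A j + (l^3 / 3) *\<^sub>R B j)"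
      by (simp add: algebra_simps)
    also have "\<dots> = l *\<^sub>R U ?a + (l\<^sup>2 / 2) *\<^sub>R A j + (l^3 / 6) *\<^sub>R B j"
      by (simp add: vec_eq_iff power2_eq_square power3_eq_cube field_simps)
    finally have "Y ?b = Y ?a + l *\<^sub>R U ?a + (l\<^sup>2 / 2) *\<^sub>R A j + (l^3 / 6) *\<^sub>R B j" using iY by (simp add: algebra_simps)
    then show ?case using step[OF j, of ?b] el[OF j] Suc by (simp add: l_def)
  qed
  have sp: "(\<lambda>t. yh t $ i) \<in> spline 3 1 L N x" for i
  proof -
    have d: "((\<lambda>t. yh t $ i) has_vector_derivative uh t $ i) (at t within {0..L})" if "t \<in> {0..L}" for t
      by (rule bounded_linear.has_vector_derivative[OF bounded_linear_vec_nth dyh[OF that]])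
    have "continuous_on {0..L} (\<lambda>t. uh t $ i)" using cu by (intro continuous_intros)
    moreover have "vector_derivative (\<lambda>t. yh t $ i) (at t within {0..L}) = uh t $ i" if "t \<in> {0..L}" for t
      by (rule vector_derivative_within_closed_interval[OF L that d[OF that]])
    ultimately have "continuous_on {0..L} (\<lambda>t. vector_derivative (\<lambda>t. yh t $ i) (at t within {0..L}))"
      by (subst continuous_on_cong[OF refl]) auto
    moreover have "(\<lambda>t. yh t $ i) differentiable (at t within {0..L})" if "t \<in> {0..L}" for t
      by (rule differentiableI_vector[OF d[OF that]])
    ultimately have C1: "Ck_on 1 {0..L} (\<lambda>t. yh t $ i)" unfolding One_nat_def Ck_on.simps by blast
    have "\<exists>q. degree q \<le> 3 \<and> (\<forall>t\<in>{x j..x (Suc j)}. yh t $ i = poly q t)" if j: "j < N" for j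
    proof -
      obtain q :: "real poly" where q: "degree q \<le> 3"
        "\<And>t. poly q t = yh (x j) $ i + U (x j) $ i * (t - x j) + A j $ i / 2 * (t - x j)\<^sup>2 + B j $ i / 6 * (t - x j)^3"
        using shifted_cubic_poly[of "yh (x j) $ i" "U (x j) $ i" "x j" "A j $ i / 2" "B j $ i / 6"] by blast
      have "yh t $ i = poly q t" if "t \<in> {x j..x (Suc j)}" for t
        unfolding step[OF j that] q(2) by (simp add: mult.commute)
      then show ?thesis using q(1) by blast
    qed
    then show ?thesis using C1 by (simp add: spline_def)
  qed
  show ?thesis
    by (intro exI[of _ yh] exI[of _ uh] exI[of _ w] conjI allI impI ballI sp dyh wL2 P(1) node P(3) uh_def)
qed

text \<open>One derivative less than in the cubic case: only the nodal values of \<open>U\<close>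
  have to be met, so matching element means suffices and \<open>w\<close> may be piecewise
  constant.\<close>

lemma affine_spline_approximation:
  fixes U W Z :: "real \<Rightarrow> real^'n"
  assumes L: "L > 0" and m: "mesh L N x"
    and W: "continuous_on {0..L} W" and Z: "Z \<in> L2 L"
    and dU: "\<And>t. t \<in> {0..L} \<Longrightarrow> (U has_vector_derivative W t) (at t within {0..L})"
    and WZ: "\<And>s t. 0 \<le> s \<Longrightarrow> s \<le> t \<Longrightarrow> t \<le> L \<Longrightarrow> W t - W s = integral {s..t} Z"
  shows "\<exists>uh w. (\<forall>i. (\<lambda>t. uh t $ i) \<in> spline 1 0 L N x) \<and>
    w \<in> L2 L \<and> (\<forall>t. 0 \<le> t \<longrightarrow> t \<le> L \<longrightarrow> uh t = U 0 + integral {0..t} w) \<and>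
    (\<forall>j\<le>N. uh (x j) = U (x j)) \<and>
    L2_norm L (\<lambda>t. W t - w t) \<le> mesh_size N x * L2_norm L Z"
proof -
  have el: "0 \<le> x j" "x (Suc j) \<le> L" "x j < x (Suc j)" if "j < N" for j
    using mesh_node_range[OF m, of j] mesh_node_range[OF m, of "Suc j"] m that by (auto simp: mesh_def)
  define R where "R j A \<longleftrightarrow>
    integral {x j..x (Suc j)} (\<lambda>t. A + (t - x j) *\<^sub>R 0) = integral {x j..x (Suc j)} W \<and>
    integral {x j..x (Suc j)} (\<lambda>t. (norm (W t - (A + (t - x j) *\<^sub>R 0)))\<^sup>2)
      \<le> (x (Suc j) - x j) * ((x (Suc j) - x j) * integral {x j..x (Suc j)} (\<lambda>t. (norm (Z t))\<^sup>2))" for j A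
  have "\<exists>A. R j A" if "j < N" for j
    unfolding R_def using el[OF that]
    by (intro mean_projection element_oscillation[OF Z WZ] continuous_on_subset[OF W]) auto
  then obtain A where R: "\<And>j. j < N \<Longrightarrow> R j (A j)" by metis
  note avg = R[unfolded R_def, THEN conjunct1] and err = R[unfolded R_def, THEN conjunct2]
  define w where "w = piecewise_affine N x A (\<lambda>j. 0)"
  define uh where "uh t = U 0 + integral {0..t} w" for t
  have P: "j \<le> N \<Longrightarrow> uh (x j) = U (x j)"
    "j < N \<Longrightarrow> t \<in> {x j..x (Suc j)} \<Longrightarrow> uh t = U (x j) + (t - x j) *\<^sub>R A j + ((t - x j)\<^sup>2 / 2) *\<^sub>R 0"
    "L2_norm L (\<lambda>t. W t - w t) \<le> mesh_size N x * L2_norm L Z" for j t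
    unfolding uh_def w_def
    by (rule piecewise_affine_primitive[OF L m W Z dU avg err]; assumption)+
  have wL2: "w \<in> L2 L" unfolding w_def by (rule piecewise_affine_L2[OF L m])
  have cu: "continuous_on {0..L} uh" by (rule Hsob_1_constructor(1)[OF L wL2]) (simp add: uh_def)
  have sp: "(\<lambda>t. uh t $ i) \<in> spline 1 0 L N x" for i
  proof -
    have C0: "Ck_on 0 {0..L} (\<lambda>t. uh t $ i)" using cu by (auto intro!: continuous_intros)
    have "\<exists>q. degree q \<le> 1 \<and> (\<forall>t\<in>{x j..x (Suc j)}. uh t $ i = poly q t)" if j: "j < N" for j
    proof (intro exI conjI ballI)
      show "degree [:U (x j) $ i - x j * A j $ i, A j $ i:] \<le> 1" by simp
      show "uh t $ i = poly [:U (x j) $ i - x j * A j $ i, A j $ i:] t" if "t \<in> {x j..x (Suc j)}" for t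
        unfolding P(2)[OF j that] by (simp add: algebra_simps)
    qed
    then show ?thesis using C0 by (simp add: spline_def)
  qed
  show ?thesis
    by (intro exI[of _ uh] exI[of _ w] conjI allI impI sp wL2 P(1) P(3) uh_def)
qed

text \<open>Sobolev regularity gives classical differentiability of the continuous representatives
  up to the end points. Applied to y, y' and b of a frame in H^3 and H^2, it provides the smoothness
  that the spline constructions assume.\<close>

lemma Hsob_2_cont_rep_deriv:
  fixes f :: "real \<Rightarrow> 'a::euclidean_space"
  assumes L: "L > 0" and f: "f \<in> Hsob 2 L" and t: "t \<in> {0..L}"
  shows "(cont_rep L f has_vector_derivative cont_rep L (wderiv L f) t) (at t within {0..L})"
proof -
  let ?r = "cont_rep L (wderiv L f)"
  have f1: "f \<in> Hsob 1 L" and f': "wderiv L f \<in> Hsob 1 L" using f Hsob_2_iff Hsob_2_imp_1 by blast+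
  have c: "continuous_on {0..L} ?r" by (rule cont_rep_Hsob(1)[OF L f'])
  have eq: "cont_rep L f s = cont_rep L f 0 + integral {0..s} ?r" if s: "s \<in> {0..L}" for s
  proof -
    have i: "integrable (\<mu> s) (wderiv L f)" "integrable (\<mu> s) ?r"
    proof -
      have "wderiv L f \<in> L2 L" using f1 Hsob_1_iff by blast
      then show "integrable (\<mu> s) (wderiv L f)" using s by (intro integrable_interval_mono[OF L2_integrable]) auto
      show "integrable (\<mu> s) ?r" using s by (intro integrable_interval_mono[OF L2_integrable[OF continuous_L2[OF c]]]) auto
    qed
    have "AE x in \<mu> s. ?r x = wderiv L f x"
      using cont_rep_Hsob(2)[OF L f'] unfolding AE_interval_iff by eventually_elim (use s in auto)
    then have "(\<integral>x. ?r x \<partial>\<mu> s) = (\<integral>x. wderiv L f x \<partial>\<mu> s)"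
      using i by (intro integral_cong_AE) auto
    then have "integral {0..s} ?r = integral {0..s} (wderiv L f)"
      unfolding integral_interval[OF i(1)] integral_interval[OF i(2)] .
    then show ?thesis using cont_rep_Hsob(3)[OF L f1, of 0 s] s by (simp add: algebra_simps)
  qed
  have "((\<lambda>s. cont_rep L f 0 + integral {0..s} ?r) has_vector_derivative 0 + ?r t) (at t within {0..L})"
    by (intro has_vector_derivative_add has_vector_derivative_const integral_has_vector_derivative c t)
  then have "((\<lambda>s. cont_rep L f 0 + integral {0..s} ?r) has_vector_derivative ?r t) (at t within {0..L})" by simp
  then show ?thesis by (rule has_vector_derivative_transform[OF t eq, rotated])
qed

section \<open>The recovery sequence\<close>

lemma L2_norm_cong_AE:
  fixes f g :: "real \<Rightarrow> 'a::euclidean_space"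
  assumes "f \<in> borel_measurable (\<mu> L)" "g \<in> borel_measurable (\<mu> L)" "AE x in \<mu> L. f x = g x"
  shows "L2_norm L f = L2_norm L g"
proof -
  have "(\<integral>x. (norm (f x))\<^sup>2 \<partial>\<mu> L) = (\<integral>x. (norm (g x))\<^sup>2 \<partial>\<mu> L)"
    using assms by (intro integral_cong_AE) auto
  then show ?thesis by (simp add: L2_norm_def)
qed

text \<open>The parameter \<kappa> bounds the errors of y'' and b'. Lower order errors vanish at 0
  and are recovered by integration: each step costs sqrt L for the uniform bound and sqrt L again
  for the L^2 norm. The bounds on the penalties keep the norms of the discrete derivatives, which
  are estimated once the pair is compared with the limit.\<close>

lemma recovery_pair:
  fixes ys bs :: curve
  assumes L: "L > 0" and m: "mesh L N x" and ys: "ys \<in> Hsob 3 L" and bs: "bs \<in> Hsob 2 L"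
    and frame: "AE t in \<mu> L. norm (wderiv L ys t) = 1 \<and> norm (bs t) = 1 \<and> wderiv L ys t \<bullet> bs t = 0"
    and \<kappa>: "\<kappa> = mesh_size N x * frame_size L (ys, bs)"
  shows "\<exists>yh bh. (yh, bh) \<in> V_disc L N x \<and>
    (\<forall>j\<le>N. norm (vector_derivative yh (at (x j) within {0..L})) = 1 \<and> norm (bh (x j)) = 1) \<and>
    (\<forall>t\<in>{0, L}. cont_rep L ys t = cont_rep L yh t \<and> cont_rep L (wderiv L ys) t = cont_rep L (wderiv L yh) t \<and>
       cont_rep L bs t = cont_rep L bh t) \<and>
    L2_norm L (\<lambda>t. ys t - yh t) \<le> L * L * \<kappa> \<and>
    L2_norm L (\<lambda>t. wderiv L ys t - wderiv L yh t) \<le> L * \<kappa> \<and>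
    L2_norm L (\<lambda>t. wderiv L (wderiv L ys) t - wderiv L (wderiv L yh) t) \<le> \<kappa> \<and>
    L2_norm L (\<lambda>t. bs t - bh t) \<le> L * \<kappa> \<and>
    L2_norm L (\<lambda>t. wderiv L bs t - wderiv L bh t) \<le> \<kappa> \<and>
    (\<integral>t. (wderiv L yh t \<bullet> bh t)\<^sup>2 \<partial>\<mu> L) \<le> 2 * (mesh_size N x)\<^sup>2 *
      ((1 + sqrt L * \<kappa>)\<^sup>2 * (L2_norm L (wderiv L (wderiv L yh)))\<^sup>2 + (L2_norm L (wderiv L bh))\<^sup>2) \<and>
    L2_norm L (\<lambda>t. wderiv L yh t \<bullet> wderiv L bh t)
      \<le> L2_norm L (\<lambda>t. wderiv L ys t \<bullet> wderiv L bs t) + \<kappa> + sqrt L * \<kappa> * L2_norm L (wderiv L bh)"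
proof -
  let ?h = "mesh_size N x"
  define Y U W B S where "Y = cont_rep L ys" and "U = cont_rep L (wderiv L ys)" and "W = cont_rep L (wderiv L (wderiv L ys))"
    and "B = cont_rep L bs" and "S = cont_rep L (wderiv L bs)"
  let ?Z = "wderiv L (wderiv L (wderiv L ys))" and ?Z' = "wderiv L (wderiv L bs)"
  have N: "0 < N" and x0: "x 0 = 0" "x N = L" using m by (auto simp: mesh_def)
  have h: "?h > 0" by (rule mesh_size_ge(2)[OF m N])
  have y2: "wderiv L ys \<in> Hsob 2 L" and wy: "has_weak_deriv L ys (wderiv L ys)" and y0: "ys \<in> L2 L"
    using ys Hsob_3_iff by blast+
  have y3: "ys \<in> Hsob 2 L" using Hsob_2_I[OF y0 wy Hsob_2_imp_1[OF y2]] .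
  have H1: "ys \<in> Hsob 1 L" "wderiv L ys \<in> Hsob 1 L" "bs \<in> Hsob 1 L" using y2 y3 bs Hsob_2_imp_1 by blast+
  have H1': "wderiv L (wderiv L ys) \<in> Hsob 1 L" "wderiv L bs \<in> Hsob 1 L" using y2 bs Hsob_2_iff by blast+
  have Z: "?Z \<in> L2 L" "?Z' \<in> L2 L" using H1' Hsob_1_iff by blast+
  have ly: "wderiv L ys \<in> L2 L" "wderiv L (wderiv L ys) \<in> L2 L" "bs \<in> L2 L" "wderiv L bs \<in> L2 L"
    using H1 H1' Hsob_1_iff by blast+
  have cW: "continuous_on {0..L} W" "continuous_on {0..L} S" and cU: "continuous_on {0..L} U" "continuous_on {0..L} B" "continuous_on {0..L} Y"
    unfolding W_def S_def U_def B_def Y_def by (intro cont_rep_Hsob(1)[OF L] H1 H1')+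
  have dY: "(Y has_vector_derivative U t) (at t within {0..L})" "(U has_vector_derivative W t) (at t within {0..L})"
    "(B has_vector_derivative S t) (at t within {0..L})" if "t \<in> {0..L}" for t
    unfolding Y_def U_def W_def B_def S_def
    by (rule Hsob_2_cont_rep_deriv[OF L y3 that] Hsob_2_cont_rep_deriv[OF L y2 that] Hsob_2_cont_rep_deriv[OF L bs that])+
  have WZ: "W t - W s = integral {s..t} ?Z" "S t - S s = integral {s..t} ?Z'" if "0 \<le> s" "s \<le> t" "t \<le> L" for s t
    unfolding W_def S_def using cont_rep_Hsob(3)[OF L H1'(1) that] cont_rep_Hsob(3)[OF L H1'(2) that] by auto
  have nZ: "?h * L2_norm L ?Z \<le> \<kappa>" "?h * L2_norm L ?Z' \<le> \<kappa>"
  proof -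
    have "(wderiv L ^^ 3) ys = ?Z" "(wderiv L ^^ 2) bs = ?Z'" by (simp_all add: numeral_3_eq_3 numeral_2_eq_2)
    then have "L2_norm L ?Z \<le> Hsob_norm 3 L ys" "L2_norm L ?Z' \<le> Hsob_norm 2 L bs"
      using L2_norm_le_Hsob_norm[of 3 3 L ys] L2_norm_le_Hsob_norm[of 2 2 L bs] by auto
    then have "L2_norm L ?Z \<le> frame_size L (ys, bs)" "L2_norm L ?Z' \<le> frame_size L (ys, bs)"
      using Hsob_norm_nonneg[of 3 L ys] Hsob_norm_nonneg[of 2 L bs] unfolding frame_size_def prod.case by linarith+
    then show "?h * L2_norm L ?Z \<le> \<kappa>" "?h * L2_norm L ?Z' \<le> \<kappa>"
      unfolding \<kappa> using h by (auto intro!: mult_left_mono)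
  qed
  then have \<kappa>0: "0 \<le> \<kappa>" using h L2_norm_nonneg[of L ?Z] mult_nonneg_nonneg[of ?h "L2_norm L ?Z"] by linarith
  have "\<exists>yh uh w. (\<forall>i. (\<lambda>t. yh t $ i) \<in> spline 3 1 L N x) \<and>
    (\<forall>t\<in>{0..L}. (yh has_vector_derivative uh t) (at t within {0..L})) \<and>
    w \<in> L2 L \<and> (\<forall>t. 0 \<le> t \<longrightarrow> t \<le> L \<longrightarrow> uh t = U 0 + integral {0..t} w) \<and>
    (\<forall>j\<le>N. uh (x j) = U (x j)) \<and> (\<forall>j\<le>N. yh (x j) = Y (x j)) \<and>
    L2_norm L (\<lambda>t. W t - w t) \<le> ?h * L2_norm L ?Z"
    by (rule cubic_spline_approximation[OF L m cW(1) Z(1) dY(1) dY(2) WZ(1)])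
  then obtain yh uh w where *: "(\<forall>i. (\<lambda>t. yh t $ i) \<in> spline 3 1 L N x) \<and>
    (\<forall>t\<in>{0..L}. (yh has_vector_derivative uh t) (at t within {0..L})) \<and>
    w \<in> L2 L \<and> (\<forall>t. 0 \<le> t \<longrightarrow> t \<le> L \<longrightarrow> uh t = U 0 + integral {0..t} w) \<and>
    (\<forall>j\<le>N. uh (x j) = U (x j)) \<and> (\<forall>j\<le>N. yh (x j) = Y (x j)) \<and>
    L2_norm L (\<lambda>t. W t - w t) \<le> ?h * L2_norm L ?Z" by (elim exE)
  have sy: "(\<lambda>t. yh t $ i) \<in> spline 3 1 L N x" for i using * by simp
  have dyh: "(yh has_vector_derivative uh t) (at t within {0..L})" if "t \<in> {0..L}" for t using * that by blast
  have uh: "uh t = U 0 + integral {0..t} w" if "0 \<le> t" "t \<le> L" for t using * that by simp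
  have w: "w \<in> L2 L" using * by simp
  have nu: "uh (x j) = U (x j)" and ny: "yh (x j) = Y (x j)" if "j \<le> N" for j using * that by simp_all
  have ew: "L2_norm L (\<lambda>t. W t - w t) \<le> ?h * L2_norm L ?Z" using * by simp
  have "\<exists>bh v. (\<forall>i. (\<lambda>t. bh t $ i) \<in> spline 1 0 L N x) \<and>
    v \<in> L2 L \<and> (\<forall>t. 0 \<le> t \<longrightarrow> t \<le> L \<longrightarrow> bh t = B 0 + integral {0..t} v) \<and>
    (\<forall>j\<le>N. bh (x j) = B (x j)) \<and>
    L2_norm L (\<lambda>t. S t - v t) \<le> ?h * L2_norm L ?Z'"
    by (rule affine_spline_approximation[OF L m cW(2) Z(2) dY(3) WZ(2)])
  then obtain bh v where **: "(\<forall>i. (\<lambda>t. bh t $ i) \<in> spline 1 0 L N x) \<and>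
    v \<in> L2 L \<and> (\<forall>t. 0 \<le> t \<longrightarrow> t \<le> L \<longrightarrow> bh t = B 0 + integral {0..t} v) \<and>
    (\<forall>j\<le>N. bh (x j) = B (x j)) \<and>
    L2_norm L (\<lambda>t. S t - v t) \<le> ?h * L2_norm L ?Z'" by (elim exE)
  have sb: "(\<lambda>t. bh t $ i) \<in> spline 1 0 L N x" for i using ** by simp
  have v: "v \<in> L2 L" using ** by simp
  have bh: "bh t = B 0 + integral {0..t} v" if "0 \<le> t" "t \<le> L" for t using ** that by simp
  have nb: "bh (x j) = B (x j)" if "j \<le> N" for j using ** that by simp
  have ev: "L2_norm L (\<lambda>t. S t - v t) \<le> ?h * L2_norm L ?Z'" using ** by simp
  have disc: "(yh, bh) \<in> V_disc L N x" using sy sb by (simp add: V_disc_def)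
  have cuh: "continuous_on {0..L} uh" by (rule Hsob_1_constructor(1)[OF L w uh])
  have cbh: "continuous_on {0..L} bh" by (rule Hsob_1_constructor(1)[OF L v bh])
  have wyh: "has_weak_deriv L yh uh" by (rule C1_Hsob_1(2)[OF L cuh dyh])
  have aeU: "AE t in \<mu> L. wderiv L yh t = uh t" by (rule wderiv_spec(2)[OF wyh])
  have hw: "has_weak_deriv L uh w" by (rule Hsob_1_constructor(2)[OF L w uh])
  have aeV: "AE t in \<mu> L. wderiv L bh t = v t" by (rule Hsob_1_constructor(4)[OF L v bh])
  have VV: "(yh, bh) \<in> V L" by (rule V_disc_in_V(1)[OF L m disc])
  note VD = V_wderivs[OF VV]
  have muh: "uh \<in> borel_measurable (\<mu> L)" "w \<in> borel_measurable (\<mu> L)" "v \<in> borel_measurable (\<mu> L)" "bh \<in> borel_measurable (\<mu> L)" "yh \<in> borel_measurable (\<mu> L)"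
    using L2_measurable[OF continuous_L2[OF cuh]] L2_measurable[OF w] L2_measurable[OF v] L2_measurable[OF VD(4)] L2_measurable[OF VD(5)] by auto
  have mD: "wderiv L yh \<in> borel_measurable (\<mu> L)" "wderiv L (wderiv L yh) \<in> borel_measurable (\<mu> L)" "wderiv L bh \<in> borel_measurable (\<mu> L)"
    using VD(1-3) L2_measurable by blast+
  have mS: "ys \<in> borel_measurable (\<mu> L)" "wderiv L ys \<in> borel_measurable (\<mu> L)" "wderiv L (wderiv L ys) \<in> borel_measurable (\<mu> L)"
     "bs \<in> borel_measurable (\<mu> L)" "wderiv L bs \<in> borel_measurable (\<mu> L)"
    using y0 ly L2_measurable by blast+
  have mC: "Y \<in> borel_measurable (\<mu> L)" "U \<in> borel_measurable (\<mu> L)" "W \<in> borel_measurable (\<mu> L)" "B \<in> borel_measurable (\<mu> L)" "S \<in> borel_measurable (\<mu> L)"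
    using cW cU by (auto intro: L2_measurable continuous_L2)
  note [measurable] = muh mD mS mC
  have aeW: "AE t in \<mu> L. wderiv L (wderiv L yh) t = w t"
  proof -
    have "has_weak_deriv L (wderiv L yh) w"
      by (rule has_weak_deriv_cong[OF hw _ _ mD(1) muh(2)]) (use aeU in \<open>auto simp: eq_commute\<close>)
    then show ?thesis by (rule wderiv_spec(2))
  qed
  have aeS: "AE t in \<mu> L. Y t = ys t" "AE t in \<mu> L. U t = wderiv L ys t" "AE t in \<mu> L. W t = wderiv L (wderiv L ys) t"
    "AE t in \<mu> L. B t = bs t" "AE t in \<mu> L. S t = wderiv L bs t"
    unfolding Y_def U_def W_def B_def S_def by (intro cont_rep_Hsob(2)[OF L] H1 H1')+
  have inI: "AE t in \<mu> L. t \<in> {0..L}" by (rule AE_intervalI) auto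
  \<comment> \<open>The frame relations are known almost everywhere only; continuity extends them to
    all points, in particular to the nodes.\<close>
  have frame': "norm (U t) = 1 \<and> norm (B t) = 1 \<and> U t \<bullet> B t = 0" if t: "t \<in> {0..L}" for t
  proof -
    have "AE t in \<mu> L. norm (U t) = 1" "AE t in \<mu> L. norm (B t) = 1" "AE t in \<mu> L. U t \<bullet> B t = 0"
      using frame aeS(2) aeS(4) by (eventually_elim, simp)+
    moreover have c1: "continuous_on {0..L} (\<lambda>t. 1::real)" "continuous_on {0..L} (\<lambda>t. 0::real)" by (intro continuous_intros)+
    ultimately show ?thesis
      using continuous_AE_eq_imp_eq[OF L continuous_on_norm[OF cU(1)] c1(1) _ t]
        continuous_AE_eq_imp_eq[OF L continuous_on_norm[OF cU(2)] c1(1) _ t]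
        continuous_AE_eq_imp_eq[OF L continuous_on_inner[OF cU(1) cU(2)] c1(2) _ t] by blast
  qed
  have ew\<kappa>: "L2_norm L (\<lambda>t. W t - w t) \<le> \<kappa>" "L2_norm L (\<lambda>t. S t - v t) \<le> \<kappa>" using ew ev nZ by linarith+
  have LL: "sqrt L * sqrt L = L" using L by simp
  \<comment> \<open>Both functions start from the same value at 0, so their difference is the
    integral of the difference of the derivatives.\<close>
  have supbd: "norm (F t - f t) \<le> sqrt L * K"
    if F: "\<And>t. t \<in> {0..L} \<Longrightarrow> (F has_vector_derivative G t) (at t within {0..L})"
      and f: "\<And>t. 0 \<le> t \<Longrightarrow> t \<le> L \<Longrightarrow> f t = F 0 + integral {0..t} g" and G: "G \<in> L2 L" and g: "g \<in> L2 L"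
      and K: "L2_norm L (\<lambda>t. G t - g t) \<le> K" and t: "t \<in> {0..L}"
    for F f G g :: curve and K t
  proof -
    have d: "(\<lambda>t. G t - g t) \<in> L2 L" by (rule L2_diff[OF G g])
    have i: "G integrable_on {0..t}" "g integrable_on {0..t}"
      using integrable_interval_sub(2)[OF L2_integrable[OF G]] integrable_interval_sub(2)[OF L2_integrable[OF g]] t by auto
    have "F t - f t = integral {0..t} (\<lambda>t. G t - g t)"
      using C1_imp_primitive[OF F, of t] f[of t] t Henstock_Kurzweil_Integration.integral_diff[OF i] by simp
    then have "norm (F t - f t) \<le> sqrt (t - 0) * L2_norm L (\<lambda>t. G t - g t)"
      using norm_integral_le_L2_norm[OF d, of 0 t] t by simp
    also have "\<dots> \<le> sqrt L * K" using t K by (intro mult_mono) auto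
    finally show ?thesis .
  qed
  have supU: "norm (U t - uh t) \<le> sqrt L * \<kappa>" and supB: "norm (B t - bh t) \<le> sqrt L * \<kappa>" if "t \<in> {0..L}" for t
    using supbd[OF dY(2) uh continuous_L2[OF cW(1)] w ew\<kappa>(1) that] supbd[OF dY(3) bh continuous_L2[OF cW(2)] v ew\<kappa>(2) that] by auto
  have supL2: "L2_norm L (\<lambda>t. F t - f t) \<le> L * K"
    if "\<And>t. t \<in> {0..L} \<Longrightarrow> norm (F t - f t) \<le> sqrt L * K" "0 \<le> K" "F \<in> borel_measurable (\<mu> L)" "f \<in> borel_measurable (\<mu> L)" for F f :: curve and K
  proof -
    have "L2_norm L (\<lambda>t. F t - f t) \<le> sqrt L * (sqrt L * K)"
    proof (rule L2_bounded(2))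
      show "AE t in \<mu> L. norm (F t - f t) \<le> sqrt L * K" using inI by eventually_elim (rule that(1))
    qed (use L that in auto)
    then show ?thesis using LL by (simp add: mult.assoc[symmetric])
  qed
  have eU: "L2_norm L (\<lambda>t. U t - uh t) \<le> L * \<kappa>" by (rule supL2[OF supU \<kappa>0 mC(2) muh(1)])
  have yh: "yh t = Y 0 + integral {0..t} uh" if "0 \<le> t" "t \<le> L" for t
    using C1_imp_primitive[OF dyh that] ny[of 0] x0 by simp
  \<comment> \<open>The same pair of estimates once more, now with the L^2 error
    \<open>L * \<kappa>\<close> of the first derivative as input.\<close>
  have eY: "L2_norm L (\<lambda>t. Y t - yh t) \<le> L * (L * \<kappa>)"
    by (rule supL2[OF supbd[OF dY(1) yh continuous_L2[OF cU(1)] continuous_L2[OF cuh] eU]]) (use L \<kappa>0 mC muh in auto)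
  have eB: "L2_norm L (\<lambda>t. B t - bh t) \<le> L * \<kappa>" by (rule supL2[OF supB \<kappa>0 mC(4) muh(4)])
  have est: "L2_norm L (\<lambda>t. ys t - yh t) \<le> L * L * \<kappa>" "L2_norm L (\<lambda>t. wderiv L ys t - wderiv L yh t) \<le> L * \<kappa>"
    "L2_norm L (\<lambda>t. wderiv L (wderiv L ys) t - wderiv L (wderiv L yh) t) \<le> \<kappa>"
    "L2_norm L (\<lambda>t. bs t - bh t) \<le> L * \<kappa>" "L2_norm L (\<lambda>t. wderiv L bs t - wderiv L bh t) \<le> \<kappa>"
  proof -
    have "L2_norm L (\<lambda>t. ys t - yh t) = L2_norm L (\<lambda>t. Y t - yh t)"
      by (rule L2_norm_cong_AE, measurable) (use aeS(1) in \<open>eventually_elim, simp\<close>)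
    then show "L2_norm L (\<lambda>t. ys t - yh t) \<le> L * L * \<kappa>" using eY by simp
    have "L2_norm L (\<lambda>t. wderiv L ys t - wderiv L yh t) = L2_norm L (\<lambda>t. U t - uh t)"
      by (rule L2_norm_cong_AE, measurable) (use aeS(2) aeU in \<open>eventually_elim, simp\<close>)
    then show "L2_norm L (\<lambda>t. wderiv L ys t - wderiv L yh t) \<le> L * \<kappa>" using eU by simp
    have "L2_norm L (\<lambda>t. wderiv L (wderiv L ys) t - wderiv L (wderiv L yh) t) = L2_norm L (\<lambda>t. W t - w t)"
      by (rule L2_norm_cong_AE, measurable) (use aeS(3) aeW in \<open>eventually_elim, simp\<close>)
    then show "L2_norm L (\<lambda>t. wderiv L (wderiv L ys) t - wderiv L (wderiv L yh) t) \<le> \<kappa>" using ew\<kappa> by simp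
    have "L2_norm L (\<lambda>t. bs t - bh t) = L2_norm L (\<lambda>t. B t - bh t)"
      by (rule L2_norm_cong_AE, measurable) (use aeS(4) in \<open>eventually_elim, simp\<close>)
    then show "L2_norm L (\<lambda>t. bs t - bh t) \<le> L * \<kappa>" using eB by simp
    have "L2_norm L (\<lambda>t. wderiv L bs t - wderiv L bh t) = L2_norm L (\<lambda>t. S t - v t)"
      by (rule L2_norm_cong_AE, measurable) (use aeS(5) aeV in \<open>eventually_elim, simp\<close>)
    then show "L2_norm L (\<lambda>t. wderiv L bs t - wderiv L bh t) \<le> \<kappa>" using ew\<kappa> by simp
  qed
  have nwv: "L2_norm L (wderiv L (wderiv L yh)) = L2_norm L w" "L2_norm L (wderiv L bh) = L2_norm L v"
    by (rule L2_norm_cong_AE[OF mD(2) muh(2) aeW], rule L2_norm_cong_AE[OF mD(3) muh(3) aeV])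

  have nodes: "norm (vector_derivative yh (at (x j) within {0..L})) = 1 \<and> norm (bh (x j)) = 1" if "j \<le> N" for j
  proof -
    have xj: "x j \<in> {0..L}" by (rule mesh_node_range[OF m that])
    have "vector_derivative yh (at (x j) within {0..L}) = U (x j)"
      using vector_derivative_within_closed_interval[OF L xj dyh[OF xj]] nu[OF that] by simp
    then show ?thesis using frame'[OF xj] nb[OF that] by simp
  qed
  have bdry: "cont_rep L ys t = cont_rep L yh t \<and> cont_rep L (wderiv L ys) t = cont_rep L (wderiv L yh) t \<and>
       cont_rep L bs t = cont_rep L bh t" if tb: "t \<in> {0, L}" for t
  proof -
    have "t = x 0 \<or> t = x N" using tb x0 by auto
    then obtain j where j: "j \<le> N" "t = x j" by (metis le0 order_refl)
    have t: "t \<in> {0..L}" using mesh_node_range[OF m j(1)] j(2) by simp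
    have "cont_rep L yh t = yh t" by (rule C1_Hsob_1(3)[OF L cuh dyh t])
    moreover have "cont_rep L (wderiv L yh) t = uh t" by (rule C1_Hsob_1(4)[OF L cuh dyh t])
    ultimately show ?thesis
      using V_disc_in_V(3)[OF L m disc t] ny[OF j(1)] nu[OF j(1)] nb[OF j(1)] j(2)
      by (simp add: Y_def U_def B_def)
  qed

  have Jeq: "(\<integral>t. (wderiv L yh t \<bullet> bh t)\<^sup>2 \<partial>\<mu> L) = (\<integral>t. (uh t \<bullet> bh t)\<^sup>2 \<partial>\<mu> L)"
    by (rule integral_cong_AE, measurable) (use aeU in \<open>eventually_elim, simp\<close>)
  have cf: "continuous_on {0..L} (\<lambda>t. (uh t \<bullet> bh t)\<^sup>2)" by (intro continuous_intros cuh cbh)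
  \<comment> \<open>A uniform bound for the discrete director: unit length of the exact one plus the
    uniform interpolation error.\<close>
  define \<beta> where "\<beta> = 1 + sqrt L * \<kappa>"
  have iw: "(\<lambda>t. (norm (w t))\<^sup>2) integrable_on {0..L}" and iv: "(\<lambda>t. (norm (v t))\<^sup>2) integrable_on {0..L}"
    using integrable_interval_sub(2)[OF L2_square_integrable[OF w]] integrable_interval_sub(2)[OF L2_square_integrable[OF v]] by auto
  have "(\<integral>t. (uh t \<bullet> bh t)\<^sup>2 \<partial>\<mu> L) = integral {0..L} (\<lambda>t. (uh t \<bullet> bh t)\<^sup>2)"
    by (rule integral_interval[OF continuous_integrable_interval[OF cf]])
  also have "\<dots> = (\<Sum>j<N. integral {x j..x (Suc j)} (\<lambda>t. (uh t \<bullet> bh t)\<^sup>2))"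
    by (rule integral_mesh_sum[OF m integrable_continuous_real[OF cf]])
  also have "\<dots> \<le> (\<Sum>j<N. 2 * ?h\<^sup>2 * (\<beta>\<^sup>2 * integral {x j..x (Suc j)} (\<lambda>t. (norm (w t))\<^sup>2) + integral {x j..x (Suc j)} (\<lambda>t. (norm (v t))\<^sup>2)))"
  proof (rule sum_mono)
    fix j assume "j \<in> {..<N}"
    then have j: "j < N" by simp
    let ?a = "x j" and ?b = "x (Suc j)"
    have el: "0 \<le> ?a" "?b \<le> L" "?a < ?b" "?a \<in> {0..L}"
      using mesh_node_range[OF m, of j] mesh_node_range[OF m, of "Suc j"] m j by (auto simp: mesh_def)
    let ?w = "integral {?a..?b} (\<lambda>t. (norm (w t))\<^sup>2)" and ?v = "integral {?a..?b} (\<lambda>t. (norm (v t))\<^sup>2)"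
    have w0: "0 \<le> ?w" "0 \<le> ?v"
      using el by (auto intro!: integral_nonneg integrable_subinterval_real[OF iw] integrable_subinterval_real[OF iv])
    have lh: "?b - ?a \<le> ?h" by (rule mesh_size_ge(1)[OF m j])
    have prim: "f t - f s = integral {s..t} g" if "\<And>t. 0 \<le> t \<Longrightarrow> t \<le> L \<Longrightarrow> f t = c + integral {0..t} g" "g \<in> L2 L" "0 \<le> s" "s \<le> t" "t \<le> L"
      for f g :: curve and c s t
      using primitive_diff[OF L2_integrable[OF that(2)] that(3-5)] that(1)[of t] that(1)[of s] that(3-5) by simp
    have pt: "(uh t \<bullet> bh t)\<^sup>2 \<le> 2 * (?b - ?a) * (\<beta>\<^sup>2 * ?w + ?v)" if t: "t \<in> {?a..?b}" for t
    proof -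
      have tL: "t \<in> {0..L}" using t el by auto
      have A: "(norm (uh t - uh ?a))\<^sup>2 \<le> (?b - ?a) * ?w"
        by (rule element_oscillation[OF w prim[OF uh w] el(1,2) t])
      have C: "(norm (bh t - bh ?a))\<^sup>2 \<le> (?b - ?a) * ?v"
        by (rule element_oscillation[OF v prim[OF bh v] el(1,2) t])
      have nbh: "norm (bh t) \<le> \<beta>"
        using supB[OF tL] norm_triangle_sub[of "bh t" "B t"] frame'[OF tL] by (simp add: \<beta>_def norm_minus_commute)
      have n1: "norm (uh ?a) = 1" "uh ?a \<bullet> bh ?a = 0"
        using nu[of j] nb[of j] frame'[OF el(4)] j by auto
      \<comment> \<open>The product vanishes at the left node of the element, where the discrete
        pair equals the frame, so only the oscillations of the two factors over one element
        remain.\<close>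
      have "uh t \<bullet> bh t = (uh t - uh ?a) \<bullet> bh t + uh ?a \<bullet> (bh t - bh ?a)"
        using n1(2) by (simp add: inner_diff_left inner_diff_right)
      also have "\<bar>\<dots>\<bar> \<le> norm (uh t - uh ?a) * norm (bh t) + norm (uh ?a) * norm (bh t - bh ?a)"
        by (intro order_trans[OF abs_triangle_ineq] add_mono Cauchy_Schwarz_ineq2)
      also have "\<dots> \<le> norm (uh t - uh ?a) * \<beta> + norm (bh t - bh ?a)"
        using nbh n1(1) by (simp add: mult_left_mono)
      finally have "\<bar>uh t \<bullet> bh t\<bar>\<^sup>2 \<le> (norm (uh t - uh ?a) * \<beta> + norm (bh t - bh ?a))\<^sup>2" by (intro power_mono) auto
      also have "\<dots> \<le> 2 * (norm (uh t - uh ?a) * \<beta>)\<^sup>2 + 2 * (norm (bh t - bh ?a))\<^sup>2"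
        using zero_le_power2[of "norm (uh t - uh ?a) * \<beta> - norm (bh t - bh ?a)"] by (simp add: power2_sum power2_diff)
      also have "\<dots> \<le> 2 * ((?b - ?a) * ?w * \<beta>\<^sup>2) + 2 * ((?b - ?a) * ?v)"
        unfolding power_mult_distrib using A C by (intro add_mono mult_left_mono mult_right_mono) auto
      finally show ?thesis by (simp add: algebra_simps)
    qed
    have "integral {?a..?b} (\<lambda>t. (uh t \<bullet> bh t)\<^sup>2) \<le> integral {?a..?b} (\<lambda>t. 2 * (?b - ?a) * (\<beta>\<^sup>2 * ?w + ?v))"
    proof (rule integral_le)
      show "(\<lambda>t. (uh t \<bullet> bh t)\<^sup>2) integrable_on {?a..?b}"
        using el by (intro integrable_continuous_real continuous_on_subset[OF cf]) auto
      show "(\<lambda>t. 2 * (?b - ?a) * (\<beta>\<^sup>2 * ?w + ?v)) integrable_on {?a..?b}" by (intro integrable_continuous_real continuous_intros)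
    qed (rule pt)
    also have "\<dots> = 2 * (?b - ?a)\<^sup>2 * (\<beta>\<^sup>2 * ?w + ?v)" using el by (simp add: power2_eq_square)
    also have "\<dots> \<le> 2 * ?h\<^sup>2 * (\<beta>\<^sup>2 * ?w + ?v)"
      using lh el w0 by (intro mult_right_mono mult_left_mono power_mono) auto
    finally show "integral {?a..?b} (\<lambda>t. (uh t \<bullet> bh t)\<^sup>2) \<le> 2 * ?h\<^sup>2 * (\<beta>\<^sup>2 * ?w + ?v)" .
  qed
  also have "\<dots> = 2 * ?h\<^sup>2 * (\<beta>\<^sup>2 * integral {0..L} (\<lambda>t. (norm (w t))\<^sup>2) + integral {0..L} (\<lambda>t. (norm (v t))\<^sup>2))"
    unfolding integral_mesh_sum[OF m iw] integral_mesh_sum[OF m iv] by (simp only: sum_distrib_left[symmetric] sum.distrib)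
  also have "\<dots> = 2 * ?h\<^sup>2 * (\<beta>\<^sup>2 * (L2_norm L w)\<^sup>2 + (L2_norm L v)\<^sup>2)"
    unfolding L2_norm_power2 integral_interval[OF L2_square_integrable[OF w]] integral_interval[OF L2_square_integrable[OF v]] ..
  finally have J: "(\<integral>t. (wderiv L yh t \<bullet> bh t)\<^sup>2 \<partial>\<mu> L) \<le> 2 * ?h\<^sup>2 * ((1 + sqrt L * \<kappa>)\<^sup>2 * (L2_norm L w)\<^sup>2 + (L2_norm L v)\<^sup>2)"
    unfolding Jeq \<beta>_def .

  have bdd: "(\<lambda>t. a t \<bullet> c t) \<in> L2 L" "L2_norm L (\<lambda>t. a t \<bullet> c t) \<le> k * L2_norm L c"
    if "\<And>t. t \<in> {0..L} \<Longrightarrow> norm (a t) \<le> k" "0 \<le> k" "a \<in> borel_measurable (\<mu> L)" "c \<in> L2 L" for a c :: curve and k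
  proof -
    have mm: "(\<lambda>t. a t \<bullet> c t) \<in> borel_measurable (\<mu> L)"
      using that(3) L2_measurable[OF that(4)] by (intro borel_measurable_inner)
    have "AE t in \<mu> L. norm (a t \<bullet> c t) \<le> norm (k *\<^sub>R c t)"
      using inI
    proof eventually_elim
      case (elim t)
      have "\<bar>a t \<bullet> c t\<bar> \<le> norm (a t) * norm (c t)" by (rule Cauchy_Schwarz_ineq2)
      also have "\<dots> \<le> k * norm (c t)" by (intro mult_right_mono that(1)[OF elim]) auto
      finally show ?case using that(2) by simp
    qed
    note LE = L2_AE_le[OF L2_scale[OF that(4), of k] mm this]
    show "(\<lambda>t. a t \<bullet> c t) \<in> L2 L" by (rule LE(1))
    show "L2_norm L (\<lambda>t. a t \<bullet> c t) \<le> k * L2_norm L c"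
      using LE(2) that(2) L2_norm_scale[of L k c] by simp
  qed
  have cV: "S \<in> L2 L" by (rule continuous_L2[OF cW(2)])
  have d1: "(\<lambda>t. v t - S t) \<in> L2 L" by (rule L2_diff[OF v cV])
  have k1: "norm (U t) \<le> 1" if "t \<in> {0..L}" for t using frame'[OF that] by simp
  have k2: "norm (uh t - U t) \<le> sqrt L * \<kappa>" if "t \<in> {0..L}" for t using supU[OF that] by (simp add: norm_minus_commute)
  have p1: "(\<lambda>t. U t \<bullet> S t) \<in> L2 L" by (rule bdd(1)[OF k1 _ mC(2) cV]) auto
  have p2: "(\<lambda>t. U t \<bullet> (v t - S t)) \<in> L2 L" "L2_norm L (\<lambda>t. U t \<bullet> (v t - S t)) \<le> 1 * L2_norm L (\<lambda>t. v t - S t)"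
    by (rule bdd[OF k1 _ mC(2) d1]; simp)+
  have p3: "(\<lambda>t. (uh t - U t) \<bullet> v t) \<in> L2 L" "L2_norm L (\<lambda>t. (uh t - U t) \<bullet> v t) \<le> sqrt L * \<kappa> * L2_norm L v"
    by (rule bdd[OF k2 _ _ v]; (use L \<kappa>0 in simp | measurable)?)+
  \<comment> \<open>Three contributions: the defect of the smooth frame itself, the error of b'
    against the unit field y', and the uniform error of y' against the discrete b'.\<close>
  have "L2_norm L (\<lambda>t. wderiv L yh t \<bullet> wderiv L bh t) = L2_norm L (\<lambda>t. (U t \<bullet> S t + U t \<bullet> (v t - S t)) + (uh t - U t) \<bullet> v t)"
    by (rule L2_norm_cong_AE, measurable)
      (use aeU aeV in \<open>eventually_elim, simp add: inner_diff_left inner_diff_right\<close>)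
  also have "\<dots> \<le> (L2_norm L (\<lambda>t. U t \<bullet> S t) + L2_norm L (\<lambda>t. U t \<bullet> (v t - S t))) + L2_norm L (\<lambda>t. (uh t - U t) \<bullet> v t)"
    by (intro order_trans[OF L2_norm_triangle] add_right_mono L2_norm_triangle L2_add p1 p2 p3)
  also have "\<dots> \<le> (L2_norm L (\<lambda>t. U t \<bullet> S t) + \<kappa>) + sqrt L * \<kappa> * L2_norm L v"
    using p2(2) p3(2) ew\<kappa>(2) L2_norm_diff_le(3)[OF v cV] by linarith
  also have "L2_norm L (\<lambda>t. U t \<bullet> S t) = L2_norm L (\<lambda>t. wderiv L ys t \<bullet> wderiv L bs t)"
    by (rule L2_norm_cong_AE, measurable) (use aeS(2,5) in \<open>eventually_elim, simp\<close>)
  finally have K: "L2_norm L (\<lambda>t. wderiv L yh t \<bullet> wderiv L bh t)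
      \<le> L2_norm L (\<lambda>t. wderiv L ys t \<bullet> wderiv L bs t) + \<kappa> + sqrt L * \<kappa> * L2_norm L v" .
  show ?thesis
    by (intro exI[of _ yh] exI[of _ bh] conjI allI impI ballI disc nodes bdry est J[folded nwv] K[folded nwv]
       conjunct1[OF nodes] conjunct2[OF nodes] conjunct1[OF bdry] conjunct1[OF conjunct2[OF bdry]] conjunct2[OF conjunct2[OF bdry]])
qed

section \<open>Convergence of the recovered pairs and of their energies\<close>

lemma L2_norm_wderiv_diff:
  fixes f g :: "real \<Rightarrow> 'a::euclidean_space"
  assumes "f \<in> Hsob 1 L" "g \<in> Hsob 1 L"
  shows "AE x in \<mu> L. wderiv L (\<lambda>x. f x - g x) x = wderiv L f x - wderiv L g x"
    "L2_norm L (wderiv L (\<lambda>x. f x - g x)) = L2_norm L (\<lambda>x. wderiv L f x - wderiv L g x)"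
proof -
  have w: "has_weak_deriv L f (wderiv L f)" "has_weak_deriv L g (wderiv L g)"
    and m: "wderiv L f \<in> L2 L" "wderiv L g \<in> L2 L" using assms Hsob_1_iff by blast+
  show *: "AE x in \<mu> L. wderiv L (\<lambda>x. f x - g x) x = wderiv L f x - wderiv L g x"
    using wderiv_lin[OF w, of 1 "-1"] by simp
  have "wderiv L (\<lambda>x. f x - g x) \<in> L2 L" using Hsob_diff[OF assms] Hsob_1_iff by blast
  then show "L2_norm L (wderiv L (\<lambda>x. f x - g x)) = L2_norm L (\<lambda>x. wderiv L f x - wderiv L g x)"
    by (rule L2_norm_cong_AE[OF L2_measurable L2_measurable[OF L2_diff[OF m]] *])
qed

lemma L2_norm_wderiv_diff2:
  fixes f g :: "real \<Rightarrow> 'a::euclidean_space"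
  assumes "f \<in> Hsob 2 L" "g \<in> Hsob 2 L"
  shows "L2_norm L (wderiv L (wderiv L (\<lambda>x. f x - g x))) = L2_norm L (\<lambda>x. wderiv L (wderiv L f) x - wderiv L (wderiv L g) x)"
proof -
  have H: "f \<in> Hsob 1 L" "g \<in> Hsob 1 L" "wderiv L f \<in> Hsob 1 L" "wderiv L g \<in> Hsob 1 L"
    using assms Hsob_2_iff Hsob_2_imp_1 by blast+
  have D: "wderiv L (\<lambda>x. f x - g x) \<in> Hsob 1 L" using Hsob_diff[OF assms] Hsob_2_iff by blast
  have E: "(\<lambda>x. wderiv L f x - wderiv L g x) \<in> Hsob 1 L" by (rule Hsob_diff[OF H(3,4)])
  have "AE x in \<mu> L. wderiv L (wderiv L (\<lambda>x. f x - g x)) x = wderiv L (\<lambda>x. wderiv L f x - wderiv L g x) x"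
  proof (rule wderiv_cong_AE)
    show "has_weak_deriv L (wderiv L (\<lambda>x. f x - g x)) (wderiv L (wderiv L (\<lambda>x. f x - g x)))"
      using D Hsob_1_iff by blast
    show "AE x in \<mu> L. wderiv L (\<lambda>x. f x - g x) x = wderiv L f x - wderiv L g x"
      by (rule L2_norm_wderiv_diff(1)[OF H(1,2)])
    show "(\<lambda>x. wderiv L f x - wderiv L g x) \<in> borel_measurable (\<mu> L)"
      using E Hsob_1_iff L2_measurable by blast
  qed
  moreover have "wderiv L (wderiv L (\<lambda>x. f x - g x)) \<in> L2 L" "wderiv L (\<lambda>x. wderiv L f x - wderiv L g x) \<in> L2 L"
    using D E Hsob_1_iff by blast+
  ultimately have "L2_norm L (wderiv L (wderiv L (\<lambda>x. f x - g x))) = L2_norm L (wderiv L (\<lambda>x. wderiv L f x - wderiv L g x))"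
    by (intro L2_norm_cong_AE L2_measurable)
  then show ?thesis using L2_norm_wderiv_diff(2)[OF H(3,4)] by simp
qed

text \<open>Since \<open>Qbar\<close> is Lipschitz in the squares, it suffices that | |f|^2 - |g|^2
  | is at most |f - g| (|f| + |g|), followed by Cauchy-Schwarz.\<close>

lemma energy_difference:
  fixes y b y' b' :: curve
  assumes V: "(y, b) \<in> V L" "(y', b') \<in> V L"
  defines "A \<equiv> wderiv L (wderiv L y)" and "A' \<equiv> wderiv L (wderiv L y')" and "B \<equiv> wderiv L b" and "B' \<equiv> wderiv L b'"
  shows "\<bar>energy L (y, b) - energy L (y', b')\<bar> \<le>
    L2_norm L (\<lambda>t. A t - A' t) * (L2_norm L A + L2_norm L A') + 4 * (L2_norm L (\<lambda>t. B t - B' t) * (L2_norm L B + L2_norm L B'))"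
proof -
  have A: "A \<in> L2 L" "A' \<in> L2 L" "B \<in> L2 L" "B' \<in> L2 L"
    unfolding A_def A'_def B_def B'_def using V_wderivs[OF V(1)] V_wderivs[OF V(2)] by auto
  have sq: "integrable (\<mu> L) (\<lambda>t. \<bar>(norm (f t))\<^sup>2 - (norm (g t))\<^sup>2\<bar>)"
    "(\<integral>t. \<bar>(norm (f t))\<^sup>2 - (norm (g t))\<^sup>2\<bar> \<partial>\<mu> L) \<le> L2_norm L (\<lambda>t. f t - g t) * (L2_norm L f + L2_norm L g)"
    if f: "f \<in> L2 L" and g: "g \<in> L2 L" for f g :: curve
  proof -
    have d: "(\<lambda>t. f t - g t) \<in> L2 L" by (rule L2_diff[OF f g])
    show i: "integrable (\<mu> L) (\<lambda>t. \<bar>(norm (f t))\<^sup>2 - (norm (g t))\<^sup>2\<bar>)"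
      by (intro integrable_abs Bochner_Integration.integrable_diff L2_square_integrable f g)
    note i1 = L2_norm_mult[OF d f] and i2 = L2_norm_mult[OF d g]
    have "(\<integral>t. \<bar>(norm (f t))\<^sup>2 - (norm (g t))\<^sup>2\<bar> \<partial>\<mu> L) \<le> (\<integral>t. norm (f t - g t) * norm (f t) + norm (f t - g t) * norm (g t) \<partial>\<mu> L)"
    proof (rule integral_mono)
      show "integrable (\<mu> L) (\<lambda>t. norm (f t - g t) * norm (f t) + norm (f t - g t) * norm (g t))"
        by (rule Bochner_Integration.integrable_add[OF i1(1) i2(1)])
      fix t
      have "\<bar>(norm (f t))\<^sup>2 - (norm (g t))\<^sup>2\<bar> = \<bar>norm (f t) - norm (g t)\<bar> * (norm (f t) + norm (g t))"
        by (simp add: power2_eq_square square_diff_square_factored abs_mult mult.commute)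
      also have "\<dots> \<le> norm (f t - g t) * (norm (f t) + norm (g t))"
        by (intro mult_right_mono norm_triangle_ineq3) simp
      finally show "\<bar>(norm (f t))\<^sup>2 - (norm (g t))\<^sup>2\<bar> \<le> norm (f t - g t) * norm (f t) + norm (f t - g t) * norm (g t)"
        by (simp add: distrib_left)
    qed (rule i)
    also have "\<dots> = (\<integral>t. norm (f t - g t) * norm (f t) \<partial>\<mu> L) + (\<integral>t. norm (f t - g t) * norm (g t) \<partial>\<mu> L)"
      by (rule Bochner_Integration.integral_add[OF i1(1) i2(1)])
    also have "\<dots> \<le> L2_norm L (\<lambda>t. f t - g t) * (L2_norm L f + L2_norm L g)"
      using i1(2) i2(2) by (simp add: distrib_left)
    finally show "(\<integral>t. \<bar>(norm (f t))\<^sup>2 - (norm (g t))\<^sup>2\<bar> \<partial>\<mu> L) \<le> L2_norm L (\<lambda>t. f t - g t) * (L2_norm L f + L2_norm L g)" .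
  qed
  let ?Q = "\<lambda>t. Qbar (norm (A t)) (norm (B t))" and ?Q' = "\<lambda>t. Qbar (norm (A' t)) (norm (B' t))"
  note iQ = Qbar_integrable[OF A(1,3)] and iQ' = Qbar_integrable[OF A(2,4)]
  have "energy L (y, b) - energy L (y', b') = (\<integral>t. ?Q t - ?Q' t \<partial>\<mu> L)"
    unfolding energy_def prod.case A_def[symmetric] A'_def[symmetric] B_def[symmetric] B'_def[symmetric]
    by (rule Bochner_Integration.integral_diff[OF iQ iQ', symmetric])
  also have "\<bar>\<dots>\<bar> \<le> (\<integral>t. \<bar>(norm (A t))\<^sup>2 - (norm (A' t))\<^sup>2\<bar> + 4 * \<bar>(norm (B t))\<^sup>2 - (norm (B' t))\<^sup>2\<bar> \<partial>\<mu> L)"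
    unfolding real_norm_def[symmetric]
  proof (rule Bochner_Integration.integral_norm_bound_integral)
    show "integrable (\<mu> L) (\<lambda>t. ?Q t - ?Q' t)" by (rule Bochner_Integration.integrable_diff[OF iQ iQ'])
    show "integrable (\<mu> L) (\<lambda>t. norm ((norm (A t))\<^sup>2 - (norm (A' t))\<^sup>2) + 4 * norm ((norm (B t))\<^sup>2 - (norm (B' t))\<^sup>2))"
      unfolding real_norm_def
      by (intro Bochner_Integration.integrable_add integrable_mult_right sq(1) A)
    show "norm (?Q t - ?Q' t) \<le> norm ((norm (A t))\<^sup>2 - (norm (A' t))\<^sup>2) + 4 * norm ((norm (B t))\<^sup>2 - (norm (B' t))\<^sup>2)" for t
      unfolding real_norm_def by (rule Qbar_Lipschitz)
  qed
  also have "\<dots> = (\<integral>t. \<bar>(norm (A t))\<^sup>2 - (norm (A' t))\<^sup>2\<bar> \<partial>\<mu> L) + 4 * (\<integral>t. \<bar>(norm (B t))\<^sup>2 - (norm (B' t))\<^sup>2\<bar> \<partial>\<mu> L)"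
    using sq(1)[OF A(1,2)] sq(1)[OF A(3,4)] by simp
  also have "\<dots> \<le> L2_norm L (\<lambda>t. A t - A' t) * (L2_norm L A + L2_norm L A') + 4 * (L2_norm L (\<lambda>t. B t - B' t) * (L2_norm L B + L2_norm L B'))"
    using sq(2)[OF A(1,2)] sq(2)[OF A(3,4)] by linarith
  finally show ?thesis .
qed

lemma tendsto_zero_by_bound:
  fixes f g :: "nat \<Rightarrow> real"
  assumes "\<And>n. 0 \<le> f n" "\<And>n. f n \<le> g n" "g \<longlonglongrightarrow> 0"
  shows "f \<longlonglongrightarrow> 0"
  by (rule tendsto_sandwich[OF always_eventually always_eventually tendsto_const assms(3)]) (simp_all add: assms(1,2))

lemma tendsto_zero_summands:
  fixes a b c :: "nat \<Rightarrow> real"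
  assumes "(\<lambda>n. a n + b n + c n) \<longlonglongrightarrow> 0" "\<And>n. 0 \<le> a n" "\<And>n. 0 \<le> b n" "\<And>n. 0 \<le> c n"
  shows "a \<longlonglongrightarrow> 0" "b \<longlonglongrightarrow> 0" "c \<longlonglongrightarrow> 0"
proof -
  have le: "a n \<le> a n + b n + c n" "b n \<le> a n + b n + c n" "c n \<le> a n + b n + c n" for n
    using assms(2)[of n] assms(3)[of n] assms(4)[of n] by linarith+
  show "a \<longlonglongrightarrow> 0" by (rule tendsto_zero_by_bound[OF assms(2) le(1) assms(1)])
  show "b \<longlonglongrightarrow> 0" by (rule tendsto_zero_by_bound[OF assms(3) le(2) assms(1)])
  show "c \<longlonglongrightarrow> 0" by (rule tendsto_zero_by_bound[OF assms(4) le(3) assms(1)])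
qed

text \<open>The three summands of the coupling condition have separate tasks: h^2 / \<epsilon>1
  removes the first penalty, \<sigma>^2 / \<epsilon>2 the defect of the smooth frame in the second
  one, and \<kappa>^2 / \<epsilon>2 its interpolation error. Boundary data are preserved exactly
  because 0 and L are nodes.\<close>

lemma recovery_sequence:
  fixes Lbc :: "curve \<times> curve \<Rightarrow> 'z::real_normed_vector" and \<epsilon>1 \<epsilon>2 \<delta> \<sigma> :: "nat \<Rightarrow> real"
  assumes L: "L > 0" and dep: "depends_on_boundary_values L Lbc"
    and c0: "c0 > 0" and rm: "regularized_modulus m c0 c1 c2 cuni"
    and mesh: "\<And>n. mesh L (N n) (x n)" and h: "\<And>n. h n = mesh_size (N n) (x n)"
    and \<epsilon>: "\<And>n. \<epsilon>1 n > 0" "\<And>n. \<epsilon>2 n > 0" "\<epsilon>2 \<longlonglongrightarrow> 0" and \<delta>: "\<And>n. \<delta> n > 0" "\<delta> \<longlonglongrightarrow> 0"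
    and yb: "(y, b) \<in> V L" and \<sigma>: "\<sigma> \<longlonglongrightarrow> 0"
    and sf: "\<And>n. smooth_frame_approx L Lbc lbc (\<sigma> n) (y, b) (ys n, bs n)"
    and lim: "(\<lambda>n. (h n)\<^sup>2 / \<epsilon>1 n + (\<sigma> n)\<^sup>2 / \<epsilon>2 n + (h n)\<^sup>2 * (frame_size L (ys n, bs n))\<^sup>2 / \<epsilon>2 n) \<longlonglongrightarrow> 0"
  shows "\<exists>yh bh. (\<forall>n. (yh n, bh n) \<in> disc_admissible L Lbc lbc (N n) (x n)) \<and>
    (\<lambda>n. Hsob_norm 2 L (\<lambda>t. yh n t - y t)) \<longlonglongrightarrow> 0 \<and>
    (\<lambda>n. Hsob_norm 1 L (\<lambda>t. bh n t - b t)) \<longlonglongrightarrow> 0 \<and>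
    (\<lambda>n. energy_disc L (m (\<delta> n)) (\<epsilon>1 n) (\<epsilon>2 n) (yh n, bh n)) \<longlonglongrightarrow> energy L (y, b)"
proof -
  define \<kappa> where "\<kappa> n = h n * frame_size L (ys n, bs n)" for n
  have SF: "ys n \<in> Hsob 3 L" "bs n \<in> Hsob 2 L" "(ys n, bs n) \<in> A_frame L Lbc lbc"
    "Hsob_norm 2 L (\<lambda>t. y t - ys n t) + Hsob_norm 1 L (\<lambda>t. b t - bs n t) +
       L2_norm L (\<lambda>t. wderiv L (ys n) t \<bullet> wderiv L (bs n) t) \<le> \<sigma> n" for n
    using sf[of n] by (simp_all add: smooth_frame_approx_def)
  have SFV: "(ys n, bs n) \<in> V L" and SFL: "Lbc (ys n, bs n) = lbc"
    and SFR: "AE t in \<mu> L. rotation_matrix (transpose (vector [wderiv L (ys n) t, bs n t, cross3 (wderiv L (ys n) t) (bs n t)] :: real ^ 3 ^ 3))" for n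
    using SF(3)[of n] by (auto simp: A_frame_def)
  have frame: "AE t in \<mu> L. norm (wderiv L (ys n) t) = 1 \<and> norm (bs n t) = 1 \<and> wderiv L (ys n) t \<bullet> bs n t = 0" for n
    using SFR[of n] by eventually_elim (use rotation_frame_orthonormal in blast)
  have fs0: "0 \<le> frame_size L (ys n, bs n)" for n by (simp add: frame_size_def)
  have h0: "0 < h n" for n
    unfolding h using mesh_size_ge(2)[OF mesh[of n], of 0] mesh[of n] by (simp add: mesh_def)
  have \<kappa>0: "0 \<le> \<kappa> n" for n using fs0[of n] h0[of n] by (simp add: \<kappa>_def)
  have T: "(\<lambda>n. (h n)\<^sup>2 / \<epsilon>1 n) \<longlonglongrightarrow> 0" "(\<lambda>n. (\<sigma> n)\<^sup>2 / \<epsilon>2 n) \<longlonglongrightarrow> 0" "(\<lambda>n. (\<kappa> n)\<^sup>2 / \<epsilon>2 n) \<longlonglongrightarrow> 0"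
  proof -
    have "(\<lambda>n. (h n)\<^sup>2 / \<epsilon>1 n + (\<sigma> n)\<^sup>2 / \<epsilon>2 n + (\<kappa> n)\<^sup>2 / \<epsilon>2 n) \<longlonglongrightarrow> 0"
      using lim by (simp add: \<kappa>_def power_mult_distrib)
    moreover have "0 \<le> (h n)\<^sup>2 / \<epsilon>1 n" "0 \<le> (\<sigma> n)\<^sup>2 / \<epsilon>2 n" "0 \<le> (\<kappa> n)\<^sup>2 / \<epsilon>2 n" for n
      using \<epsilon>(1)[of n] \<epsilon>(2)[of n] by simp_all
    ultimately show "(\<lambda>n. (h n)\<^sup>2 / \<epsilon>1 n) \<longlonglongrightarrow> 0" "(\<lambda>n. (\<sigma> n)\<^sup>2 / \<epsilon>2 n) \<longlonglongrightarrow> 0" "(\<lambda>n. (\<kappa> n)\<^sup>2 / \<epsilon>2 n) \<longlonglongrightarrow> 0"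
      by (rule tendsto_zero_summands)+
  qed
  \<comment> \<open>The coupling condition controls \<kappa>^2 / \<epsilon>2; as \<epsilon>2 tends
    to 0 as well, so does \<kappa>, which yields convergence of the pairs themselves.\<close>
  have \<kappa>: "\<kappa> \<longlonglongrightarrow> 0"
  proof -
    have "(\<lambda>n. sqrt ((\<kappa> n)\<^sup>2 / \<epsilon>2 n * \<epsilon>2 n)) \<longlonglongrightarrow> sqrt (0 * 0)" by (intro tendsto_intros T \<epsilon>)
    moreover have "sqrt ((\<kappa> n)\<^sup>2 / \<epsilon>2 n * \<epsilon>2 n) = \<kappa> n" for n using \<epsilon>(2)[of n] \<kappa>0[of n] by simp
    ultimately show ?thesis by simp
  qed
  \<comment> \<open>Packs the properties of one recovered pair into a predicate, so that a whole
    sequence can be chosen at once.\<close>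
  define R where "R n y' b' \<longleftrightarrow> (y', b') \<in> V_disc L (N n) (x n) \<and>
    (\<forall>j\<le>N n. norm (vector_derivative y' (at (x n j) within {0..L})) = 1 \<and> norm (b' (x n j)) = 1) \<and>
    (\<forall>t\<in>{0, L}. cont_rep L (ys n) t = cont_rep L y' t \<and> cont_rep L (wderiv L (ys n)) t = cont_rep L (wderiv L y') t \<and>
       cont_rep L (bs n) t = cont_rep L b' t) \<and>
    L2_norm L (\<lambda>t. ys n t - y' t) \<le> L * L * \<kappa> n \<and>
    L2_norm L (\<lambda>t. wderiv L (ys n) t - wderiv L y' t) \<le> L * \<kappa> n \<and>
    L2_norm L (\<lambda>t. wderiv L (wderiv L (ys n)) t - wderiv L (wderiv L y') t) \<le> \<kappa> n \<and>
    L2_norm L (\<lambda>t. bs n t - b' t) \<le> L * \<kappa> n \<and>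
    L2_norm L (\<lambda>t. wderiv L (bs n) t - wderiv L b' t) \<le> \<kappa> n \<and>
    (\<integral>t. (wderiv L y' t \<bullet> b' t)\<^sup>2 \<partial>\<mu> L) \<le> 2 * (h n)\<^sup>2 *
      ((1 + sqrt L * \<kappa> n)\<^sup>2 * (L2_norm L (wderiv L (wderiv L y')))\<^sup>2 + (L2_norm L (wderiv L b'))\<^sup>2) \<and>
    L2_norm L (\<lambda>t. wderiv L y' t \<bullet> wderiv L b' t)
      \<le> L2_norm L (\<lambda>t. wderiv L (ys n) t \<bullet> wderiv L (bs n) t) + \<kappa> n + sqrt L * \<kappa> n * L2_norm L (wderiv L b')" for n y' b'
  have "\<exists>y' b'. R n y' b'" for n
    unfolding R_def h
    by (rule recovery_pair[OF L mesh SF(1,2) frame]) (simp add: \<kappa>_def h)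
  then obtain yh bh where "\<And>n. R n (yh n) (bh n)" by metis
  note R = this[unfolded R_def]
  have disc: "(yh n, bh n) \<in> V_disc L (N n) (x n)" and nodes: "\<forall>j\<le>N n. norm (vector_derivative (yh n) (at (x n j) within {0..L})) = 1 \<and> norm (bh n (x n j)) = 1"
    and bdry: "\<forall>t\<in>{0, L}. cont_rep L (ys n) t = cont_rep L (yh n) t \<and> cont_rep L (wderiv L (ys n)) t = cont_rep L (wderiv L (yh n)) t \<and>
       cont_rep L (bs n) t = cont_rep L (bh n) t"
    and e: "L2_norm L (\<lambda>t. ys n t - yh n t) \<le> L * L * \<kappa> n"
    "L2_norm L (\<lambda>t. wderiv L (ys n) t - wderiv L (yh n) t) \<le> L * \<kappa> n"
    "L2_norm L (\<lambda>t. wderiv L (wderiv L (ys n)) t - wderiv L (wderiv L (yh n)) t) \<le> \<kappa> n"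
    "L2_norm L (\<lambda>t. bs n t - bh n t) \<le> L * \<kappa> n"
    "L2_norm L (\<lambda>t. wderiv L (bs n) t - wderiv L (bh n) t) \<le> \<kappa> n"
    and J: "(\<integral>t. (wderiv L (yh n) t \<bullet> bh n t)\<^sup>2 \<partial>\<mu> L) \<le> 2 * (h n)\<^sup>2 *
      ((1 + sqrt L * \<kappa> n)\<^sup>2 * (L2_norm L (wderiv L (wderiv L (yh n))))\<^sup>2 + (L2_norm L (wderiv L (bh n)))\<^sup>2)"
    and K: "L2_norm L (\<lambda>t. wderiv L (yh n) t \<bullet> wderiv L (bh n) t)
      \<le> L2_norm L (\<lambda>t. wderiv L (ys n) t \<bullet> wderiv L (bs n) t) + \<kappa> n + sqrt L * \<kappa> n * L2_norm L (wderiv L (bh n))" for n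
    using R[of n] by - ((elim conjE, assumption)+)
  have VV: "(yh n, bh n) \<in> V L" for n by (rule V_disc_in_V(1)[OF L mesh disc])
  have "Lbc (yh n, bh n) = lbc" for n
    using dep SFV[of n] VV[of n] bdry[of n] SFL[of n] unfolding depends_on_boundary_values_def by metis
  then have da: "(yh n, bh n) \<in> disc_admissible L Lbc lbc (N n) (x n)" for n
    using disc[of n] nodes[of n] by (simp add: disc_admissible_def)

  note D = V_wderivs[OF yb] and Ds = V_wderivs[OF SFV] and Dh = V_wderivs[OF VV]
  have s: "L2_norm L (\<lambda>t. y t - ys n t) \<le> \<sigma> n" "L2_norm L (\<lambda>t. wderiv L y t - wderiv L (ys n) t) \<le> \<sigma> n"
    "L2_norm L (\<lambda>t. wderiv L (wderiv L y) t - wderiv L (wderiv L (ys n)) t) \<le> \<sigma> n"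
    "L2_norm L (\<lambda>t. b t - bs n t) \<le> \<sigma> n" "L2_norm L (\<lambda>t. wderiv L b t - wderiv L (bs n) t) \<le> \<sigma> n"
    "L2_norm L (\<lambda>t. wderiv L (ys n) t \<bullet> wderiv L (bs n) t) \<le> \<sigma> n" for n
  proof -
    have le: "Hsob_norm 2 L (\<lambda>t. y t - ys n t) \<le> \<sigma> n" "Hsob_norm 1 L (\<lambda>t. b t - bs n t) \<le> \<sigma> n"
      "L2_norm L (\<lambda>t. wderiv L (ys n) t \<bullet> wderiv L (bs n) t) \<le> \<sigma> n"
      using SF(4)[of n] Hsob_norm_nonneg[of 2 L "\<lambda>t. y t - ys n t"] Hsob_norm_nonneg[of 1 L "\<lambda>t. b t - bs n t"]
        L2_norm_nonneg[of L "\<lambda>t. wderiv L (ys n) t \<bullet> wderiv L (bs n) t"] by linarith+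
    show "L2_norm L (\<lambda>t. wderiv L (ys n) t \<bullet> wderiv L (bs n) t) \<le> \<sigma> n" by (rule le(3))
    have "(wderiv L ^^ 2) (\<lambda>t. y t - ys n t) = wderiv L (wderiv L (\<lambda>t. y t - ys n t))" by (simp add: numeral_2_eq_2)
    then have "L2_norm L (\<lambda>t. y t - ys n t) \<le> Hsob_norm 2 L (\<lambda>t. y t - ys n t)"
      "L2_norm L (wderiv L (\<lambda>t. y t - ys n t)) \<le> Hsob_norm 2 L (\<lambda>t. y t - ys n t)"
      "L2_norm L (wderiv L (wderiv L (\<lambda>t. y t - ys n t))) \<le> Hsob_norm 2 L (\<lambda>t. y t - ys n t)"
      "L2_norm L (\<lambda>t. b t - bs n t) \<le> Hsob_norm 1 L (\<lambda>t. b t - bs n t)"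
      "L2_norm L (wderiv L (\<lambda>t. b t - bs n t)) \<le> Hsob_norm 1 L (\<lambda>t. b t - bs n t)"
      using L2_norm_le_Hsob_norm[of 0 2 L "\<lambda>t. y t - ys n t"] L2_norm_le_Hsob_norm[of 1 2 L "\<lambda>t. y t - ys n t"]
        L2_norm_le_Hsob_norm[of 2 2 L "\<lambda>t. y t - ys n t"] L2_norm_le_Hsob_norm[of 0 1 L "\<lambda>t. b t - bs n t"]
        L2_norm_le_Hsob_norm[of 1 1 L "\<lambda>t. b t - bs n t"] by simp_all
    then show "L2_norm L (\<lambda>t. y t - ys n t) \<le> \<sigma> n" "L2_norm L (\<lambda>t. wderiv L y t - wderiv L (ys n) t) \<le> \<sigma> n"
      "L2_norm L (\<lambda>t. wderiv L (wderiv L y) t - wderiv L (wderiv L (ys n)) t) \<le> \<sigma> n"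
      "L2_norm L (\<lambda>t. b t - bs n t) \<le> \<sigma> n" "L2_norm L (\<lambda>t. wderiv L b t - wderiv L (bs n) t) \<le> \<sigma> n"
      using le L2_norm_wderiv_diff(2)[OF D(8) Ds(8)] L2_norm_wderiv_diff2[OF D(9) Ds(9)] L2_norm_wderiv_diff(2)[OF D(7) Ds(7)]
      by simp_all
  qed
  have tri: "L2_norm L (\<lambda>t. f t - k t) \<le> a + c"
    if "f \<in> L2 L" "g \<in> L2 L" "k \<in> L2 L" "L2_norm L (\<lambda>t. g t - f t) \<le> a" "L2_norm L (\<lambda>t. k t - g t) \<le> c"
    for f g k :: curve and a c
  proof -
    have "L2_norm L (\<lambda>t. (f t - g t) + (g t - k t)) \<le> L2_norm L (\<lambda>t. f t - g t) + L2_norm L (\<lambda>t. g t - k t)"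
      by (rule L2_norm_triangle[OF L2_diff[OF that(1,2)] L2_diff[OF that(2,3)]])
    then show ?thesis
      using that(4,5) L2_norm_diff_le(3)[OF that(1,2)] L2_norm_diff_le(3)[OF that(2,3)] by simp
  qed
  define \<tau> where "\<tau> n = \<kappa> n + \<sigma> n" for n
  have \<tau>: "\<tau> \<longlonglongrightarrow> 0" unfolding \<tau>_def using tendsto_add[OF \<kappa> \<sigma>] by simp
  have d0: "L2_norm L (\<lambda>t. yh n t - y t) \<le> L * L * \<kappa> n + \<sigma> n" for n by (rule tri[OF Dh(5) Ds(5) D(5) e(1) s(1)])
  have d1: "L2_norm L (\<lambda>t. wderiv L (yh n) t - wderiv L y t) \<le> L * \<kappa> n + \<sigma> n" for n by (rule tri[OF Dh(3) Ds(3) D(3) e(2) s(2)])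
  have d2: "L2_norm L (\<lambda>t. wderiv L (wderiv L (yh n)) t - wderiv L (wderiv L y) t) \<le> \<tau> n" for n
    unfolding \<tau>_def by (rule tri[OF Dh(1) Ds(1) D(1) e(3) s(3)])
  have d3: "L2_norm L (\<lambda>t. bh n t - b t) \<le> L * \<kappa> n + \<sigma> n" for n by (rule tri[OF Dh(4) Ds(4) D(4) e(4) s(4)])
  have d4: "L2_norm L (\<lambda>t. wderiv L (bh n) t - wderiv L b t) \<le> \<tau> n" for n
    unfolding \<tau>_def by (rule tri[OF Dh(2) Ds(2) D(2) e(5) s(5)])
  have lim2: "(\<lambda>n. Hsob_norm 2 L (\<lambda>t. yh n t - y t)) \<longlonglongrightarrow> 0"
  proof (rule tendsto_zero_by_bound)
    show "Hsob_norm 2 L (\<lambda>t. yh n t - y t) \<le> (L * L * \<kappa> n + \<sigma> n) + (L * \<kappa> n + \<sigma> n) + \<tau> n" for n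
      using Hsob_norm_2_le[of L "\<lambda>t. yh n t - y t"] L2_norm_wderiv_diff(2)[OF Dh(8) D(8), of n]
        L2_norm_wderiv_diff2[OF Dh(9) D(9), of n] d0[of n] d1[of n] d2[of n] by linarith
    have "(\<lambda>n. (L * L * \<kappa> n + \<sigma> n) + (L * \<kappa> n + \<sigma> n) + \<tau> n) \<longlonglongrightarrow> (L * L * 0 + 0) + (L * 0 + 0) + 0"
      by (intro tendsto_intros \<kappa> \<sigma> \<tau>)
    then show "(\<lambda>n. (L * L * \<kappa> n + \<sigma> n) + (L * \<kappa> n + \<sigma> n) + \<tau> n) \<longlonglongrightarrow> 0" by simp
  qed simp
  have lim1: "(\<lambda>n. Hsob_norm 1 L (\<lambda>t. bh n t - b t)) \<longlonglongrightarrow> 0"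
  proof (rule tendsto_zero_by_bound)
    show "Hsob_norm 1 L (\<lambda>t. bh n t - b t) \<le> (L * \<kappa> n + \<sigma> n) + \<tau> n" for n
      using Hsob_norm_1_le[of L "\<lambda>t. bh n t - b t"] L2_norm_wderiv_diff(2)[OF Dh(7) D(7), of n] d3[of n] d4[of n] by linarith
    have "(\<lambda>n. (L * \<kappa> n + \<sigma> n) + \<tau> n) \<longlonglongrightarrow> (L * 0 + 0) + 0" by (intro tendsto_intros \<kappa> \<sigma> \<tau>)
    then show "(\<lambda>n. (L * \<kappa> n + \<sigma> n) + \<tau> n) \<longlonglongrightarrow> 0" by simp
  qed (rule Hsob_norm_nonneg)

  let ?A = "L2_norm L (wderiv L (wderiv L y))" and ?B = "L2_norm L (wderiv L b)"
  let ?An = "\<lambda>n. L2_norm L (wderiv L (wderiv L (yh n)))" and ?Bn = "\<lambda>n. L2_norm L (wderiv L (bh n))"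
  have nA: "?An n \<le> ?A + \<tau> n" and nB: "?Bn n \<le> ?B + \<tau> n" for n
    using L2_norm_diff_le(2)[OF Dh(1) D(1), of n] L2_norm_diff_le(2)[OF Dh(2) D(2), of n] d2[of n] d4[of n] by linarith+
  have \<tau>0: "0 \<le> \<tau> n" for n using d2[of n] L2_norm_nonneg order_trans by blast
  have "(\<lambda>n. energy L (yh n, bh n)) \<longlonglongrightarrow> energy L (y, b)"
  proof -
    have "(\<lambda>n. \<bar>energy L (yh n, bh n) - energy L (y, b)\<bar>) \<longlonglongrightarrow> 0"
    proof (rule tendsto_zero_by_bound)
      show "\<bar>energy L (yh n, bh n) - energy L (y, b)\<bar> \<le> \<tau> n * ((?A + \<tau> n) + ?A) + 4 * (\<tau> n * ((?B + \<tau> n) + ?B))" for n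
        using d2[of n] d4[of n] nA[of n] nB[of n] \<tau>0[of n]
        by (intro order_trans[OF energy_difference[OF VV yb]] add_mono mult_mono mult_left_mono) auto
      have "(\<lambda>n. \<tau> n * ((?A + \<tau> n) + ?A) + 4 * (\<tau> n * ((?B + \<tau> n) + ?B))) \<longlonglongrightarrow> 0 * ((?A + 0) + ?A) + 4 * (0 * ((?B + 0) + ?B))"
        by (intro tendsto_intros \<tau>)
      then show "(\<lambda>n. \<tau> n * ((?A + \<tau> n) + ?A) + 4 * (\<tau> n * ((?B + \<tau> n) + ?B))) \<longlonglongrightarrow> 0" by simp
    qed simp
    then show ?thesis by (simp add: tendsto_rabs_zero_iff LIM_zero_iff)
  qed
  moreover have "(\<lambda>n. energy_disc L (m (\<delta> n)) (\<epsilon>1 n) (\<epsilon>2 n) (yh n, bh n) - energy L (yh n, bh n)) \<longlonglongrightarrow> 0"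
  proof -
    let ?J = "\<lambda>n. \<integral>t. (wderiv L (yh n) t \<bullet> bh n t)\<^sup>2 \<partial>\<mu> L" and ?K = "\<lambda>n. \<integral>t. (wderiv L (yh n) t \<bullet> wderiv L (bh n) t)\<^sup>2 \<partial>\<mu> L"
    \<comment> \<open>The bracket stays bounded, since the discrete norms are at most those of the
      limit plus \<open>\<tau> n\<close>; the prefactor h^2 / \<epsilon>1 tends to 0. The bound
      \<open>?kb\<close> has the same structure with the prefactor \<kappa>^2 / \<epsilon>2.\<close>
    let ?jb = "\<lambda>n. (h n)\<^sup>2 / \<epsilon>1 n * ((1 + sqrt L * \<kappa> n)\<^sup>2 * (?A + \<tau> n)\<^sup>2 + (?B + \<tau> n)\<^sup>2)"
    let ?c = "\<lambda>n. 1 + sqrt L * (?B + \<tau> n)"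
    let ?kb = "\<lambda>n. (\<sigma> n)\<^sup>2 / \<epsilon>2 n + (\<kappa> n)\<^sup>2 / \<epsilon>2 n * (?c n)\<^sup>2"
    have jb: "?J n / (2 * \<epsilon>1 n) \<le> ?jb n" for n
    proof -
      have "?J n \<le> 2 * (h n)\<^sup>2 * ((1 + sqrt L * \<kappa> n)\<^sup>2 * (?A + \<tau> n)\<^sup>2 + (?B + \<tau> n)\<^sup>2)"
        using nA[of n] nB[of n] by (intro order_trans[OF J] mult_left_mono add_mono power_mono) auto
      then have "?J n / (2 * \<epsilon>1 n) \<le> (2 * (h n)\<^sup>2 * ((1 + sqrt L * \<kappa> n)\<^sup>2 * (?A + \<tau> n)\<^sup>2 + (?B + \<tau> n)\<^sup>2)) / (2 * \<epsilon>1 n)"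
        using \<epsilon>(1)[of n] by (intro divide_right_mono) auto
      then show ?thesis by simp
    qed
    have kb: "?K n / (2 * \<epsilon>2 n) \<le> ?kb n" for n
    proof -
      have "L2_norm L (\<lambda>t. wderiv L (yh n) t \<bullet> wderiv L (bh n) t) \<le> \<sigma> n + \<kappa> n + sqrt L * \<kappa> n * (?B + \<tau> n)"
        using s(6)[of n] nB[of n] \<kappa>0[of n] L by (intro order_trans[OF K] add_mono mult_left_mono) auto
      also have "\<dots> = \<sigma> n + \<kappa> n * ?c n" by (simp add: algebra_simps)
      finally have "(L2_norm L (\<lambda>t. wderiv L (yh n) t \<bullet> wderiv L (bh n) t))\<^sup>2 \<le> (\<sigma> n + \<kappa> n * ?c n)\<^sup>2"
        by (rule power_mono) simp
      also have "\<dots> \<le> 2 * (\<sigma> n)\<^sup>2 + 2 * (\<kappa> n * ?c n)\<^sup>2"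
        using zero_le_power2[of "\<sigma> n - \<kappa> n * ?c n"] unfolding power2_sum power2_diff by linarith
      finally have "?K n \<le> 2 * ((\<sigma> n)\<^sup>2 + (\<kappa> n)\<^sup>2 * (?c n)\<^sup>2)"
        by (simp add: L2_norm_power2 power_mult_distrib)
      then have "?K n / (2 * \<epsilon>2 n) \<le> (2 * ((\<sigma> n)\<^sup>2 + (\<kappa> n)\<^sup>2 * (?c n)\<^sup>2)) / (2 * \<epsilon>2 n)"
        using \<epsilon>(2)[of n] by (intro divide_right_mono) auto
      then show ?thesis by (simp add: add_divide_distrib)
    qed
    have "(\<lambda>n. \<bar>energy_disc L (m (\<delta> n)) (\<epsilon>1 n) (\<epsilon>2 n) (yh n, bh n) - energy L (yh n, bh n)\<bar>) \<longlonglongrightarrow> 0"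
    proof (rule tendsto_zero_by_bound)
      show "\<bar>energy_disc L (m (\<delta> n)) (\<epsilon>1 n) (\<epsilon>2 n) (yh n, bh n) - energy L (yh n, bh n)\<bar> \<le> 5 / 2 * (cuni * \<delta> n) * L + ?jb n + ?kb n" for n
        using energy_disc_split(4)[OF L rm c0 \<delta>(1) VV \<epsilon>(1,2), of n n n n] jb[of n] kb[of n] by linarith
      have "(\<lambda>n. 5 / 2 * (cuni * \<delta> n) * L + ?jb n + ?kb n) \<longlonglongrightarrow> 5 / 2 * (cuni * 0) * L
          + 0 * ((1 + sqrt L * 0)\<^sup>2 * (?A + 0)\<^sup>2 + (?B + 0)\<^sup>2) + (0 + 0 * (1 + sqrt L * (?B + 0))\<^sup>2)"
        by (intro tendsto_intros \<delta> T \<kappa> \<tau>)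
      then show "(\<lambda>n. 5 / 2 * (cuni * \<delta> n) * L + ?jb n + ?kb n) \<longlonglongrightarrow> 0" by simp
    qed simp
    then show ?thesis by (simp add: tendsto_rabs_zero_iff)
  qed
  ultimately have "(\<lambda>n. energy_disc L (m (\<delta> n)) (\<epsilon>1 n) (\<epsilon>2 n) (yh n, bh n)) \<longlonglongrightarrow> energy L (y, b)"
    using tendsto_add by fastforce
  then show ?thesis using da lim1 lim2 by blast
qed

text \<open>Admissibility of the limit is tied to a finite lower limit because orthogonality is
  enforced by the penalties only: for matching boundary data, a straight curve with a constant unit
  \<open>b\<close> that is not orthogonal to its tangent meets all nodal constraints on every mesh,
  with energies of order 1 / \<epsilon>1. The energy inequality is free of this premise.\<close>

theorem proposition4p1:
  fixes L :: real
    and Lbc :: "curve \<times> curve \<Rightarrow> 'z::real_normed_vector" and lbc :: 'z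
    and m :: "real \<Rightarrow> real \<Rightarrow> real" and c0 c1 c2 cuni :: real
    and N :: "nat \<Rightarrow> nat" and x :: "nat \<Rightarrow> nat \<Rightarrow> real" and h :: "nat \<Rightarrow> real"
    and \<epsilon>1 \<epsilon>2 \<delta> :: "nat \<Rightarrow> real"
  assumes "L > 0"
    and "bounded_linear_V L Lbc" and "depends_on_boundary_values L Lbc"
    and "c0 > 0" and "regularized_modulus m c0 c1 c2 cuni"
    and "quasiuniform_family L N x"
    and "\<And>n. h n = mesh_size (N n) (x n)" and "h \<longlonglongrightarrow> 0"
    and "\<And>n. \<epsilon>1 n > 0" and "\<epsilon>1 \<longlonglongrightarrow> 0"
    and "\<And>n. \<epsilon>2 n > 0" and "\<epsilon>2 \<longlonglongrightarrow> 0"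
    and "\<And>n. \<delta> n > 0" and "\<delta> \<longlonglongrightarrow> 0"
  shows
    "(\<forall>y b \<sigma> ys bs.
        (y, b) \<in> admissible L Lbc lbc \<and>
        (\<forall>n. \<sigma> n > 0) \<and> \<sigma> \<longlonglongrightarrow> 0 \<and>
        (\<forall>n. smooth_frame_approx L Lbc lbc (\<sigma> n) (y, b) (ys n, bs n)) \<and>
        (\<lambda>n. (h n)\<^sup>2 / \<epsilon>1 n + (\<sigma> n)\<^sup>2 / \<epsilon>2 n
              + (h n)\<^sup>2 * (frame_size L (ys n, bs n))\<^sup>2 / \<epsilon>2 n) \<longlonglongrightarrow> 0
        \<longrightarrow>
        (\<exists>yh bh.
           (\<forall>n. (yh n, bh n) \<in> disc_admissible L Lbc lbc (N n) (x n)) \<and>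
           (\<lambda>n. Hsob_norm 2 L (\<lambda>t. yh n t - y t)) \<longlonglongrightarrow> 0 \<and>
           (\<lambda>n. Hsob_norm 1 L (\<lambda>t. bh n t - b t)) \<longlonglongrightarrow> 0 \<and>
           (\<lambda>n. energy_disc L (m (\<delta> n)) (\<epsilon>1 n) (\<epsilon>2 n) (yh n, bh n)) \<longlonglongrightarrow> energy L (y, b)))
     \<and>
     (\<forall>y b yh bh.
        (y, b) \<in> V L \<and>
        (\<forall>n. (yh n, bh n) \<in> disc_admissible L Lbc lbc (N n) (x n)) \<and>
        (\<exists>C. \<forall>n. V_norm L (yh n, bh n) \<le> C) \<and>
        weakly_converges_V L (\<lambda>n. (yh n, bh n)) (y, b)
        \<longrightarrow>
        (liminf (\<lambda>n. ereal (energy_disc L (m (\<delta> n)) (\<epsilon>1 n) (\<epsilon>2 n) (yh n, bh n))) < \<infinity>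
           \<longrightarrow> (y, b) \<in> admissible L Lbc lbc) \<and>
        ereal (energy L (y, b))
          \<le> liminf (\<lambda>n. ereal (energy_disc L (m (\<delta> n)) (\<epsilon>1 n) (\<epsilon>2 n) (yh n, bh n))))"
proof -
  have mesh: "mesh L (N n) (x n)" for n
    using assms(6) by (simp add: quasiuniform_family_def)
  have h: "(\<lambda>n. mesh_size (N n) (x n)) \<longlonglongrightarrow> 0"
    using assms(8) unfolding assms(7)[symmetric] .
  show ?thesis
  proof (intro conjI allI impI)
    fix y b \<sigma> ys bs
    assume *: "(y, b) \<in> admissible L Lbc lbc \<and>
        (\<forall>n. \<sigma> n > 0) \<and> \<sigma> \<longlonglongrightarrow> 0 \<and>
        (\<forall>n. smooth_frame_approx L Lbc lbc (\<sigma> n) (y, b) (ys n, bs n)) \<and>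
        (\<lambda>n. (h n)\<^sup>2 / \<epsilon>1 n + (\<sigma> n)\<^sup>2 / \<epsilon>2 n
              + (h n)\<^sup>2 * (frame_size L (ys n, bs n))\<^sup>2 / \<epsilon>2 n) \<longlonglongrightarrow> 0"
    have "(y, b) \<in> V L" using * by (auto simp: admissible_def A_frame_def)
    moreover have "smooth_frame_approx L Lbc lbc (\<sigma> n) (y, b) (ys n, bs n)" for n using * by blast
    ultimately show "\<exists>yh bh.
           (\<forall>n. (yh n, bh n) \<in> disc_admissible L Lbc lbc (N n) (x n)) \<and>
           (\<lambda>n. Hsob_norm 2 L (\<lambda>t. yh n t - y t)) \<longlonglongrightarrow> 0 \<and>
           (\<lambda>n. Hsob_norm 1 L (\<lambda>t. bh n t - b t)) \<longlonglongrightarrow> 0 \<and>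
           (\<lambda>n. energy_disc L (m (\<delta> n)) (\<epsilon>1 n) (\<epsilon>2 n) (yh n, bh n)) \<longlonglongrightarrow> energy L (y, b)"
      using * by (intro recovery_sequence[OF assms(1,3,4,5) mesh assms(7,9,11,12,13,14)]) auto
  next
    fix y b yh bh
    assume *: "(y, b) \<in> V L \<and>
        (\<forall>n. (yh n, bh n) \<in> disc_admissible L Lbc lbc (N n) (x n)) \<and>
        (\<exists>C. \<forall>n. V_norm L (yh n, bh n) \<le> C) \<and>
        weakly_converges_V L (\<lambda>n. (yh n, bh n)) (y, b)"
    then obtain C where "\<forall>n. V_norm L (yh n, bh n) \<le> C" by blast
    then have C: "V_norm L (yh n, bh n) \<le> C" for n by blast
    have yb: "(y, b) \<in> V L" and da: "(yh n, bh n) \<in> disc_admissible L Lbc lbc (N n) (x n)"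
      and w: "weakly_converges_V L (\<lambda>n. (yh n, bh n)) (y, b)" for n
      using * by blast+
    note limit = liminf_inequality[OF assms(1-5) mesh h assms(9-14) yb da C w]
    show "ereal (energy L (y, b))
          \<le> liminf (\<lambda>n. ereal (energy_disc L (m (\<delta> n)) (\<epsilon>1 n) (\<epsilon>2 n) (yh n, bh n)))"
      by (rule limit(2))
    assume "liminf (\<lambda>n. ereal (energy_disc L (m (\<delta> n)) (\<epsilon>1 n) (\<epsilon>2 n) (yh n, bh n))) < \<infinity>"
    then show "(y, b) \<in> admissible L Lbc lbc" by (rule limit(1))
  qed
qed

end
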